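(* Let $X$ be a local compactum and let $|X|$ be the space constructed from any admissible choice of data $(M,u,H,d)$ for $X$ (see context). For every map $f\colon A\to |X|$ and every FDR-embedding $i\colon A\to W$ with $W$ (and then also $A$) locally compact metrizable, there is a map $f'\colon W\to |X|$ such that $f'\circ i\simeq f$ (homotopic). Moreover, any two such maps $f'$ are homotopic.
   Context: All spaces are metrizable topological spaces and all maps are continuous. A local compactum is a locally compact separable metrizable space. An absolute retract (AR) is a metrizable space $M$ such that for every metrizable space $Z$ and closed $A\subseteq Z$, every map $A\to M$ extends to a map $Z\to M$. A closed subset $X\subseteq M$ is homotopy negligible in $M$ if there is a homotopy $H\colon M\times[0,1]\to M$ with $H_0=\mathrm{id}_M$ and $H(M\times(0,1])\subseteq M\setminus X$; such $H$ is additive if $H_s\circ H_t=H_{\min\{s+t,1\}}$ for all $s,t\in[0,1]$. If $X,Y$ are closed homotopy negligible subsets of spaces $M,N$, a continuous map $\phi\colon M\setminus X\to N\setminus Y$ is $X$-$Y$-approaching if for every sequence in $M\setminus X$ converging in $M$ to a point of $X$, its image has a subsequence converging in $N$ to a point of $Y$. FDR-embedding. For a closed subset $A$ of a space $W$, the inclusion $A\subseteq W$ is an FDR-embedding if there exist an AR $N$ containing $W$ as a closed homotopy negligible subset, a closed subset $L\subseteq N$ which is an AR with $L\cap W=A$ and $A$ homotopy negligible in $L$, and a $(W\times[0,1])$-$W$-approaching map $\Phi\colon (N\setminus W)\times[0,1]\to N\setminus W$ with $\Phi_0=\mathrm{id}$, $\Phi_1(N\setminus W)=L\setminus A$, and $\Phi_t|_{L\setminus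 A}=\mathrm{id}$ for all $t$. A map $i\colon A\to W$ is an FDR-embedding if it is a closed embedding and the inclusion $i(A)\subseteq W$ is an FDR-embedding. Exhaustion function on $M$: a continuous $u\colon M\to(0,1]$ such that $u(x_n)\to 0$ for every sequence $(x_n)$ in $M$ with no accumulation point in $M$. Admissible data for $X$: a locally compact separable AR $M$ containing $X$ as a closed subset, an exhaustion function $u$ on $M$, an additive homotopy $H\colon M\times[0,1]\to M$ with $H_0=\mathrm{id}_M$, $H(M\times(0,1])\subseteq M\setminus X$ and $u(H(m,s))\ge u(m)$ for all $m,s$, and a metric $d$ giving the topology of $M$. (Such data always exist.) Construction of $|M|$ and $|X|$. On the set $M/X$ (with $X$ collapsed to a point $\{X\}$) use the metric $d_{M/X}(m,\{X\})=d(m,X)$, $d_{M/X}(m,m')=\min\{d(m,m'),d(m,X)+d(m',X)\}$ for $m,m'\in M\setminus X$. For $\varepsilon\in(0,1]$ let $M_\varepsilon=u^{-1}([\varepsilon,1])$ (compact) and $X_\varepsilon=M_\varepsilon\cap X$, and regard $M_\varepsilon/X_\varepsilon$ as a subset of $M/X$. Let $|M_\varepsilon|$ be the set of continuous paths $\gamma\colon[0,1]\to M_\varepsilon/X_\varepsilon$ with $\gamma((0,1])\subseteq M_\varepsilon\setminus X_\varepsilon$, with the uniform metric $d_{|M_\varepsilon|}(\gamma,\gamma')=\sup_t d_{M/X}(\gamma(t),\gamma'(t))$, and $|X_\varepsilon|\subseteq|M_\varepsilon|$ the subset of those $\gamma$ with $\gamma(0)=\{X_\varepsilon\}$ (the collapsed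 point). For $\varepsilon>\varepsilon'$ there is an isometric inclusion $|M_\varepsilon|\subseteq|M_{\varepsilon'}|$. Put $|M|=\bigcup_{\varepsilon\in(0,1]}\{\varepsilon\}\times|M_\varepsilon|$ with metric $d_{|M|}((\varepsilon,\gamma),(\varepsilon',\gamma'))=|\varepsilon-\varepsilon'|+d_{|M_{\min\{\varepsilon,\varepsilon'\}}|}(\gamma,\gamma')$, and let $|X|=\bigcup_{\varepsilon\in(0,1]}\{\varepsilon\}\times|X_\varepsilon|\subseteq|M|$. *)

theory Defs
  imports "HOL-Analysis.Analysis"
begin

abbreviation I01 :: "real topology" where
  "I01 \<equiv> top_of_set {0..1}"

text \<open>
  HOL cannot quantify over types inside a definition, so the test spaces \<open>Z\<close> range over all
  metrizable topologies carried by subsets of the type \<^typ>\<open>'m \<Rightarrow> real\<close>. This is no loss: \<open>M\<close> embeds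
  as a closed subset of a convex set \<open>K\<close> of bounded real functions on \<open>M\<close>
  (Kuratowski--Wojdyslawski), and \<open>K\<close> is carried by a subset of \<^typ>\<open>'m \<Rightarrow> real\<close>. So the property
  below makes \<open>M\<close> a retract of \<open>K\<close>, and then the Dugundji extension theorem yields the extension
  property for metrizable \<open>Z\<close> over every type.
\<close>

definition absolute_retract :: "'m topology \<Rightarrow> bool" where
  "absolute_retract M \<longleftrightarrow>
     metrizable_space M \<and>
     (\<forall>(Z :: ('m \<Rightarrow> real) topology) A f.
        metrizable_space Z \<and> closedin Z A \<and> continuous_map (subtopology Z A) M f \<longrightarrow>
        (\<exists>g. continuous_map Z M g \<and> (\<forall>z\<in>A. g z = f z)))"

definition local_compactum :: "'m topology \<Rightarrow> bool" where
  "local_compactum X \<longleftrightarrow> metrizable_space X \<and> locally_compact_space X \<and> separable_space X"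

definition instant_homotopy :: "'m topology \<Rightarrow> 'm set \<Rightarrow> ('m \<times> real \<Rightarrow> 'm) \<Rightarrow> bool" where
  "instant_homotopy M X H \<longleftrightarrow>
     continuous_map (prod_topology M I01) M H \<and>
     (\<forall>m\<in>topspace M. H (m, 0) = m) \<and>
     H ` (topspace M \<times> {0<..1}) \<subseteq> topspace M - X"

definition homotopy_negligible :: "'m topology \<Rightarrow> 'm set \<Rightarrow> bool" where
  "homotopy_negligible M X \<longleftrightarrow> closedin M X \<and> (\<exists>H. instant_homotopy M X H)"

definition additive_homotopy :: "'m topology \<Rightarrow> ('m \<times> real \<Rightarrow> 'm) \<Rightarrow> bool" where
  "additive_homotopy M H \<longleftrightarrow>
     (\<forall>s\<in>{0..1}. \<forall>t\<in>{0..1}. \<forall>m\<in>topspace M. H (H (m, t), s) = H (m, min (s + t) 1))"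

definition approaching ::
    "'m topology \<Rightarrow> 'm set \<Rightarrow> 'n topology \<Rightarrow> 'n set \<Rightarrow> ('m \<Rightarrow> 'n) \<Rightarrow> bool" where
  "approaching M X N Y \<phi> \<longleftrightarrow>
     continuous_map (subtopology M (topspace M - X)) (subtopology N (topspace N - Y)) \<phi> \<and>
     (\<forall>\<sigma> x. range \<sigma> \<subseteq> topspace M - X \<and> x \<in> X \<and> limitin M \<sigma> x sequentially \<longrightarrow>
        (\<exists>r y. strict_mono (r :: nat \<Rightarrow> nat) \<and> y \<in> Y \<and> limitin N (\<phi> \<circ> \<sigma> \<circ> r) y sequentially))"

text \<open>
  The type of the ambient AR \<open>N\<close> is made explicit by the first argument, since it cannot be
  quantified existentially; a theorem assuming \<open>fdr_inclusion TYPE('n) W A\<close> for a type variable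
  \<^typ>\<open>'n\<close> covers every \<open>N\<close>. As \<open>N\<close> and \<open>W\<close> live on different types, \<open>W\<close> is identified with its
  image under an embedding \<open>j\<close>.
\<close>

definition fdr_inclusion :: "'n itself \<Rightarrow> 'w topology \<Rightarrow> 'w set \<Rightarrow> bool" where
  "fdr_inclusion _ W A \<longleftrightarrow>
     closedin W A \<and>
     (\<exists>(N :: 'n topology) j W' A' L \<Phi>.
        embedding_map W N j \<and> W' = j ` topspace W \<and> A' = j ` A \<and>
        absolute_retract N \<and> homotopy_negligible N W' \<and>
        closedin N L \<and> absolute_retract (subtopology N L) \<and> L \<inter> W' = A' \<and>
        homotopy_negligible (subtopology N L) A' \<and>
        approaching (prod_topology N I01) (W' \<times> {0..1}) N W' \<Phi> \<and>
        (\<forall>x\<in>topspace N - W'. \<Phi> (x, 0) = x) \<and>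
        (\<lambda>x. \<Phi> (x, 1)) ` (topspace N - W') = L - A' \<and>
        (\<forall>t\<in>{0..1}. \<forall>x\<in>L - A'. \<Phi> (x, t) = x))"

definition fdr_embedding :: "'n itself \<Rightarrow> 'a topology \<Rightarrow> 'w topology \<Rightarrow> ('a \<Rightarrow> 'w) \<Rightarrow> bool" where
  "fdr_embedding T A W i \<longleftrightarrow>
     embedding_map A W i \<and> closedin W (i ` topspace A) \<and> fdr_inclusion T W (i ` topspace A)"

definition accumulation_point :: "'m topology \<Rightarrow> (nat \<Rightarrow> 'm) \<Rightarrow> 'm \<Rightarrow> bool" where
  "accumulation_point M x p \<longleftrightarrow>
     p \<in> topspace M \<and> (\<forall>U. openin M U \<and> p \<in> U \<longrightarrow> infinite {n. x n \<in> U})"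

definition exhaustion :: "'m topology \<Rightarrow> ('m \<Rightarrow> real) \<Rightarrow> bool" where
  "exhaustion M u \<longleftrightarrow>
     continuous_map M (top_of_set {0<..1}) u \<and>
     (\<forall>x. range x \<subseteq> topspace M \<and> (\<nexists>p. accumulation_point M x p) \<longrightarrow> (\<lambda>n. u (x n)) \<longlonglongrightarrow> 0)"

definition admissible_data ::
    "'m topology \<Rightarrow> 'm set \<Rightarrow> ('m \<Rightarrow> real) \<Rightarrow> ('m \<times> real \<Rightarrow> 'm) \<Rightarrow> 'm metric \<Rightarrow> bool" where
  "admissible_data M X u H d \<longleftrightarrow>
     absolute_retract M \<and> locally_compact_space M \<and> separable_space M \<and>
     closedin M X \<and>
     exhaustion M u \<and>
     instant_homotopy M X H \<and> additive_homotopy M H \<and>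
     (\<forall>m\<in>topspace M. \<forall>s\<in>{0..1}. u (H (m, s)) \<ge> u m) \<and>
     mtopology_of d = M"

text \<open>
  Points of \<open>M/X\<close>: \<^term>\<open>None\<close> is the collapsed point \<open>{X}\<close>, and \<^term>\<open>Some m\<close> is a point
  \<open>m\<close> outside \<open>X\<close>. Then \<open>M\<^sub>\<epsilon>/X\<^sub>\<epsilon>\<close> is \<open>collapse X ` M\<^sub>\<epsilon>\<close>, which contains \<^term>\<open>None\<close> only if \<open>X\<^sub>\<epsilon>\<close>
  is nonempty.
\<close>

definition collapse :: "'m set \<Rightarrow> 'm \<Rightarrow> 'm option" where
  "collapse X m = (if m \<in> X then None else Some m)"

text \<open>For empty \<open>X\<close> nothing is collapsed: \<open>M/X = M\<close> as metric spaces, and the value of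
  \<^term>\<open>dist_to\<close> is immaterial.\<close>

definition dist_to :: "'m metric \<Rightarrow> 'm set \<Rightarrow> 'm \<Rightarrow> real" where
  "dist_to d X m = (if X = {} then 0 else INF x\<in>X. mdist d m x)"

fun quot_dist :: "'m metric \<Rightarrow> 'm set \<Rightarrow> 'm option \<Rightarrow> 'm option \<Rightarrow> real" where
  "quot_dist d X None None = 0"
| "quot_dist d X (Some m) None = dist_to d X m"
| "quot_dist d X None (Some m) = dist_to d X m"
| "quot_dist d X (Some m) (Some m') =
     (if X = {} then mdist d m m' else min (mdist d m m') (dist_to d X m + dist_to d X m'))"

definition quot_metric :: "'m metric \<Rightarrow> 'm set \<Rightarrow> 'm option metric" where
  "quot_metric d X = metric (collapse X ` mspace d, quot_dist d X)"

definition level :: "'m metric \<Rightarrow> ('m \<Rightarrow> real) \<Rightarrow> real \<Rightarrow> 'm set" where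
  "level d u \<epsilon> = {m \<in> mspace d. u m \<in> {\<epsilon>..1}}"

text \<open>
  The uniform metric on all paths in \<open>M/X\<close>. All the sets \<open>|M\<^sub>\<epsilon>|\<close> are subsets of this one metric
  space, so the inclusions \<open>|M\<^sub>\<epsilon>| \<subseteq> |M\<^sub>\<epsilon>\<^sub>'|\<close> are isometric by construction.
\<close>

abbreviation path_metric :: "'m metric \<Rightarrow> 'm set \<Rightarrow> (real \<Rightarrow> 'm option) metric" where
  "path_metric d X \<equiv> cfunspace I01 (quot_metric d X)"

definition M_eps_paths :: "'m metric \<Rightarrow> 'm set \<Rightarrow> ('m \<Rightarrow> real) \<Rightarrow> real \<Rightarrow> (real \<Rightarrow> 'm option) set" where
  "M_eps_paths d X u \<epsilon> =
     {\<gamma> \<in> mspace (path_metric d X).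
        \<gamma> ` {0..1} \<subseteq> collapse X ` level d u \<epsilon> \<and>
        \<gamma> ` {0<..1} \<subseteq> Some ` (level d u \<epsilon> - X)}"

definition X_eps_paths :: "'m metric \<Rightarrow> 'm set \<Rightarrow> ('m \<Rightarrow> real) \<Rightarrow> real \<Rightarrow> (real \<Rightarrow> 'm option) set" where
  "X_eps_paths d X u \<epsilon> = {\<gamma> \<in> M_eps_paths d X u \<epsilon>. \<gamma> 0 = None}"

definition bar_M :: "'m metric \<Rightarrow> 'm set \<Rightarrow> ('m \<Rightarrow> real) \<Rightarrow> (real \<times> (real \<Rightarrow> 'm option)) set" where
  "bar_M d X u = (SIGMA \<epsilon>:{0<..1}. M_eps_paths d X u \<epsilon>)"

definition bar_X :: "'m metric \<Rightarrow> 'm set \<Rightarrow> ('m \<Rightarrow> real) \<Rightarrow> (real \<times> (real \<Rightarrow> 'm option)) set" where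
  "bar_X d X u = (SIGMA \<epsilon>:{0<..1}. X_eps_paths d X u \<epsilon>)"

definition bar_M_metric ::
    "'m metric \<Rightarrow> 'm set \<Rightarrow> ('m \<Rightarrow> real) \<Rightarrow> (real \<times> (real \<Rightarrow> 'm option)) metric" where
  "bar_M_metric d X u =
     metric (bar_M d X u,
             \<lambda>(\<epsilon>, \<gamma>) (\<epsilon>', \<gamma>'). \<bar>\<epsilon> - \<epsilon>'\<bar> + mdist (path_metric d X) \<gamma> \<gamma>')"

definition bar_X_topology ::
    "'m metric \<Rightarrow> 'm set \<Rightarrow> ('m \<Rightarrow> real) \<Rightarrow> (real \<times> (real \<Rightarrow> 'm option)) topology" where
  "bar_X_topology d X u = subtopology (mtopology_of (bar_M_metric d X u)) (bar_X d X u)"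

subsection \<open>The metrics are as intended\<close>

lemma dist_to_bdd: "bdd_below ((\<lambda>x. mdist d m x) ` X)"
  by (rule bdd_belowI[where m=0]) auto

lemma dist_to_nonneg: "0 \<le> dist_to d X m"
  by (auto simp: dist_to_def intro!: cINF_greatest)

lemma dist_to_triangle:
  assumes "m \<in> mspace d" "m' \<in> mspace d" "X \<subseteq> mspace d" "X \<noteq> {}"
  shows "dist_to d X m \<le> mdist d m m' + dist_to d X m'"
proof -
  have "dist_to d X m - mdist d m m' \<le> mdist d m' x" if "x \<in> X" for x
  proof -
    have "dist_to d X m \<le> mdist d m x"
      using that by (auto simp: dist_to_def intro!: cINF_lower[OF dist_to_bdd])
    also have "\<dots> \<le> mdist d m m' + mdist d m' x"
      using assms that by (intro mdist_triangle) auto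
    finally show ?thesis by simp
  qed
  then have "dist_to d X m - mdist d m m' \<le> dist_to d X m'"
    unfolding dist_to_def[of d X m'] using assms by (auto intro!: cINF_greatest)
  then show ?thesis by simp
qed

lemma dist_to_pos:
  assumes X: "closedin (mtopology_of d) X" "X \<noteq> {}" and m: "m \<in> mspace d" "m \<notin> X"
  shows "0 < dist_to d X m"
proof -
  interpret Metric_space "mspace d" "mdist d" by simp
  obtain r where r: "r > 0" "disjnt X (mball m r)"
    using X m unfolding mtopology_of_def closedin_metric by blast
  have sub: "X \<subseteq> mspace d" using closedin_subset[OF X(1)] by simp
  have "r \<le> mdist d m x" if "x \<in> X" for x
    using that r m sub by (force simp: disjnt_iff)
  then have "r \<le> dist_to d X m"
    using X by (auto simp: dist_to_def intro!: cINF_greatest)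
  with r show ?thesis by simp
qed

lemma Metric_space_quot:
  assumes X: "closedin (mtopology_of d) X"
  shows "Metric_space (collapse X ` mspace d) (quot_dist d X)"
proof -
  have sub: "X \<subseteq> mspace d" using closedin_subset[OF X] by simp
  have el: "(p = None \<and> X \<noteq> {}) \<or> (\<exists>m. p = Some m \<and> m \<in> mspace d \<and> m \<notin> X)"
    if "p \<in> collapse X ` mspace d" for p
    using that by (auto simp: collapse_def split: if_splits)
  have t: "mdist d a c \<le> mdist d a b + mdist d b c"
    if "a \<in> mspace d" "b \<in> mspace d" "c \<in> mspace d" for a b c
    using that by (rule mdist_triangle)
  show ?thesis
  proof (cases "X = {}")
    case True
    show ?thesis
    proof
      fix x y show "0 \<le> quot_dist d X x y"
        using dist_to_nonneg True by (cases x; cases y) auto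
      show "quot_dist d X x y = quot_dist d X y x"
        using True by (cases x; cases y) (auto simp: mdist_commute)
    next
      fix x y assume "x \<in> collapse X ` mspace d" "y \<in> collapse X ` mspace d"
      then show "quot_dist d X x y = 0 \<longleftrightarrow> x = y"
        using True by (auto simp: collapse_def)
    next
      fix x y z
      assume "x \<in> collapse X ` mspace d" "y \<in> collapse X ` mspace d" "z \<in> collapse X ` mspace d"
      then show "quot_dist d X x z \<le> quot_dist d X x y + quot_dist d X y z"
        using True by (auto simp: collapse_def intro: t)
    qed
  next
    case False
    note nn = dist_to_nonneg[of d X] and pos = dist_to_pos[OF X False]
    note tri = dist_to_triangle[OF _ _ sub False]
    show ?thesis
    proof
      fix x y show "0 \<le> quot_dist d X x y"
        using nn False by (cases x; cases y) auto
      show "quot_dist d X x y = quot_dist d X y x"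
        using False by (cases x; cases y) (auto simp: mdist_commute add.commute)
    next
      fix x y assume xy: "x \<in> collapse X ` mspace d" "y \<in> collapse X ` mspace d"
      show "quot_dist d X x y = 0 \<longleftrightarrow> x = y"
      proof (cases x; cases y)
        fix a b assume [simp]: "x = Some a" "y = Some b"
        have ab: "a \<in> mspace d" "a \<notin> X" "b \<in> mspace d" "b \<notin> X"
          using el[OF xy(1)] el[OF xy(2)] by auto
        show ?thesis
          using pos[OF ab(1,2)] pos[OF ab(3,4)] mdist_zero[OF ab(1,3)] False
          by (auto simp: min_def)
      qed (use el[OF xy(1)] el[OF xy(2)] pos in force)+
    next
      fix x y z
      assume xyz: "x \<in> collapse X ` mspace d" "y \<in> collapse X ` mspace d" "z \<in> collapse X ` mspace d"
      have S: "p \<in> mspace d" if "Some p \<in> collapse X ` mspace d" for p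
        using el[OF that] by simp
      show "quot_dist d X x z \<le> quot_dist d X x y + quot_dist d X y z"
      proof (cases y)
        case None
        then show ?thesis
          using nn False by (cases x; cases z) (auto simp: min_def)
      next
        case (Some b)
        with S[of b] xyz(2) have b: "b \<in> mspace d" by simp
        have a: "dist_to d X a \<le> mdist d a b + dist_to d X b"
                "dist_to d X b \<le> mdist d a b + dist_to d X a" if "a \<in> mspace d" for a
          using tri[OF that b] tri[OF b that] by (auto simp: mdist_commute)
        show ?thesis
        proof (cases x; cases z)
          fix m n assume [simp]: "x = Some m" "z = Some n"
          have mn: "m \<in> mspace d" "n \<in> mspace d" using S xyz by auto
          show ?thesis
            using t[OF mn(1) b mn(2)] a[OF mn(1)] a[OF mn(2)] nn[of m] nn[of n] nn[of b] False Some
              mdist_commute[of d b n] mdist_nonneg[of d m b] mdist_nonneg[of d n b]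
            by (simp add: min_def)
        next
          fix m assume [simp]: "x = Some m" "z = None"
          have m: "m \<in> mspace d" using S xyz by auto
          show ?thesis
            using a[OF m] nn[of m] nn[of b] False Some by (simp add: min_def)
        next
          fix n assume [simp]: "x = None" "z = Some n"
          have n: "n \<in> mspace d" using S xyz by auto
          show ?thesis
            using a[OF n] nn[of n] nn[of b] False Some mdist_commute[of d b n] by (simp add: min_def)
        next
          assume "x = None" "z = None"
          then show ?thesis using nn[of b] Some by simp
        qed
      qed
    qed
  qed
qed

lemma
  assumes "closedin (mtopology_of d) X"
  shows mspace_quot_metric: "mspace (quot_metric d X) = collapse X ` mspace d"
    and mdist_quot_metric: "mdist (quot_metric d X) = quot_dist d X"
  using Metric_space_quot[OF assms]
  by (simp_all add: quot_metric_def Metric_space.mspace_metric Metric_space.mdist_metric)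

lemma mdist_path_metric:
  assumes "closedin (mtopology_of d) X"
    and "\<gamma> \<in> mspace (path_metric d X)" "\<gamma>' \<in> mspace (path_metric d X)"
  shows "mdist (path_metric d X) \<gamma> \<gamma>' = (SUP t\<in>{0..1}. quot_dist d X (\<gamma> t) (\<gamma>' t))"
proof -
  interpret Q: Metric_space "mspace (quot_metric d X)" "mdist (quot_metric d X)" by simp
  have "\<gamma> \<in> Q.fspace {0..1}" "\<gamma>' \<in> Q.fspace {0..1}"
    using assms(2,3) cfunspace_subset_funspace[of I01 "quot_metric d X"] by auto
  then show ?thesis
    by (simp add: mdist_cfunspace_eq_mdist_funspace Q.fdist_def
        flip: mdist_quot_metric[OF assms(1)])
qed

lemma Metric_space_bar_M:
  "Metric_space (bar_M d X u) (\<lambda>(\<epsilon>, \<gamma>) (\<epsilon>', \<gamma>'). \<bar>\<epsilon> - \<epsilon>'\<bar> + mdist (path_metric d X) \<gamma> \<gamma>')"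
proof -
  have in_path: "\<gamma> \<in> mspace (path_metric d X)" if "(\<epsilon>, \<gamma>) \<in> bar_M d X u" for \<epsilon> \<gamma>
    using that unfolding bar_M_def M_eps_paths_def by blast
  show ?thesis
  proof
    fix x y z assume xyz: "x \<in> bar_M d X u" "y \<in> bar_M d X u" "z \<in> bar_M d X u"
    obtain a \<alpha> b \<beta> c \<gamma> where [simp]: "x = (a, \<alpha>)" "y = (b, \<beta>)" "z = (c, \<gamma>)"
      by (metis surj_pair)
    have "mdist (path_metric d X) \<alpha> \<gamma> \<le>
        mdist (path_metric d X) \<alpha> \<beta> + mdist (path_metric d X) \<beta> \<gamma>"
      by (rule mdist_triangle) (use xyz in \<open>simp_all only: in_path \<open>x = _\<close> \<open>y = _\<close> \<open>z = _\<close>\<close>)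
    then show "(case x of (\<epsilon>, \<gamma>) \<Rightarrow> \<lambda>(\<epsilon>', \<gamma>'). \<bar>\<epsilon> - \<epsilon>'\<bar> + mdist (path_metric d X) \<gamma> \<gamma>') z \<le>
       (case x of (\<epsilon>, \<gamma>) \<Rightarrow> \<lambda>(\<epsilon>', \<gamma>'). \<bar>\<epsilon> - \<epsilon>'\<bar> + mdist (path_metric d X) \<gamma> \<gamma>') y +
       (case y of (\<epsilon>, \<gamma>) \<Rightarrow> \<lambda>(\<epsilon>', \<gamma>'). \<bar>\<epsilon> - \<epsilon>'\<bar> + mdist (path_metric d X) \<gamma> \<gamma>') z"
      by simp
  next
    fix x y assume xy: "x \<in> bar_M d X u" "y \<in> bar_M d X u"
    obtain a \<alpha> b \<beta> where [simp]: "x = (a, \<alpha>)" "y = (b, \<beta>)" by (metis surj_pair)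
    have "mdist (path_metric d X) \<alpha> \<beta> = 0 \<longleftrightarrow> \<alpha> = \<beta>"
      by (rule mdist_zero) (use xy in \<open>simp_all only: in_path \<open>x = _\<close> \<open>y = _\<close>\<close>)
    then show "(case x of (\<epsilon>, \<gamma>) \<Rightarrow> \<lambda>(\<epsilon>', \<gamma>'). \<bar>\<epsilon> - \<epsilon>'\<bar> + mdist (path_metric d X) \<gamma> \<gamma>') y = 0
       \<longleftrightarrow> x = y"
      by (simp add: add_nonneg_eq_0_iff)
  qed (auto simp: mdist_commute abs_minus_commute split: prod.split)
qed

lemma mspace_bar_M_metric: "mspace (bar_M_metric d X u) = bar_M d X u"
  unfolding bar_M_metric_def by (rule Metric_space.mspace_metric[OF Metric_space_bar_M])

lemma mdist_bar_M_metric: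
  "mdist (bar_M_metric d X u) (\<epsilon>, \<gamma>) (\<epsilon>', \<gamma>') = \<bar>\<epsilon> - \<epsilon>'\<bar> + mdist (path_metric d X) \<gamma> \<gamma>'"
  unfolding bar_M_metric_def by (simp add: Metric_space.mdist_metric[OF Metric_space_bar_M])

lemma topspace_bar_X_topology: "topspace (bar_X_topology d X u) = bar_X d X u"
  by (auto simp: bar_X_topology_def mspace_bar_M_metric bar_X_def bar_M_def X_eps_paths_def)

end

theory Submission
  imports Defs
begin

text \<open>
  A map \<open>f\<close> from \<open>W\<close> to the space of paths is the same, up to the choice of the levels \<open>\<epsilon>\<close>, as its
  telescope \<open>(w, t) \<mapsto> \<gamma>\<^sub>w t\<close>, an approaching map from \<open>W \<times> (0,1]\<close> to \<open>M - X\<close>; homotopies of maps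
  correspond to approaching homotopies of telescopes. If \<open>W\<close> is homotopy negligible in \<open>N\<close> with
  instant homotopy \<open>h\<close>, then \<open>\<phi> \<mapsto> \<phi> \<circ> h\<close> is a bijection from the homotopy classes of approaching maps
  \<open>N - W \<rightarrow> M - X\<close> to those of telescopes over \<open>W\<close>, because telescopes extend over a neighbourhood
  and, after a change of the parameter \<open>t\<close>, to all of \<open>N \<times> [0,1] - W \<times> 0\<close>. The same holds for \<open>A\<close>
  in \<open>L\<close>. The map \<open>\<Phi>\<close> of an FDR-embedding shows that restriction from \<open>N - W\<close> to \<open>L - A\<close> is a
  bijection on homotopy classes of approaching maps, and the theorem follows.
\<close>

section \<open>Approaching maps and their homotopies\<close>

text \<open>Convergence to the collapsed point of \<open>M/X\<close> only says that the distance to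
  \<open>X\<close> tends to 0, while an approaching map needs a subsequence converging in
  \<open>M\<close> to a point of \<open>X\<close>. The levels close this gap. Along a convergent
  sequence in \<open>|X|\<close> the levels stay away from 0, hence so does \<open>u\<close> along
  the paths, and the exhaustion property yields a convergent subsequence. Conversely, an approaching
  map cannot let \<open>u\<close> tend to 0 over a convergent sequence of base points, which leaves
  room for a continuous positive level.

  An approaching map has in general no continuous extension to the removed set: only subsequences of
  its values converge. This is why the arguments run on sequences, and why an extension supplied by
  the absolute retract \<open>M\<close> says nothing near the removed set and has to be corrected.
  The removed set is a parameter of \<open>approaching\<close>: \<open>W\<close> for maps on
  \<open>N - W\<close>, \<open>W \<times> {0}\<close> for telescopes, with a further factor
  \<open>[0,1]\<close> for homotopies. So one composition lemma and one gluing lemma serve all of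
  them.\<close>

lemma metrizable_closedin_iff_sequentially_closed:
  assumes "metrizable_space T"
  shows "closedin T C \<longleftrightarrow> C \<subseteq> topspace T \<and>
    (\<forall>\<sigma> l. range \<sigma> \<subseteq> C \<and> limitin T \<sigma> l sequentially \<longrightarrow> l \<in> C)"
proof -
  obtain S d where "Metric_space S d" "T = Metric_space.mtopology S d"
    using assms by (auto simp: metrizable_space_def)
  then show ?thesis
    using Metric_space.metric_closedin_iff_sequentially_closed[of S d C]
    by (simp add: Metric_space.topspace_mtopology)
qed

text \<open>One convergent subsequence per sequence suffices: closedness of the preimage of a closed
  set is tested on sequences inside that preimage, and the closed set contains the limit of every
  convergent subsequence of the images.\<close>

lemma continuous_map_subsequenceI:
  assumes T: "metrizable_space T" and F: "\<And>x. x \<in> topspace T \<Longrightarrow> F x \<in> topspace N"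
    and lim: "\<And>\<sigma> x. \<lbrakk>range \<sigma> \<subseteq> topspace T; limitin T \<sigma> x sequentially\<rbrakk>
        \<Longrightarrow> \<exists>r. strict_mono (r :: nat \<Rightarrow> nat) \<and> limitin N (F \<circ> \<sigma> \<circ> r) (F x) sequentially"
  shows "continuous_map T N F"
  unfolding continuous_map_closedin
proof (intro conjI allI impI)
  show "F \<in> topspace T \<rightarrow> topspace N" using F by auto
next
  fix C assume C: "closedin N C"
  show "closedin T {x \<in> topspace T. F x \<in> C}"
    unfolding metrizable_closedin_iff_sequentially_closed[OF T]
  proof (intro conjI allI impI)
    fix \<sigma> x assume *: "range \<sigma> \<subseteq> {x \<in> topspace T. F x \<in> C} \<and> limitin T \<sigma> x sequentially"
    then obtain r where r: "strict_mono (r :: nat \<Rightarrow> nat)" "limitin N (F \<circ> \<sigma> \<circ> r) (F x) sequentially"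
      using lim[of \<sigma> x] by blast
    have "F x \<in> C"
      by (rule limitin_closedin[OF r(2) C]) (use * in \<open>auto intro!: always_eventually\<close>)
    then show "x \<in> {x \<in> topspace T. F x \<in> C}"
      using * limitin_topspace by fastforce
  qed auto
qed

text \<open>Continuity off \<open>B\<close> and the condition at \<open>B\<close> become one
  statement about sequences off \<open>B\<close> with an arbitrary limit;
  \<open>approachingD\<close> is the converse. Proofs that compose or glue approaching maps can then
  treat both kinds of limit at once.\<close>

lemma approachingI:
  assumes T: "metrizable_space T"
    and maps: "\<And>x. x \<in> topspace T - B \<Longrightarrow> F x \<in> topspace N - Y"
    and lim: "\<And>\<sigma> x. \<lbrakk>range \<sigma> \<subseteq> topspace T - B; limitin T \<sigma> x sequentially\<rbrakk>
        \<Longrightarrow> \<exists>r y. strict_mono (r :: nat \<Rightarrow> nat) \<and> limitin N (F \<circ> \<sigma> \<circ> r) y sequentially \<and>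
             (x \<in> B \<longrightarrow> y \<in> Y) \<and> (x \<notin> B \<longrightarrow> y = F x)"
  shows "approaching T B N Y F"
  unfolding approaching_def
proof (intro conjI allI impI)
  show "continuous_map (subtopology T (topspace T - B)) (subtopology N (topspace N - Y)) F"
  proof (rule continuous_map_subsequenceI)
    fix \<sigma> x
    assume \<sigma>: "range \<sigma> \<subseteq> topspace (subtopology T (topspace T - B))"
      and l: "limitin (subtopology T (topspace T - B)) \<sigma> x sequentially"
    have \<sigma>': "range \<sigma> \<subseteq> topspace T - B" and l': "limitin T \<sigma> x sequentially" and x: "x \<notin> B"
      using \<sigma> l by (auto simp: limitin_subtopology)
    obtain r where r: "strict_mono (r :: nat \<Rightarrow> nat)" "limitin N (F \<circ> \<sigma> \<circ> r) (F x) sequentially"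
      using lim[OF \<sigma>' l'] x by blast
    have "F x \<in> topspace N - Y"
      using maps x limitin_topspace[OF l'] by blast
    then have "limitin (subtopology N (topspace N - Y)) (F \<circ> \<sigma> \<circ> r) (F x) sequentially"
      using r(2) maps \<sigma>' by (auto simp: limitin_subtopology intro!: always_eventually)
    then show "\<exists>r. strict_mono (r :: nat \<Rightarrow> nat) \<and>
        limitin (subtopology N (topspace N - Y)) (F \<circ> \<sigma> \<circ> r) (F x) sequentially"
      using r(1) by blast
  qed (use T maps in \<open>auto simp: metrizable_space_subtopology\<close>)
next
  fix \<sigma> x assume "range \<sigma> \<subseteq> topspace T - B \<and> x \<in> B \<and> limitin T \<sigma> x sequentially"
  then show "\<exists>r y. strict_mono (r :: nat \<Rightarrow> nat) \<and> y \<in> Y \<and> limitin N (F \<circ> \<sigma> \<circ> r) y sequentially"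
    using lim[of \<sigma> x] by blast
qed

lemma approaching_maps:
  "\<lbrakk>approaching T B N Y F; x \<in> topspace T; x \<notin> B\<rbrakk> \<Longrightarrow> F x \<in> topspace N \<and> F x \<notin> Y"
  unfolding approaching_def continuous_map_def by auto

lemma approachingD:
  assumes F: "approaching T B N Y F"
    and \<sigma>: "range \<sigma> \<subseteq> topspace T - B" "limitin T \<sigma> x sequentially"
  obtains r y where "strict_mono (r :: nat \<Rightarrow> nat)" "limitin N (F \<circ> \<sigma> \<circ> r) y sequentially"
    "x \<in> B \<longrightarrow> y \<in> Y" "x \<notin> B \<longrightarrow> y = F x"
proof (cases "x \<in> B")
  case True
  then obtain r y where "strict_mono (r :: nat \<Rightarrow> nat)" "y \<in> Y" "limitin N (F \<circ> \<sigma> \<circ> r) y sequentially"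
    using F \<sigma> unfolding approaching_def by metis
  with True show ?thesis using that[of r y] by simp
next
  case False
  have "limitin (subtopology T (topspace T - B)) \<sigma> x sequentially"
    using False \<sigma> limitin_topspace[OF \<sigma>(2)]
    by (auto simp: limitin_subtopology intro!: always_eventually)
  then have "limitin (subtopology N (topspace N - Y)) (F \<circ> \<sigma>) (F x) sequentially"
    by (rule continuous_map_limit[rotated]) (use F in \<open>simp add: approaching_def\<close>)
  then show ?thesis
    using that[of id "F x"] False by (auto simp: limitin_subtopology strict_mono_def)
qed

text \<open>The main source of explicit approaching maps: projections, reparametrisations and
  instant homotopies are continuous on the whole space, so no subsequence has to be
  extracted.\<close>

lemma approaching_continuous:
  assumes T: "metrizable_space T" and F: "continuous_map T N F"
    and "\<And>x. x \<in> topspace T \<Longrightarrow> F x \<in> Y \<longleftrightarrow> x \<in> B"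
  shows "approaching T B N Y F"
proof (rule approachingI[OF T])
  fix x assume "x \<in> topspace T - B"
  then show "F x \<in> topspace N - Y"
    using assms continuous_map_image_subset_topspace by fastforce
next
  fix \<sigma> x assume "range \<sigma> \<subseteq> topspace T - B" and l: "limitin T \<sigma> x sequentially"
  have "limitin N (F \<circ> \<sigma> \<circ> id) (F x) sequentially"
    using continuous_map_limit[OF F l] by simp
  moreover have "x \<in> B \<longrightarrow> F x \<in> Y"
    using assms(3) limitin_topspace[OF l] by blast
  ultimately show "\<exists>r y. strict_mono (r :: nat \<Rightarrow> nat) \<and> limitin N (F \<circ> \<sigma> \<circ> r) y sequentially \<and>
      (x \<in> B \<longrightarrow> y \<in> Y) \<and> (x \<notin> B \<longrightarrow> y = F x)"
    using strict_mono_id by blast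
qed

text \<open>Subsequences are extracted twice. The first limit \<open>y\<close> lies in
  \<open>Y\<close> exactly when \<open>x\<close> lies in \<open>B\<close>, so the second extraction
  falls into the matching case for \<open>G\<close>.\<close>

lemma approaching_compose:
  assumes T: "metrizable_space T"
    and F: "approaching T B N Y F" and G: "approaching N Y K Z G"
  shows "approaching T B K Z (G \<circ> F)"
proof (rule approachingI[OF T])
  fix x assume "x \<in> topspace T - B"
  then show "(G \<circ> F) x \<in> topspace K - Z"
    using approaching_maps[OF F] approaching_maps[OF G] by auto
next
  fix \<sigma> x assume \<sigma>: "range \<sigma> \<subseteq> topspace T - B" and l: "limitin T \<sigma> x sequentially"
  obtain r y where r: "strict_mono (r :: nat \<Rightarrow> nat)" "limitin N (F \<circ> \<sigma> \<circ> r) y sequentially"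
    "x \<in> B \<longrightarrow> y \<in> Y" "x \<notin> B \<longrightarrow> y = F x"
    by (rule approachingD[OF F \<sigma> l])
  have "range (F \<circ> \<sigma> \<circ> r) \<subseteq> topspace N - Y"
    using \<sigma> approaching_maps[OF F] by (fastforce simp: image_subset_iff)
  then obtain r' z where r': "strict_mono (r' :: nat \<Rightarrow> nat)"
    "limitin K (G \<circ> (F \<circ> \<sigma> \<circ> r) \<circ> r') z sequentially"
    "y \<in> Y \<longrightarrow> z \<in> Z" "y \<notin> Y \<longrightarrow> z = G y"
    by (rule approachingD[OF G _ r(2)])
  have "x \<notin> B \<Longrightarrow> y \<notin> Y"
    using r(4) approaching_maps[OF F] limitin_topspace[OF l] by simp
  then show "\<exists>r y. strict_mono (r :: nat \<Rightarrow> nat) \<and> limitin K (G \<circ> F \<circ> \<sigma> \<circ> r) y sequentially \<and>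
      (x \<in> B \<longrightarrow> y \<in> Z) \<and> (x \<notin> B \<longrightarrow> y = (G \<circ> F) x)"
    using r(3,4) r' strict_mono_o[OF r(1) r'(1)]
    by (intro exI[of _ "r \<circ> r'"] exI[of _ z] conjI impI) (simp_all add: o_assoc)
qed

lemma approaching_cong:
  assumes F: "approaching T B N Y F" and T: "metrizable_space T"
    and eq: "\<And>x. x \<in> topspace T - B \<Longrightarrow> F x = G x"
  shows "approaching T B N Y G"
proof (rule approachingI[OF T])
  fix x assume "x \<in> topspace T - B"
  then show "G x \<in> topspace N - Y"
    using approaching_maps[OF F] eq by auto
next
  fix \<sigma> x assume \<sigma>: "range \<sigma> \<subseteq> topspace T - B" and l: "limitin T \<sigma> x sequentially"
  obtain r y where r: "strict_mono (r :: nat \<Rightarrow> nat)" "limitin N (F \<circ> \<sigma> \<circ> r) y sequentially"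
    "x \<in> B \<longrightarrow> y \<in> Y" "x \<notin> B \<longrightarrow> y = F x"
    by (rule approachingD[OF F \<sigma> l])
  have "F \<circ> \<sigma> \<circ> r = G \<circ> \<sigma> \<circ> r"
    using \<sigma> eq by (auto simp: fun_eq_iff)
  moreover have "x \<notin> B \<Longrightarrow> F x = G x"
    using limitin_topspace[OF l] eq by auto
  ultimately show "\<exists>r y. strict_mono (r :: nat \<Rightarrow> nat) \<and> limitin N (G \<circ> \<sigma> \<circ> r) y sequentially \<and>
      (x \<in> B \<longrightarrow> y \<in> Y) \<and> (x \<notin> B \<longrightarrow> y = G x)"
    using r by (intro exI[of _ r] exI[of _ y] conjI impI) simp_all
qed

text \<open>A sequence off \<open>B\<close> visits one of the two closed sets infinitely often, and
  closedness keeps its limit there.\<close>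

lemma approaching_closed_Un:
  assumes T: "metrizable_space T" and C: "closedin T C1" "closedin T C2" "topspace T \<subseteq> C1 \<union> C2"
    and F1: "approaching (subtopology T C1) (B \<inter> C1) N Y F"
    and F2: "approaching (subtopology T C2) (B \<inter> C2) N Y F"
  shows "approaching T B N Y F"
proof (rule approachingI[OF T])
  fix x assume "x \<in> topspace T - B"
  then show "F x \<in> topspace N - Y"
    using C(3) approaching_maps[OF F1, of x] approaching_maps[OF F2, of x] by auto
next
  fix \<sigma> x assume \<sigma>: "range \<sigma> \<subseteq> topspace T - B" and l: "limitin T \<sigma> x sequentially"
  have *: "\<exists>r y. strict_mono (r :: nat \<Rightarrow> nat) \<and> limitin N (F \<circ> \<sigma> \<circ> r) y sequentially \<and>
      (x \<in> B \<longrightarrow> y \<in> Y) \<and> (x \<notin> B \<longrightarrow> y = F x)"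
    if C: "closedin T C" and F: "approaching (subtopology T C) (B \<inter> C) N Y F"
      and inf: "infinite {n. \<sigma> n \<in> C}" for C
  proof -
    obtain r where r: "strict_mono (r :: nat \<Rightarrow> nat)" "\<And>n. \<sigma> (r n) \<in> C"
      using infinite_enumerate[OF inf] by auto
    have l': "limitin T (\<sigma> \<circ> r) x sequentially"
      using limitin_subsequence[OF r(1) l] .
    have x: "x \<in> C"
      by (rule limitin_closedin[OF l' C]) (use r in auto)
    have lC: "limitin (subtopology T C) (\<sigma> \<circ> r) x sequentially"
      using l' x r by (auto simp: limitin_subtopology)
    have "range (\<sigma> \<circ> r) \<subseteq> topspace (subtopology T C) - B \<inter> C"
      using \<sigma> r by auto
    then obtain r' y where "strict_mono (r' :: nat \<Rightarrow> nat)"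
        "limitin N (F \<circ> (\<sigma> \<circ> r) \<circ> r') y sequentially"
        "x \<in> B \<inter> C \<longrightarrow> y \<in> Y" "x \<notin> B \<inter> C \<longrightarrow> y = F x"
      by (rule approachingD[OF F _ lC])
    then show ?thesis
      using strict_mono_o[OF r(1)] x
      by (intro exI[of _ "r \<circ> r'"] exI[of _ y] conjI impI) (simp_all add: o_assoc)
  qed
  have "{n. \<sigma> n \<in> C1} \<union> {n. \<sigma> n \<in> C2} = UNIV"
    using \<sigma> C(3) by auto
  then have "infinite {n. \<sigma> n \<in> C1} \<or> infinite {n. \<sigma> n \<in> C2}"
    by (metis finite_UnI infinite_UNIV_nat)
  then show "\<exists>r y. strict_mono (r :: nat \<Rightarrow> nat) \<and> limitin N (F \<circ> \<sigma> \<circ> r) y sequentially \<and>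
      (x \<in> B \<longrightarrow> y \<in> Y) \<and> (x \<notin> B \<longrightarrow> y = F x)"
    using *[OF C(1) F1] *[OF C(2) F2] by blast
qed

lemma approaching_into_closed_subspace:
  assumes F: "approaching T B N Y F" and T: "metrizable_space T"
    and L: "closedin N L" and im: "\<And>x. x \<in> topspace T - B \<Longrightarrow> F x \<in> L"
  shows "approaching T B (subtopology N L) (L \<inter> Y) F"
proof (rule approachingI[OF T])
  fix x assume "x \<in> topspace T - B"
  then show "F x \<in> topspace (subtopology N L) - L \<inter> Y"
    using approaching_maps[OF F] im by auto
next
  fix \<sigma> x assume \<sigma>: "range \<sigma> \<subseteq> topspace T - B" and l: "limitin T \<sigma> x sequentially"
  obtain r y where r: "strict_mono (r :: nat \<Rightarrow> nat)" "limitin N (F \<circ> \<sigma> \<circ> r) y sequentially"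
    "x \<in> B \<longrightarrow> y \<in> Y" "x \<notin> B \<longrightarrow> y = F x"
    by (rule approachingD[OF F \<sigma> l])
  have in_L: "\<forall>\<^sub>F n in sequentially. (F \<circ> \<sigma> \<circ> r) n \<in> L"
    using \<sigma> im by (intro always_eventually) auto
  have "y \<in> L"
    by (rule limitin_closedin[OF r(2) L in_L]) auto
  then show "\<exists>r y. strict_mono (r :: nat \<Rightarrow> nat) \<and>
      limitin (subtopology N L) (F \<circ> \<sigma> \<circ> r) y sequentially \<and>
      (x \<in> B \<longrightarrow> y \<in> L \<inter> Y) \<and> (x \<notin> B \<longrightarrow> y = F x)"
    using r in_L by (intro exI[of _ r] exI[of _ y] conjI impI) (simp_all add: limitin_subtopology)
qed

lemma metrizable_prod_I01: "metrizable_space T \<Longrightarrow> metrizable_space (prod_topology T I01)"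
  by (simp add: metrizable_space_prod_topology metrizable_space_subtopology metrizable_space_euclidean)

lemma continuous_map_into_I01:
  "\<lbrakk>continuous_map T euclideanreal f; \<And>x. x \<in> topspace T \<Longrightarrow> 0 \<le> f x \<and> f x \<le> 1\<rbrakk>
    \<Longrightarrow> continuous_map T I01 f"
  by (auto simp: continuous_map_in_subtopology)

lemma continuous_map_from_I01:
  "continuous_map T I01 f \<Longrightarrow> continuous_map T euclideanreal f"
  by (simp add: continuous_map_in_subtopology)

section \<open>Approaching homotopy: equivalence relation and composition\<close>

text \<open>The ends are compared off \<open>B\<close> only: HOL functions are total, and their
  values on the removed set carry no information.\<close>

definition approaching_homotopic ::
    "'m topology \<Rightarrow> 'm set \<Rightarrow> 'n topology \<Rightarrow> 'n set \<Rightarrow> ('m \<Rightarrow> 'n) \<Rightarrow> ('m \<Rightarrow> 'n) \<Rightarrow> bool" where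
  "approaching_homotopic T B N Y \<phi> \<psi> \<longleftrightarrow>
     (\<exists>K. approaching (prod_topology T I01) (B \<times> {0..1}) N Y K \<and>
        (\<forall>m\<in>topspace T - B. K (m, 0) = \<phi> m \<and> K (m, 1) = \<psi> m))"

lemma approaching_homotopic_refl:
  assumes T: "metrizable_space T" and F: "approaching T B N Y \<phi>"
    and eq: "\<And>m. m \<in> topspace T - B \<Longrightarrow> \<phi> m = \<psi> m"
  shows "approaching_homotopic T B N Y \<phi> \<psi>"
proof -
  have "approaching (prod_topology T I01) (B \<times> {0..1}) T B fst"
    by (rule approaching_continuous[OF metrizable_prod_I01[OF T] continuous_map_fst]) auto
  then have "approaching (prod_topology T I01) (B \<times> {0..1}) N Y (\<phi> \<circ> fst)"
    by (rule approaching_compose[OF metrizable_prod_I01[OF T] _ F])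
  then show ?thesis
    unfolding approaching_homotopic_def using eq by (intro exI[of _ "\<phi> \<circ> fst"]) auto
qed

lemma approaching_homotopic_sym:
  assumes T: "metrizable_space T" and h: "approaching_homotopic T B N Y \<phi> \<psi>"
  shows "approaching_homotopic T B N Y \<psi> \<phi>"
proof -
  obtain K where K: "approaching (prod_topology T I01) (B \<times> {0..1}) N Y K"
    "\<And>m. m \<in> topspace T - B \<Longrightarrow> K (m, 0) = \<phi> m \<and> K (m, 1) = \<psi> m"
    using h unfolding approaching_homotopic_def by blast
  have c: "continuous_map (prod_topology T I01) (prod_topology T I01) (\<lambda>p. (fst p, 1 - snd p))"
    by (auto simp: continuous_map_paired continuous_map_fst
        intro!: continuous_map_into_I01 continuous_map_diff continuous_map_from_I01[OF continuous_map_snd])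
  have "approaching (prod_topology T I01) (B \<times> {0..1}) (prod_topology T I01) (B \<times> {0..1})
      (\<lambda>p. (fst p, 1 - snd p))"
    by (rule approaching_continuous[OF metrizable_prod_I01[OF T] c]) auto
  from approaching_compose[OF metrizable_prod_I01[OF T] this K(1)] show ?thesis
    unfolding approaching_homotopic_def using K(2)
    by (intro exI[of _ "K \<circ> (\<lambda>p. (fst p, 1 - snd p))"]) auto
qed

lemma approaching_subtopology:
  assumes T: "metrizable_space T" and F: "approaching T B N Y F"
  shows "approaching (subtopology T S) (B \<inter> S) N Y F"
proof -
  have "approaching (subtopology T S) (B \<inter> S) T B id"
    by (rule approaching_continuous) (auto simp: T metrizable_space_subtopology)
  from approaching_compose[OF metrizable_space_subtopology[OF T] this F] show ?thesis by simp
qed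

lemma approaching_homotopic_trans:
  assumes T: "metrizable_space T" 
    and 1: "approaching_homotopic T B N Y \<phi> \<psi>" and 2: "approaching_homotopic T B N Y \<psi> \<omega>"
  shows "approaching_homotopic T B N Y \<phi> \<omega>"
proof -
  let ?P = "prod_topology T I01"
  note mP = metrizable_prod_I01[OF T]
  obtain K where K: "approaching ?P (B \<times> {0..1}) N Y K"
    "\<And>m. m \<in> topspace T - B \<Longrightarrow> K (m, 0) = \<phi> m \<and> K (m, 1) = \<psi> m"
    using 1 unfolding approaching_homotopic_def by blast
  obtain K' where K': "approaching ?P (B \<times> {0..1}) N Y K'"
    "\<And>m. m \<in> topspace T - B \<Longrightarrow> K' (m, 0) = \<psi> m \<and> K' (m, 1) = \<omega> m"
    using 2 unfolding approaching_homotopic_def by blast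
  \<comment> \<open>Clipping makes both speed-doubling maps self-maps of the whole product, so that
    they can be composed first and restricted to the halves afterwards.\<close>
  define r r' where "r = (\<lambda>p :: 'a \<times> real. (fst p, min 1 (2 * snd p)))"
    and "r' = (\<lambda>p :: 'a \<times> real. (fst p, max 0 (2 * snd p - 1)))"
  have "continuous_map ?P ?P r" "continuous_map ?P ?P r'"
    unfolding r_def r'_def
    by (auto simp: continuous_map_paired continuous_map_fst
        intro!: continuous_map_into_I01 continuous_map_diff continuous_map_real_min
          continuous_map_real_max continuous_map_real_mult_left
          continuous_map_from_I01[OF continuous_map_snd])
  then have "approaching ?P (B \<times> {0..1}) ?P (B \<times> {0..1}) r"
      "approaching ?P (B \<times> {0..1}) ?P (B \<times> {0..1}) r'"
    by (auto intro!: approaching_continuous[OF mP] simp: r_def r'_def)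
  then have a: "approaching ?P (B \<times> {0..1}) N Y (K \<circ> r)" "approaching ?P (B \<times> {0..1}) N Y (K' \<circ> r')"
    using approaching_compose[OF mP] K K' by blast+
  define J where "J = (\<lambda>p. if snd p \<le> 1/2 then (K \<circ> r) p else (K' \<circ> r') p)"
  \<comment> \<open>At height 1/2 the two halves agree off \<open>B\<close>, since both give
    \<open>\<psi>\<close> there.\<close>
  have eq: "J p = (K' \<circ> r') p" if "p \<in> topspace ?P - B \<times> {0..1}" "snd p \<ge> 1/2" for p
  proof (cases "snd p = 1/2")
    case True
    have "fst p \<in> topspace T - B" using that by (cases p) auto
    then show ?thesis
      using K(2) K'(2) True by (simp add: J_def r_def r'_def)
  next
    case False
    then show ?thesis using that by (simp add: J_def)
  qed
  let ?C1 = "{p \<in> topspace ?P. snd p \<in> {..1/2}}" and ?C2 = "{p \<in> topspace ?P. snd p \<in> {1/2..}}"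
  have s: "continuous_map ?P euclideanreal snd"
    by (rule continuous_map_from_I01[OF continuous_map_snd])
  have "approaching ?P (B \<times> {0..1}) N Y J"
  proof (rule approaching_closed_Un[OF mP])
    show "closedin ?P ?C1" by (rule closedin_continuous_map_preimage[OF s]) auto
    show "closedin ?P ?C2" by (rule closedin_continuous_map_preimage[OF s]) auto
    show "topspace ?P \<subseteq> ?C1 \<union> ?C2" by auto
    show "approaching (subtopology ?P ?C1) (B \<times> {0..1} \<inter> ?C1) N Y J"
      by (rule approaching_cong[OF approaching_subtopology[OF mP a(1)]])
        (auto simp: J_def mP metrizable_space_subtopology)
    show "approaching (subtopology ?P ?C2) (B \<times> {0..1} \<inter> ?C2) N Y J"
    proof (rule approaching_cong[OF approaching_subtopology[OF mP a(2)]])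
      fix p assume "p \<in> topspace (subtopology ?P ?C2) - B \<times> {0..1} \<inter> ?C2"
      then have "p \<in> topspace ?P - B \<times> {0..1}" "snd p \<ge> 1/2" by auto
      then show "(K' \<circ> r') p = J p" using eq by simp
    qed (simp add: mP metrizable_space_subtopology)
  qed
  moreover have "J (m, 0) = \<phi> m \<and> J (m, 1) = \<omega> m" if "m \<in> topspace T - B" for m
    using K(2)[OF that] K'(2)[OF that] by (simp add: J_def r_def r'_def)
  ultimately show ?thesis unfolding approaching_homotopic_def by blast
qed

text \<open>Allows a homotopy to be precomposed with \<open>F\<close>. The second coordinate
  converges along every subsequence, so the one extracted for \<open>F\<close> works for the
  pair.\<close>

lemma approaching_times_I01:
  assumes T: "metrizable_space T" and F: "approaching T B N Y F"
  shows "approaching (prod_topology T I01) (B \<times> {0..1}) (prod_topology N I01) (Y \<times> {0..1})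
           (\<lambda>p. (F (fst p), snd p))"
proof (rule approachingI[OF metrizable_prod_I01[OF T]])
  fix p assume "p \<in> topspace (prod_topology T I01) - B \<times> {0..1}"
  then have "fst p \<in> topspace T" "fst p \<notin> B" "snd p \<in> {0..1}" by (cases p; auto)+
  then show "(F (fst p), snd p) \<in> topspace (prod_topology N I01) - Y \<times> {0..1}"
    using approaching_maps[OF F, of "fst p"] by auto
next
  fix \<sigma> p assume \<sigma>: "range \<sigma> \<subseteq> topspace (prod_topology T I01) - B \<times> {0..1}"
    and l: "limitin (prod_topology T I01) \<sigma> p sequentially"
  have l': "limitin T (fst \<circ> \<sigma>) (fst p) sequentially" "limitin I01 (snd \<circ> \<sigma>) (snd p) sequentially"
    using l unfolding limitin_pairwise by blast+
  have "range (fst \<circ> \<sigma>) \<subseteq> topspace T - B"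
  proof (intro image_subsetI)
    fix n have "\<sigma> n \<in> topspace (prod_topology T I01) - B \<times> {0..1}"
      by (rule subsetD[OF \<sigma> rangeI])
    then show "(fst \<circ> \<sigma>) n \<in> topspace T - B"
      by (auto simp: mem_Times_iff)
  qed
  then obtain r y where r: "strict_mono (r :: nat \<Rightarrow> nat)"
    "limitin N (F \<circ> (fst \<circ> \<sigma>) \<circ> r) y sequentially"
    "fst p \<in> B \<longrightarrow> y \<in> Y" "fst p \<notin> B \<longrightarrow> y = F (fst p)"
    by (rule approachingD[OF F _ l'(1)])
  have "snd p \<in> {0..1}" using limitin_topspace[OF l'(2)] by simp
  moreover have "limitin (prod_topology N I01) ((\<lambda>p. (F (fst p), snd p)) \<circ> \<sigma> \<circ> r) (y, snd p) sequentially"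
    using r(2) limitin_subsequence[OF r(1) l'(2)] by (simp add: limitin_pairwise o_def)
  ultimately show "\<exists>r y. strict_mono (r :: nat \<Rightarrow> nat) \<and>
      limitin (prod_topology N I01) ((\<lambda>p. (F (fst p), snd p)) \<circ> \<sigma> \<circ> r) y sequentially \<and>
      (p \<in> B \<times> {0..1} \<longrightarrow> y \<in> Y \<times> {0..1}) \<and> (p \<notin> B \<times> {0..1} \<longrightarrow> y = (F (fst p), snd p))"
    using r by (intro exI[of _ r] exI[of _ "(y, snd p)"] conjI impI) (auto simp: mem_Times_iff)
qed

lemma approaching_homotopic_compose_right:
  assumes T: "metrizable_space T" and F: "approaching T B N Y F"
    and h: "approaching_homotopic N Y K Z \<phi> \<psi>"
  shows "approaching_homotopic T B K Z (\<phi> \<circ> F) (\<psi> \<circ> F)"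
proof -
  obtain J where J: "approaching (prod_topology N I01) (Y \<times> {0..1}) K Z J"
    "\<And>m. m \<in> topspace N - Y \<Longrightarrow> J (m, 0) = \<phi> m \<and> J (m, 1) = \<psi> m"
    using h unfolding approaching_homotopic_def by blast
  from approaching_compose[OF metrizable_prod_I01[OF T] approaching_times_I01[OF T F] J(1)]
  show ?thesis
    unfolding approaching_homotopic_def
    using J(2) approaching_maps[OF F]
    by (intro exI[of _ "J \<circ> (\<lambda>p. (F (fst p), snd p))"]) auto
qed

section \<open>Extension of maps into the ambient retract\<close>

lemma limitin_mtopology_of:
  "limitin (mtopology_of d) f l F \<longleftrightarrow>
     l \<in> mspace d \<and> (\<forall>\<^sub>F n in F. f n \<in> mspace d) \<and> ((\<lambda>n. mdist d (f n) l) \<longlongrightarrow> 0) F"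
  unfolding mtopology_of_def
  by (simp add: Metric_space.limitin_metric_dist_null Metric_space_mspace_mdist)

lemma metrizable_space_mtopology_of: "metrizable_space (mtopology_of d)"
  unfolding mtopology_of_def
  by (simp add: Metric_space.metrizable_space_mtopology Metric_space_mspace_mdist)

lemma metrizable_space_metric:
  assumes "metrizable_space T"
  obtains d where "mtopology_of d = T"
  using assms Metric_space.mtopology_of unfolding metrizable_space_def by metis

lemma limitin_mdist_close:
  assumes l: "limitin (mtopology_of d) f l F" and g: "\<And>n. g n \<in> mspace d"
    and close: "\<And>n. mdist d (f n) (g n) \<le> e n" and e: "(e \<longlongrightarrow> 0) F"
  shows "limitin (mtopology_of d) g l F"
proof -
  have f: "l \<in> mspace d" "\<forall>\<^sub>F n in F. f n \<in> mspace d" "((\<lambda>n. mdist d (f n) l) \<longlongrightarrow> 0) F"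
    using l by (simp_all add: limitin_mtopology_of)
  have "((\<lambda>n. e n + mdist d (f n) l) \<longlongrightarrow> 0 + 0) F"
    by (intro tendsto_add e f)
  then have lim: "((\<lambda>n. e n + mdist d (f n) l) \<longlongrightarrow> 0) F" by simp
  have "\<forall>\<^sub>F n in F. mdist d (g n) l \<le> e n + mdist d (f n) l"
    using f(2)
  proof eventually_elim
    case (elim n)
    have "mdist d (g n) l \<le> mdist d (g n) (f n) + mdist d (f n) l"
      using elim g f(1) by (intro mdist_triangle) auto
    then show ?case using close[of n] by (simp add: mdist_commute)
  qed
  then have "((\<lambda>n. mdist d (g n) l) \<longlongrightarrow> 0) F"
    using tendsto_sandwich[OF _ _ tendsto_const lim] by (auto intro!: always_eventually)
  then show ?thesis using f(1) g by (simp add: limitin_mtopology_of)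
qed

text \<open>The one-sided estimate is enough because \<open>x\<close> and \<open>y\<close> may be
  exchanged. It covers distances and infima, among them the level function of a telescope.\<close>

lemma continuous_map_1_Lipschitz:
  assumes "\<And>x y. \<lbrakk>x \<in> mspace d; y \<in> mspace d\<rbrakk> \<Longrightarrow> f x \<le> f y + mdist d x y"
  shows "continuous_map (mtopology_of d) euclideanreal f"
proof -
  have "\<bar>f x - f y\<bar> \<le> 1 * mdist d x y" if "x \<in> mspace d" "y \<in> mspace d" for x y
    using assms[OF that] assms[OF that(2,1)] by (simp add: mdist_commute[of d y x])
  then have "Lipschitz_continuous_map d euclidean_metric f"
    unfolding Lipschitz_continuous_map_def
    by (intro conjI exI[of _ 1]) (auto simp: dist_real_def)
  then show ?thesis
    using Lipschitz_continuous_imp_continuous_map by fastforce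
qed

lemma continuous_map_mdist_left:
  assumes "q \<in> mspace d" shows "continuous_map (mtopology_of d) euclideanreal (\<lambda>m. mdist d m q)"
  by (rule continuous_map_1_Lipschitz) (use assms mdist_triangle in \<open>fastforce simp: add.commute\<close>)

lemma continuous_map_dist_to:
  assumes "X \<subseteq> mspace d" shows "continuous_map (mtopology_of d) euclideanreal (dist_to d X)"
proof (cases "X = {}")
  case False
  then show ?thesis
    by (intro continuous_map_1_Lipschitz) (metis assms dist_to_triangle add.commute)
qed (simp add: dist_to_def[abs_def])

lemma vanishing_function:
  assumes Y: "metrizable_space Y" and E: "closedin Y E"
  obtains k where "continuous_map Y euclideanreal k"
    "\<forall>y\<in>topspace Y. 0 \<le> k y \<and> k y \<le> 1 \<and> (k y = 0 \<longleftrightarrow> y \<in> E)"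
proof (cases "E = {}")
  case True
  \<comment> \<open>\<open>dist_to\<close> is 0 everywhere for an empty set, so the constant 1 takes
    its place.\<close>
  then show ?thesis using that[of "\<lambda>_. 1"] by simp
next
  case False
  obtain d where d: "mtopology_of d = Y" using metrizable_space_metric[OF Y] .
  have sub: "E \<subseteq> mspace d" using closedin_subset[OF E] d by auto
  have *: "dist_to d E y = 0 \<longleftrightarrow> y \<in> E" if "y \<in> mspace d" for y
  proof
    assume "y \<in> E"
    then have "dist_to d E y \<le> mdist d y y"
      using False cINF_lower[OF dist_to_bdd[of d y E]] by (simp add: dist_to_def)
    then show "dist_to d E y = 0"
      using dist_to_nonneg[of d E y] mdist_zero[OF that that] by simp
  next
    assume "dist_to d E y = 0"
    then show "y \<in> E" using dist_to_pos[of d E y] E d False that by force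
  qed
  show ?thesis
  proof (rule that[of "\<lambda>y. min 1 (dist_to d E y)"])
    show "continuous_map Y euclideanreal (\<lambda>y. min 1 (dist_to d E y))"
      using continuous_map_dist_to[OF sub] d by (intro continuous_map_real_min) auto
    show "\<forall>y\<in>topspace Y. 0 \<le> min 1 (dist_to d E y) \<and> min 1 (dist_to d E y) \<le> 1 \<and>
        (min 1 (dist_to d E y) = 0 \<longleftrightarrow> y \<in> E)"
    proof
      fix y assume "y \<in> topspace Y"
      then show "0 \<le> min 1 (dist_to d E y) \<and> min 1 (dist_to d E y) \<le> 1 \<and>
          (min 1 (dist_to d E y) = 0 \<longleftrightarrow> y \<in> E)"
        using *[of y] d dist_to_nonneg[of d E y] by (auto simp: min_def)
    qed
  qed
qed

text \<open>A series of Urysohn functions for the pairs \<open>E\<close>, \<open>C n\<close> with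
  weights \<open>(1/2)^n\<close>. The weights make the series converge uniformly and are at the same
  time the values of its terms on the sets \<open>C n\<close>.\<close>

lemma vanishing_majorant:
  fixes C :: "nat \<Rightarrow> 'a set"
  assumes Y: "normal_space Y" and E: "closedin Y E"
    and C: "\<And>n. closedin Y (C n)" "\<And>n. disjnt E (C n)"
  obtains s where "continuous_map Y euclideanreal s" "\<forall>y\<in>topspace Y. 0 \<le> s y"
    "\<forall>y\<in>E. s y = 0" "\<forall>n. \<forall>y\<in>C n. (1/2)^n \<le> s y"
proof -
  have "\<exists>f. continuous_map Y (top_of_set {0..1::real}) f \<and> f ` E \<subseteq> {0} \<and> f ` C n \<subseteq> {1}" for n
    using Urysohn_lemma[OF Y E C(1)[of n] C(2)[of n], of 0 1] by (metis zero_le_one)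
  then obtain h where h: "\<And>n. continuous_map Y (top_of_set {0..1::real}) (h n)"
    "\<And>n. h n ` E \<subseteq> {0}" "\<And>n. h n ` C n \<subseteq> {1}"
    by metis
  define a where "a = (\<lambda>n y. (1/2)^n * h n y)"
  have h01: "0 \<le> h n y" "h n y \<le> 1" if "y \<in> topspace Y" for n y
    using h(1)[of n] that by (auto simp: continuous_map_in_subtopology Pi_iff)
  have a0: "0 \<le> a n y" "norm (a n y) \<le> (1/2)^n" if "y \<in> topspace Y" for n y
    using h01[OF that] by (auto simp: a_def mult_left_le)
  have sm: "summable (\<lambda>n. a n y)" if "y \<in> topspace Y" for y
    by (rule summable_comparison_test'[where g="\<lambda>n. (1/2)^n" and N=0])
      (use a0 that in \<open>auto simp: summable_geometric\<close>)
  define s where "s = (\<lambda>y. suminf (\<lambda>n. a n y))"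
  have unif: "uniform_limit (topspace Y) (\<lambda>n y. \<Sum>i<n. a i y) s sequentially"
    unfolding s_def
    by (rule Weierstrass_m_test[where M="\<lambda>n. (1/2)^n"]) (use a0 in \<open>auto simp: summable_geometric\<close>)
  have "continuous_map Y Met_TC.mtopology s"
  proof (rule Met_TC.continuous_map_uniform_limit)
    have "continuous_map Y euclideanreal (\<lambda>y. \<Sum>i<n. a i y)" for n
      unfolding a_def
      by (intro continuous_map_sum continuous_map_real_mult_left continuous_map_from_I01 h) auto
    then show "\<forall>\<^sub>F n in sequentially. continuous_map Y Met_TC.mtopology (\<lambda>y. \<Sum>i<n. a i y)"
      by simp
    show "\<forall>\<^sub>F n in sequentially. \<forall>y\<in>topspace Y. s y \<in> UNIV \<and> dist (\<Sum>i<n. a i y) (s y) < e"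
      if "e > 0" for e
      using uniform_limitD[OF unif that] by simp
  qed simp
  then have "continuous_map Y euclideanreal s" by simp
  moreover have "0 \<le> s y" if "y \<in> topspace Y" for y
    unfolding s_def by (rule suminf_nonneg[OF sm[OF that] a0(1)[OF that]])
  moreover have "s y = 0" if "y \<in> E" for y
  proof -
    have "a n y = 0" for n using h(2)[of n] that by (auto simp: a_def)
    then show ?thesis by (simp add: s_def)
  qed
  moreover have "(1/2)^n \<le> s y" if "y \<in> C n" for y n
  proof -
    have y: "y \<in> topspace Y" using C(1)[of n] that closedin_subset by blast
    have "(1/2)^n = (\<Sum>i\<in>{n}. a i y)" using h(3)[of n] that by (auto simp: a_def)
    also have "\<dots> \<le> s y"
      unfolding s_def by (rule sum_le_suminf[OF sm[OF y]]) (use a0 y in auto)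
    finally show ?thesis .
  qed
  ultimately show ?thesis using that by blast
qed

section \<open>Compactness and extension by means of the exhaustion function\<close>

text \<open>The form in which compactness of the sets \<open>u \<ge> \<epsilon>\<close> enters. The
  exhaustion property supplies an accumulation point, and shrinking balls around it select the
  subsequence.\<close>

lemma exhaustion_convergent_subsequence:
  assumes u: "exhaustion (mtopology_of d) u" and x: "range x \<subseteq> mspace d"
    and nz: "\<not> (\<lambda>n. u (x n)) \<longlonglongrightarrow> 0"
  obtains r p where "strict_mono (r :: nat \<Rightarrow> nat)" "limitin (mtopology_of d) (x \<circ> r) p sequentially"
proof -
  interpret Metric_space "mspace d" "mdist d" by simp
  obtain p where p: "accumulation_point (mtopology_of d) x p"
    using u x nz unfolding exhaustion_def by auto
  then have pm: "p \<in> mspace d" by (simp add: accumulation_point_def)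
  have inf: "infinite {n. x n \<in> mball p e}" if "e > 0" for e
  proof -
    have "openin (mtopology_of d) (mball p e)" by (simp add: mtopology_of_def)
    then show ?thesis
      using p pm that unfolding accumulation_point_def by (metis centre_in_mball_iff)
  qed
  have ex: "\<exists>n > m. x n \<in> mball p e" if "e > 0" for m e
    using inf[OF that] unfolding infinite_nat_iff_unbounded by auto
  have "\<exists>r. \<forall>k. x (r k) \<in> mball p (inverse (Suc k)) \<and> r k < r (Suc k)"
  proof (rule dependent_nat_choice)
    show "\<exists>n. x n \<in> mball p (inverse (Suc 0))" using ex[of "inverse (Suc 0)" 0] by auto
    show "\<exists>n'. x n' \<in> mball p (inverse (Suc (Suc k))) \<and> n < n'" for n k
      using ex[of "inverse (Suc (Suc k))" n] by auto
  qed
  then obtain r where r: "\<And>k. x (r k) \<in> mball p (inverse (Suc k))" "\<And>k. r k < r (Suc k)"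
    by auto
  have "(\<lambda>k. mdist d ((x \<circ> r) k) p) \<longlonglongrightarrow> 0"
  proof (rule tendsto_sandwich[OF _ _ tendsto_const LIMSEQ_inverse_real_of_nat])
    show "\<forall>\<^sub>F k in sequentially. mdist d ((x \<circ> r) k) p \<le> inverse (real (Suc k))"
      using r(1) by (auto simp: mdist_commute less_imp_le intro!: always_eventually)
  qed auto
  then have "limitin (mtopology_of d) (x \<circ> r) p sequentially"
    using x pm by (auto simp: limitin_mtopology_of intro!: always_eventually)
  moreover have "strict_mono r" using r(2) by (simp add: strict_mono_Suc_iff)
  ultimately show ?thesis using that by blast
qed

text \<open>
  The test spaces in the definition of an absolute retract live on a fixed type. For the spaces
  admitting an exhaustion function this suffices: adding \<open>1/u\<close> to the distances from a countable
  dense set makes the canonical map to a countable power of the line a closed embedding, hence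
  \<open>M\<close> is a retract of that power, and Tietze's theorem extends maps into it coordinatewise.
\<close>

lemma absolute_retract_extension:
  fixes d :: "'m metric" and Z :: "'z topology"
  assumes ar: "absolute_retract (mtopology_of d)" and sep: "separable_space (mtopology_of d)"
    and u: "exhaustion (mtopology_of d) u"
    and Z: "metrizable_space Z" and C: "closedin Z C"
    and F: "continuous_map (subtopology Z C) (mtopology_of d) F"
  obtains G where "continuous_map Z (mtopology_of d) G" "\<And>z. z \<in> C \<Longrightarrow> G z = F z"
proof -
  interpret Metric_space "mspace d" "mdist d" by simp
  obtain Q where Q: "countable Q" "Q \<subseteq> mspace d" "mtopology_of d closure_of Q = mspace d"
    using sep by (auto simp: separable_space_def)
  have dense: "\<exists>q\<in>Q. mdist d m q < e" if "m \<in> mspace d" "e > 0" for m e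
  proof -
    have "m \<in> mtopology closure_of Q" using Q(3) that by (simp add: mtopology_of_def)
    then show ?thesis using that by (force simp: metric_closure_of)
  qed
  \<comment> \<open>Indexing by \<open>Q\<close>, a subset of the carrier of \<open>d\<close>, puts
    this countable power on the type that \<open>absolute_retract\<close> uses for its test
    spaces.\<close>
  define E :: "('m \<Rightarrow> real) topology" where "E = product_topology (\<lambda>_. euclideanreal) Q"
  have E: "metrizable_space E"
    unfolding E_def metrizable_space_product_topology
    using Q(1) by (auto simp: metrizable_space_euclidean intro: countable_subset)
  define e where "e = (\<lambda>m. restrict (\<lambda>q. mdist d m q + 1 / u m) Q)"
  have u_cont: "continuous_map (mtopology_of d) euclideanreal u"
    using u by (simp add: exhaustion_def continuous_map_in_subtopology)
  have u_pos: "0 < u m" if "m \<in> mspace d" for m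
    using u that by (force simp: exhaustion_def continuous_map_in_subtopology)
  have e_cont: "continuous_map (mtopology_of d) E e"
    unfolding E_def continuous_map_componentwise
  proof (intro conjI ballI)
    fix q assume q: "q \<in> Q"
    have "continuous_map (mtopology_of d) euclideanreal (\<lambda>m. mdist d m q + 1 / u m)"
      using Q(2) q u_pos
      by (intro continuous_map_add continuous_map_mdist_left continuous_map_real_divide u_cont) force+
    then show "continuous_map (mtopology_of d) euclideanreal (\<lambda>m. e m q)"
      using q by (simp add: e_def)
  qed (auto simp: e_def)
  have e_inj: "inj_on e (topspace (mtopology_of d))"
  proof (rule inj_onI)
    fix m m' assume m: "m \<in> topspace (mtopology_of d)" "m' \<in> topspace (mtopology_of d)"
      and eq: "e m = e m'"
    have eq': "mdist d m q + 1 / u m = mdist d m' q + 1 / u m'" if "q \<in> Q" for q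
      using fun_cong[OF eq, of q] that by (simp add: e_def)
    \<comment> \<open>A point \<open>q\<close> close to \<open>m\<close> makes the first distance
      small, and the second one is nonnegative. By symmetry both reciprocals agree, and then so do
      the distances to all of \<open>Q\<close>.\<close>
    have le: "1 / u m' \<le> 1 / u m"
      if mm: "m \<in> mspace d" and eq: "\<And>q. q \<in> Q \<Longrightarrow> mdist d m q + 1 / u m = mdist d m' q + 1 / u m'" for m m'
    proof (rule field_le_epsilon)
      fix \<delta> :: real assume "\<delta> > 0"
      then obtain q where q: "q \<in> Q" "mdist d m q < \<delta>" using dense[OF mm] by blast
      have "0 \<le> mdist d m' q" by simp
      then show "1 / u m' \<le> 1 / u m + \<delta>" using eq[OF q(1)] q(2) by linarith
    qed
    have "1 / u m = 1 / u m'"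
      using le[of m m'] le[of m' m] eq' m by force
    then have eq'': "mdist d m q = mdist d m' q" if "q \<in> Q" for q
      using eq'[OF that] by simp
    have "mdist d m m' \<le> 0"
    proof (rule field_le_epsilon)
      fix \<delta> :: real assume "\<delta> > 0"
      then obtain q where q: "q \<in> Q" "mdist d m q < \<delta>/2" using dense[of m "\<delta>/2"] m by auto
      have "mdist d m m' \<le> mdist d m q + mdist d q m'"
        using m q Q(2) by (intro mdist_triangle) auto
      then show "mdist d m m' \<le> 0 + \<delta>"
        using eq''[OF q(1)] q(2) by (simp add: mdist_commute[of d q m'])
    qed
    then have "mdist d m m' = 0"
      using mdist_nonneg[of d m m'] by linarith
    then show "m = m'" using m by simp
  qed
  have e_closed: "closed_map (mtopology_of d) E e"
    unfolding closed_map_def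
  proof (intro allI impI)
    fix S assume S: "closedin (mtopology_of d) S"
    have S': "S \<subseteq> mspace d" using closedin_subset[OF S] by simp
    show "closedin E (e ` S)"
      unfolding metrizable_closedin_iff_sequentially_closed[OF E]
    proof (intro conjI allI impI)
      show "e ` S \<subseteq> topspace E"
        using S' continuous_map_image_subset_topspace[OF e_cont] by auto
      fix \<sigma> l assume *: "range \<sigma> \<subseteq> e ` S \<and> limitin E \<sigma> l sequentially"
      then have "\<forall>n. \<exists>m\<in>S. \<sigma> n = e m" by blast
      then obtain m where m: "\<And>n. m n \<in> S" "\<And>n. \<sigma> n = e (m n)" by metis
      have "mspace d \<noteq> {}" using m(1)[of 0] S' by auto
      then obtain q where q: "q \<in> Q" using dense[of _ 1] by fastforce
      have lim: "limitin E (e \<circ> m) l sequentially"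
      proof -
        have "\<sigma> = e \<circ> m" using m(2) by auto
        then show ?thesis using * by simp
      qed
      have "continuous_map E euclideanreal (\<lambda>x. x q)"
        unfolding E_def by (rule continuous_map_product_projection[OF q])
      from continuous_map_limit[OF this lim]
      have lq: "(\<lambda>n. e (m n) q) \<longlonglongrightarrow> l q" by (simp add: o_def)
      \<comment> \<open>Otherwise the summand \<open>1 / u\<close> would make the coordinate at
        \<open>q\<close> unbounded. Multiplied by \<open>u\<close> this reads: products at least 1
        that tend to 0.\<close>
      have "\<not> (\<lambda>n. u (m n)) \<longlonglongrightarrow> 0"
      proof
        assume u0: "(\<lambda>n. u (m n)) \<longlonglongrightarrow> 0"
        have "(\<lambda>n. u (m n) * e (m n) q) \<longlonglongrightarrow> 0 * l q"
          by (intro tendsto_mult u0 lq)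
        moreover have "1 \<le> u (m n) * e (m n) q" for n
        proof -
          have "0 < u (m n)" using m(1)[of n] S' u_pos by blast
          moreover have "0 \<le> mdist d (m n) q" by simp
          ultimately show ?thesis using q by (simp add: e_def distrib_left)
        qed
        ultimately show False
          using LIMSEQ_le_const[of _ "0 * l q" 1] by fastforce
      qed
      moreover have "range m \<subseteq> mspace d" using m(1) S' by auto
      ultimately obtain r p where r: "strict_mono (r :: nat \<Rightarrow> nat)"
        "limitin (mtopology_of d) (m \<circ> r) p sequentially"
        using exhaustion_convergent_subsequence[OF u] by metis
      have p: "p \<in> S"
        by (rule limitin_closedin[OF r(2) S]) (use m(1) in auto)
      have "limitin E (e \<circ> (m \<circ> r)) (e p) sequentially"
        by (rule continuous_map_limit[OF e_cont r(2)])
      moreover have "limitin E (e \<circ> (m \<circ> r)) l sequentially"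
        using limitin_subsequence[OF r(1) lim] by (simp add: o_assoc)
      ultimately have "e p = l"
        using limitin_Hausdorff_unique metrizable_imp_Hausdorff_space[OF E] trivial_limit_sequentially
        by metis
      then show "l \<in> e ` S" using p by blast
    qed
  qed
  have "homeomorphic_map (mtopology_of d) (subtopology E (e ` mspace d)) e"
    using injective_closed_imp_embedding_map[OF e_cont e_closed e_inj] by (simp add: embedding_map_def)
  then obtain k where k: "homeomorphic_maps (mtopology_of d) (subtopology E (e ` mspace d)) e k"
    by (auto simp: homeomorphic_map_maps)
  have "closedin E (e ` mspace d)"
    using e_closed by (metis closed_map_def closedin_topspace topspace_mtopology_of)
  moreover have "continuous_map (subtopology E (e ` mspace d)) (mtopology_of d) k"
    using k by (simp add: homeomorphic_maps_def)
  ultimately obtain r where r: "continuous_map E (mtopology_of d) r" "\<And>z. z \<in> e ` mspace d \<Longrightarrow> r z = k z"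
    using ar E unfolding absolute_retract_def by metis
  have re: "r (e m) = m" if "m \<in> mspace d" for m
    using r(2)[of "e m"] k that by (auto simp: homeomorphic_maps_def)
  have "\<exists>g. continuous_map Z euclideanreal g \<and> (\<forall>z\<in>C. g z = e (F z) q)" if "q \<in> Q" for q
  proof -
    have "continuous_map E euclideanreal (\<lambda>x. x q)"
      unfolding E_def by (rule continuous_map_product_projection[OF that])
    from continuous_map_compose[OF continuous_map_compose[OF F e_cont] this]
    have "continuous_map (subtopology Z C) euclideanreal (\<lambda>z. e (F z) q)" by (simp add: o_def)
    then obtain g where "continuous_map Z euclideanreal g" "\<And>z. z \<in> C \<Longrightarrow> g z = e (F z) q"
      by (rule Tietze_extension_realinterval[OF metrizable_imp_normal_space[OF Z] C is_interval_univ UNIV_not_empty])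
        auto
    then show ?thesis by blast
  qed
  then obtain g where g: "\<And>q. q \<in> Q \<Longrightarrow> continuous_map Z euclideanreal (g q)"
    "\<And>q z. \<lbrakk>q \<in> Q; z \<in> C\<rbrakk> \<Longrightarrow> g q z = e (F z) q" by metis
  have "continuous_map Z E (\<lambda>z. restrict (\<lambda>q. g q z) Q)"
    unfolding E_def continuous_map_componentwise using g(1) by auto
  from continuous_map_compose[OF this r(1)]
  have "continuous_map Z (mtopology_of d) (r \<circ> (\<lambda>z. restrict (\<lambda>q. g q z) Q))" .
  moreover have "(r \<circ> (\<lambda>z. restrict (\<lambda>q. g q z) Q)) z = F z" if "z \<in> C" for z
  proof -
    have "z \<in> topspace Z" using that C closedin_subset by blast
    then have "F z \<in> mspace d"
      using continuous_map_image_subset_topspace[OF F] that by auto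
    moreover have "restrict (\<lambda>q. g q z) Q = e (F z)"
      using g(2) that by (auto simp: e_def)
    ultimately show ?thesis using re by simp
  qed
  ultimately show ?thesis using that by blast
qed

section \<open>Extension of approaching maps\<close>

lemma admissible_dataD:
  assumes "admissible_data M X u H d"
  shows "M = mtopology_of d" "absolute_retract (mtopology_of d)" "separable_space (mtopology_of d)"
    "exhaustion (mtopology_of d) u" "closedin (mtopology_of d) X" "X \<subseteq> mspace d"
    "instant_homotopy (mtopology_of d) X H" "metrizable_space M"
  using assms closedin_subset[of M X] metrizable_space_mtopology_of[of d]
  unfolding admissible_data_def by auto

text \<open>
  First extend \<open>g\<close> to a map \<open>G\<^sub>1\<close> with values in \<open>M - X\<close>, without control near \<open>B \<times> {0}\<close>. It is
  controlled on a neighbourhood \<open>V\<close> of the domain of \<open>g\<close>, which contains \<open>{y} \<times> [s y, 1]\<close> for some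
  \<open>s\<close> vanishing on \<open>B \<union> C\<close> and all \<open>y\<close> close to \<open>B\<close>; so replacing the parameter \<open>t\<close> by
  \<open>max t (s y)\<close> makes \<open>G\<^sub>1\<close> approaching.
\<close>

lemma approaching_extension:
  fixes Y :: "'y topology"
  assumes adm: "admissible_data M X u H d" and Y: "metrizable_space Y"
    and B: "closedin Y B" and C: "closedin Y C"
    and g: "approaching (subtopology (prod_topology Y I01) ((B \<union> C) \<times> {0..1})) (B \<times> {0}) M X g"
  obtains G where "approaching (prod_topology Y I01) (B \<times> {0}) M X G"
    "\<And>p. \<lbrakk>p \<in> (B \<union> C) \<times> {0..1}; p \<notin> B \<times> {0}\<rbrakk> \<Longrightarrow> G p = g p"
proof -
  note M = admissible_dataD[OF adm]
  define P where "P = prod_topology Y I01"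
  define D where "D = (B \<union> C) \<times> {0..1::real}"
  define B0 where "B0 = B \<times> {0::real}"
  define Z where "Z = subtopology P (topspace P - B0)"
  have P: "metrizable_space P" unfolding P_def by (rule metrizable_prod_I01[OF Y])
  have Z: "metrizable_space Z" unfolding Z_def by (rule metrizable_space_subtopology[OF P])
  have topP: "topspace P = topspace Y \<times> {0..1}" by (simp add: P_def)
  have topZ: "topspace Z = topspace P - B0" by (auto simp: Z_def)
  have BC: "closedin Y (B \<union> C)" using B C by (rule closedin_Un)
  have subY: "B \<subseteq> topspace Y" "C \<subseteq> topspace Y" using B C closedin_subset by auto
  have D: "closedin P D"
    unfolding P_def D_def closedin_prod_Times_iff using BC by simp
  have B0: "closedin P B0"
    unfolding P_def B0_def closedin_prod_Times_iff using B by (simp add: closedin_subtopology_Int_closed)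
  have DZ: "D \<inter> topspace Z = D - B0"
    using D closedin_subset topZ by fastforce
  have closedZ: "closedin Z (D - B0)"
    using D DZ by (metis Z_def closedin_subtopology_Int_closed inf_commute topZ)
  obtain kB where kB: "continuous_map Y euclideanreal kB"
    "\<forall>y\<in>topspace Y. 0 \<le> kB y \<and> kB y \<le> 1 \<and> (kB y = 0 \<longleftrightarrow> y \<in> B)"
    by (rule vanishing_function[OF Y B])
  obtain kE where kE: "continuous_map Y euclideanreal kE"
    "\<forall>y\<in>topspace Y. 0 \<le> kE y \<and> kE y \<le> 1 \<and> (kE y = 0 \<longleftrightarrow> y \<in> B \<union> C)"
    by (rule vanishing_function[OF Y BC])
  have fstP: "continuous_map P Y fst" and sndP: "continuous_map P euclideanreal snd"
    unfolding P_def by (simp_all add: continuous_map_fst continuous_map_from_I01[OF continuous_map_snd])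
  have fstZ: "continuous_map Z Y fst"
    unfolding Z_def by (rule continuous_map_from_subtopology[OF fstP])

  have "continuous_map (subtopology Z (D - B0)) M g"
  proof -
    have "subtopology Z (D - B0) = subtopology (subtopology P D) (topspace (subtopology P D) - B0)"
      unfolding Z_def subtopology_subtopology using D closedin_subset
      by (intro arg_cong[of _ _ "subtopology P"]) fastforce
    then show ?thesis
      using g by (simp add: approaching_def P_def D_def B0_def continuous_map_in_subtopology)
  qed
  then obtain G0 where G0: "continuous_map Z M G0" "\<And>z. z \<in> D - B0 \<Longrightarrow> G0 z = g z"
    using absolute_retract_extension[OF M(2-4) Z closedZ] M(1) by metis
  have g_maps: "g z \<in> topspace M - X" if "z \<in> D - B0" for z
  proof -
    have "z \<in> topspace (subtopology P D)" using that D closedin_subset by fastforce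
    then show ?thesis
      using approaching_maps[OF g, of z] that by (simp add: P_def D_def B0_def)
  qed
  have H: "continuous_map (prod_topology M I01) M H" "\<And>m. m \<in> topspace M \<Longrightarrow> H (m, 0) = m"
    "\<And>m t. \<lbrakk>m \<in> topspace M; 0 < t; t \<le> 1\<rbrakk> \<Longrightarrow> H (m, t) \<in> topspace M - X"
    using M(1,7) unfolding instant_homotopy_def by (blast, blast, fastforce)
  \<comment> \<open>\<open>H\<close> pushes the extension off \<open>X\<close>. Its time
    \<open>kE\<close> vanishes exactly over \<open>B \<union> C\<close>, so the values prescribed by
    \<open>g\<close> are kept.\<close>
  define G1 where "G1 = (\<lambda>z. H (G0 z, kE (fst z)))"
  have G1_cont: "continuous_map Z M G1"
  proof -
    have "continuous_map Z I01 (\<lambda>z. kE (fst z))"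
      using kE topZ topP continuous_map_compose[OF fstZ kE(1)]
      by (intro continuous_map_into_I01) (auto simp: o_def)
    then have "continuous_map Z (prod_topology M I01) (\<lambda>z. (G0 z, kE (fst z)))"
      using G0(1) by (simp add: continuous_map_paired)
    from continuous_map_compose[OF this H(1)] show ?thesis by (simp add: G1_def o_def)
  qed
  have G1_D: "G1 z = g z" if "z \<in> D - B0" for z
  proof -
    have "fst z \<in> B \<union> C" using that by (auto simp: D_def)
    then have "kE (fst z) = 0" using kE subY by blast
    then show ?thesis using G0(2)[OF that] g_maps[OF that] H(2) by (simp add: G1_def)
  qed
  have G1_maps: "G1 z \<in> topspace M - X" if "z \<in> topspace Z" for z
  proof (cases "z \<in> D")
    case True
    then show ?thesis using G1_D g_maps that topZ by simp
  next
    case False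
    then have "fst z \<in> topspace Y" "fst z \<notin> B \<union> C"
      using that topZ topP by (auto simp: D_def)
    then have "0 < kE (fst z)" "kE (fst z) \<le> 1" using bspec[OF kE(2), of "fst z"] by auto
    moreover have "G0 z \<in> topspace M"
      using continuous_map_image_subset_topspace[OF G0(1)] that by blast
    ultimately show ?thesis using H(3) by (simp add: G1_def)
  qed

  obtain dP where dP: "mtopology_of dP = P" using metrizable_space_metric[OF P] .
  have mdP: "mspace dP = topspace P" using dP by auto
  \<comment> \<open>The tolerance: continuous, positive off \<open>B0\<close> and zero on
    \<open>B0\<close>, hence tending to 0 along every sequence that converges to a point of
    \<open>B0\<close>.\<close>
  define \<beta> where "\<beta> = (\<lambda>z. max (snd z) (kB (fst z)))"
  have \<beta>_cont: "continuous_map P euclideanreal \<beta>"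
    unfolding \<beta>_def using continuous_map_compose[OF fstP kB(1)]
    by (intro continuous_map_real_max sndP) (simp add: o_def)
  have \<beta>_pos: "0 < \<beta> z" if "z \<in> topspace Z" for z
  proof -
    have z: "fst z \<in> topspace Y" "0 \<le> snd z" "fst z \<notin> B \<or> snd z \<noteq> 0"
      using that by (auto simp: topZ topP B0_def)
    then show ?thesis using bspec[OF kB(2), of "fst z"] by (auto simp: \<beta>_def less_max_iff_disj)
  qed
  have \<beta>_B0: "\<beta> z = 0" if "z \<in> B0" for z
    using that bspec[OF kB(2), of "fst z"] subY by (auto simp: B0_def \<beta>_def)
  \<comment> \<open>Each point of \<open>V\<close> has a companion in the domain of \<open>g\<close>
    that is close in position and in value. Near \<open>B0\<close> this transfers the subsequential
    limits of \<open>g\<close> to \<open>G1\<close>.\<close>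
  define V where "V = {z \<in> topspace Z. \<exists>z'\<in>D - B0. mdist dP z z' < \<beta> z \<and> mdist d (G1 z) (g z') < \<beta> z}"
  have "openin Z V"
  proof -
    have "openin Z {z \<in> topspace Z. \<beta> z - max (mdist dP z z') (mdist d (G1 z) (g z')) \<in> {0<..}}"
      if "z' \<in> D - B0" for z'
    proof (rule openin_continuous_map_preimage)
      have "z' \<in> mspace dP" using that D closedin_subset mdP by auto
      then have "continuous_map Z euclideanreal (\<lambda>z. mdist dP z z')"
        using continuous_map_mdist_left[of z' dP] dP
        by (simp add: Z_def continuous_map_from_subtopology)
      moreover have "continuous_map Z euclideanreal (\<lambda>z. mdist d (G1 z) (g z'))"
        using continuous_map_compose[OF G1_cont, of euclideanreal "\<lambda>m. mdist d m (g z')"]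
          continuous_map_mdist_left[of "g z'" d] g_maps[OF that] M(1) by (simp add: o_def)
      moreover have "continuous_map Z euclideanreal \<beta>"
        unfolding Z_def by (rule continuous_map_from_subtopology[OF \<beta>_cont])
      ultimately show "continuous_map Z euclideanreal
          (\<lambda>z. \<beta> z - max (mdist dP z z') (mdist d (G1 z) (g z')))"
        by (intro continuous_map_diff continuous_map_real_max)
    qed auto
    then have "openin Z (\<Union>z'\<in>D - B0. {z \<in> topspace Z. \<beta> z - max (mdist dP z z') (mdist d (G1 z) (g z')) \<in> {0<..}})"
      by blast
    also have "(\<Union>z'\<in>D - B0. {z \<in> topspace Z. \<beta> z - max (mdist dP z z') (mdist d (G1 z) (g z')) \<in> {0<..}}) = V"
      by (auto simp: V_def)
    finally show ?thesis .
  qed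
  moreover have "openin P (topspace P - B0)" using B0 by blast
  ultimately have openO: "openin P V"
    unfolding Z_def by (metis openin_open_subtopology)
  have DO: "D - B0 \<subseteq> V"
  proof
    fix z assume z: "z \<in> D - B0"
    then have "z \<in> topspace Z" using D closedin_subset topZ by fastforce
    moreover have "mdist dP z z = 0" "mdist d (G1 z) (g z) = 0"
      using calculation z G1_D g_maps M(1) mdP topZ by auto
    ultimately show "z \<in> V"
      using \<beta>_pos[of z] z unfolding V_def by (intro CollectI conjI bexI[of _ z]) simp_all
  qed

  \<comment> \<open>The base points whose fibre leaves \<open>V\<close> at some height at least
    \<open>(1/2)^n\<close>. Projection along the compact factor \<open>[0,1]\<close> is a closed
    map, which makes these sets closed.\<close>
  define Cn where "Cn = (\<lambda>n. fst ` ((topspace P - V) \<inter> {p \<in> topspace P. snd p \<in> {(1/2)^n..}}))"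
  have Cn_iff: "y \<in> Cn n \<longleftrightarrow> y \<in> topspace Y \<and> (\<exists>t. (1/2)^n \<le> t \<and> t \<le> 1 \<and> (y, t) \<notin> V)" for n y
  proof -
    have "0 \<le> t" if "(1/2)^n \<le> t" for t :: real
      by (rule order_trans[OF _ that]) simp
    then show ?thesis by (force simp: Cn_def topP)
  qed
  have Cn_closed: "closedin Y (Cn n)" for n
  proof -
    have "closedin P ((topspace P - V) \<inter> {p \<in> topspace P. snd p \<in> {(1/2)^n..}})"
      by (intro closedin_Int closedin_continuous_map_preimage[OF sndP]) (use openO in auto)
    moreover have "closed_map P Y fst"
      unfolding P_def by (rule closed_map_fst) (simp add: compact_space_subtopology)
    ultimately show ?thesis unfolding Cn_def closed_map_def by blast
  qed
  have Cn_disj: "disjnt (B \<union> C) (Cn n)" for n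
  proof -
    have "(y, t) \<in> V" if "y \<in> B \<union> C" "(1/2)^n \<le> t" "t \<le> 1" for y t
    proof -
      have "0 < t" by (rule less_le_trans[OF _ that(2)]) simp
      then show ?thesis using DO that by (auto simp: D_def B0_def)
    qed
    then show ?thesis unfolding disjnt_iff Cn_iff by blast
  qed
  obtain s where s: "continuous_map Y euclideanreal s" "\<forall>y\<in>topspace Y. 0 \<le> s y"
    "\<forall>y\<in>B \<union> C. s y = 0" "\<forall>n. \<forall>y\<in>Cn n. (1/2)^n \<le> s y"
    by (rule vanishing_majorant[OF metrizable_imp_normal_space[OF Y] BC Cn_closed Cn_disj])
  \<comment> \<open>The new height has to bring the point into \<open>V\<close>. The factor 2 makes
    up for rounding a height down to a power of 1/2. The term \<open>kE\<close> keeps the height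
    positive off \<open>B \<union> C\<close>, since the sets \<open>Cn n\<close> give no information
    at height 0. The cap \<open>min 1\<close> keeps it in the interval.\<close>
  define w where "w = (\<lambda>p. (fst p, min 1 (max (snd p) (max (2 * s (fst p)) (kE (fst p))))))"
  have w_cont: "continuous_map P P w"
    unfolding P_def w_def continuous_map_paired
  proof (intro conjI continuous_map_into_I01)
    show "continuous_map (prod_topology Y I01) Y fst" by (rule continuous_map_fst)
    show "continuous_map (prod_topology Y I01) euclideanreal
        (\<lambda>x. min 1 (max (snd x) (max (2 * s (fst x)) (kE (fst x)))))"
      using continuous_map_compose[OF fstP s(1)] continuous_map_compose[OF fstP kE(1)] sndP
      unfolding P_def o_def
      by (intro continuous_map_real_min continuous_map_real_max continuous_map_real_mult_left) auto
  qed auto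
  have w_D: "w p = p" if "p \<in> D" for p
  proof -
    have "fst p \<in> B \<union> C" "snd p \<in> {0..1}" using that by (auto simp: D_def)
    moreover have "kE (fst p) = 0" using bspec[OF kE(2), of "fst p"] calculation subY by blast
    ultimately show ?thesis using s(3) by (simp add: w_def prod_eq_iff)
  qed
  have w_Z: "w p \<in> topspace Z" if "p \<in> topspace Z" for p
  proof -
    have "w p \<in> topspace P"
      using continuous_map_image_subset_topspace[OF w_cont] that topZ by blast
    moreover have "w p \<notin> B0"
    proof
      assume *: "w p \<in> B0"
      then have "fst p \<in> B" "snd (w p) = 0" by (auto simp: B0_def w_def)
      then have "p \<in> D" using that by (auto simp: topZ topP D_def)
      then show False using w_D * that topZ by simp
    qed
    ultimately show ?thesis by (simp add: topZ)
  qed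
  have w_O: "w p \<in> V" if p: "p \<in> topspace Z" and C0: "fst p \<notin> Cn 0" for p
  proof (cases "fst p \<in> B \<union> C")
    case True
    then have "p \<in> D - B0" using p by (auto simp: topZ topP D_def)
    then show ?thesis using DO w_D by auto
  next
    case False
    define t where "t = snd (w p)"
    have y: "fst p \<in> topspace Y" using p topZ topP by auto
    have wp: "w p = (fst p, t)" by (simp add: t_def w_def)
    have t: "0 < t" "t \<le> 1"
      using bspec[OF kE(2) y] False by (auto simp: t_def w_def less_max_iff_disj)
    show ?thesis
    proof (rule ccontr)
      assume notO: "w p \<notin> V"
      \<comment> \<open>At height 1 the base point would belong to \<open>Cn 0\<close>. So the cap
        is inactive and \<open>t\<close> is at least \<open>2 * s (fst p)\<close>.\<close>
      have "t \<noteq> 1"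
        using C0 notO y unfolding Cn_iff wp by auto
      then have st: "2 * s (fst p) \<le> t" "t < 1"
        using t by (auto simp: t_def w_def)
      have "\<exists>n. (1/2)^n \<le> t"
        using real_arch_pow_inv[OF t(1), of "1/2"] by (auto intro: less_imp_le)
      then obtain n where n: "(1/2)^n \<le> t" "\<And>k. k < n \<Longrightarrow> \<not> (1/2)^k \<le> t"
        using exists_least_iff[of "\<lambda>n. (1/2)^n \<le> t"] by blast
      have "n \<noteq> 0" using n(1) st(2) by (cases n) auto
      \<comment> \<open>As \<open>n\<close> is least with \<open>(1/2)^n \<le> t\<close>, the height
        is below \<open>2 * (1/2)^n\<close>, and this is at most \<open>2 * s (fst p)\<close>
        because the base point lies in \<open>Cn n\<close>: a contradiction.\<close>
      then have "t < 2 * (1/2)^n" using n(2)[of "n - 1"] by (cases n) auto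
      moreover have "fst p \<in> Cn n" unfolding Cn_iff using y n(1) t notO wp by auto
      ultimately show False using s(4)[rule_format, of "fst p" n] st(1) by linarith
    qed
  qed
  have wZ_cont: "continuous_map Z Z w"
    unfolding Z_def
  proof (rule continuous_map_into_subtopology)
    show "continuous_map (subtopology P (topspace P - B0)) P w"
      by (rule continuous_map_from_subtopology[OF w_cont])
    show "w \<in> topspace (subtopology P (topspace P - B0)) \<rightarrow> topspace P - B0"
      using w_Z topZ Z_def by auto
  qed
  define G where "G = G1 \<circ> w"
  have G_cont: "continuous_map Z M G"
    unfolding G_def by (rule continuous_map_compose[OF wZ_cont G1_cont])
  have "approaching P B0 M X G"
  proof (rule approachingI[OF P])
    fix p assume "p \<in> topspace P - B0"
    then show "G p \<in> topspace M - X" using G1_maps w_Z topZ by (simp add: G_def)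
  next
    fix \<sigma> x assume \<sigma>: "range \<sigma> \<subseteq> topspace P - B0" and l: "limitin P \<sigma> x sequentially"
    have xP: "x \<in> topspace P" using limitin_topspace[OF l] .
    show "\<exists>r y. strict_mono (r :: nat \<Rightarrow> nat) \<and> limitin M (G \<circ> \<sigma> \<circ> r) y sequentially \<and>
        (x \<in> B0 \<longrightarrow> y \<in> X) \<and> (x \<notin> B0 \<longrightarrow> y = G x)"
    proof (cases "x \<in> B0")
      case False
      then have "limitin Z \<sigma> x sequentially"
        using \<sigma> l xP unfolding Z_def limitin_subtopology by (auto intro!: always_eventually)
      from continuous_map_limit[OF G_cont this] show ?thesis
        using False by (intro exI[of _ id] exI[of _ "G x"]) (simp add: strict_mono_id)
    next
      case True
      then have xD: "x \<in> D" and xB: "fst x \<in> B" by (auto simp: B0_def D_def)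
      have "limitin Y (fst \<circ> \<sigma>) (fst x) sequentially"
        by (rule continuous_map_limit[OF fstP l])
      moreover have "openin Y (topspace Y - Cn 0)" "fst x \<in> topspace Y - Cn 0"
        using Cn_closed Cn_disj[of 0] xB subY by (auto simp: disjnt_iff)
      ultimately have "\<forall>\<^sub>F n in sequentially. (fst \<circ> \<sigma>) n \<in> topspace Y - Cn 0"
        unfolding limitin_def by blast
      \<comment> \<open>Eventually the base points avoid the closed set \<open>Cn 0\<close>, which
        misses \<open>B\<close>. From there on \<open>w_O\<close> applies; \<open>v\<close> drops
        the finitely many earlier terms.\<close>
      then obtain N where N: "\<And>n. n \<ge> N \<Longrightarrow> fst (\<sigma> n) \<notin> Cn 0"
        unfolding eventually_sequentially by auto
      define v where "v = (\<lambda>n. w (\<sigma> (n + N)))"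
      have \<sigma>Z: "\<sigma> n \<in> topspace Z" for n using \<sigma> topZ by auto
      have "v n \<in> V" for n
        unfolding v_def using N[of "n + N"] by (intro w_O \<sigma>Z) simp
      then have "\<forall>n. \<exists>z'\<in>D - B0. mdist dP (v n) z' < \<beta> (v n) \<and> mdist d (G1 (v n)) (g z') < \<beta> (v n)"
        unfolding V_def by blast
      \<comment> \<open>The tolerance tends to 0, so the companions \<open>z' n\<close> have the
        same limit \<open>x\<close>. The hypothesis on \<open>g\<close> applies to them, and
        \<open>G1\<close> inherits the subsequential limit along \<open>v\<close>.\<close>
      then obtain z' where z': "\<And>n. z' n \<in> D - B0" "\<And>n. mdist dP (v n) (z' n) < \<beta> (v n)"
        "\<And>n. mdist d (G1 (v n)) (g (z' n)) < \<beta> (v n)" by metis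
      have "limitin P (w \<circ> \<sigma>) x sequentially"
        using continuous_map_limit[OF w_cont l] w_D[OF xD] by simp
      then have lv: "limitin P v x sequentially"
        unfolding v_def by (drule_tac limitin_sequentially_offset[where k=N]) (simp add: o_def)
      have "limitin euclideanreal (\<beta> \<circ> v) (\<beta> x) sequentially"
        by (rule continuous_map_limit[OF \<beta>_cont lv])
      then have \<beta>0: "(\<lambda>n. \<beta> (v n)) \<longlonglongrightarrow> 0" using \<beta>_B0[OF True] by (simp add: o_def)
      have z'P: "z' n \<in> topspace P" for n using z'(1) D closedin_subset by auto
      have "limitin P z' x sequentially"
        using limitin_mdist_close[of dP v x sequentially z' "\<lambda>n. \<beta> (v n)"] lv dP z'P mdP z'(2) \<beta>0
        by (simp add: less_imp_le)
      then have lz': "limitin (subtopology P D) z' x sequentially"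
        unfolding limitin_subtopology using z'(1) xD by auto
      have "range z' \<subseteq> topspace (subtopology P D) - B0" using z'(1) z'P by auto
      then obtain r y where r: "strict_mono (r :: nat \<Rightarrow> nat)" "limitin M (g \<circ> z' \<circ> r) y sequentially"
        "x \<in> B0 \<longrightarrow> y \<in> X" "x \<notin> B0 \<longrightarrow> y = g x"
        using approachingD[OF g, folded P_def, folded D_def B0_def, OF _ lz'] by blast
      have "limitin M (G1 \<circ> v \<circ> r) y sequentially"
      proof (unfold M(1), rule limitin_mdist_close)
        show "limitin (mtopology_of d) (g \<circ> z' \<circ> r) y sequentially" using r(2) M(1) by simp
        show "(G1 \<circ> v \<circ> r) n \<in> mspace d" for n
          using G1_maps[OF w_Z[OF \<sigma>Z]] M(1) by (simp add: v_def)
        show "mdist d ((g \<circ> z' \<circ> r) n) ((G1 \<circ> v \<circ> r) n) \<le> \<beta> (v (r n))" for n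
          using z'(3)[of "r n"] by (simp add: mdist_commute less_imp_le)
        show "(\<lambda>n. \<beta> (v (r n))) \<longlonglongrightarrow> 0"
          using LIMSEQ_subseq_LIMSEQ[OF \<beta>0 r(1)] by (simp add: o_def)
      qed
      moreover have "G1 \<circ> v \<circ> r = G \<circ> \<sigma> \<circ> (\<lambda>n. r n + N)"
        by (auto simp: G_def v_def)
      moreover have "strict_mono (\<lambda>n. r n + N)" using r(1) by (simp add: strict_mono_def)
      ultimately show ?thesis using r(3) True by metis
    qed
  qed
  moreover have "G p = g p" if "p \<in> D" "p \<notin> B0" for p
    using that w_D G1_D by (simp add: G_def)
  ultimately show ?thesis using that unfolding P_def D_def B0_def by blast
qed

section \<open>Telescopes over homotopy negligible sets\<close>

abbreviation telescope :: "'w topology \<Rightarrow> 'm topology \<Rightarrow> 'm set \<Rightarrow> ('w \<times> real \<Rightarrow> 'm) \<Rightarrow> bool" where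
  "telescope W \<equiv> approaching (prod_topology W I01) (topspace W \<times> {0})"

abbreviation telescope_homotopic ::
    "'w topology \<Rightarrow> 'm topology \<Rightarrow> 'm set \<Rightarrow> ('w \<times> real \<Rightarrow> 'm) \<Rightarrow> ('w \<times> real \<Rightarrow> 'm) \<Rightarrow> bool" where
  "telescope_homotopic W \<equiv> approaching_homotopic (prod_topology W I01) (topspace W \<times> {0})"

lemma continuous_map_fst_fst: "continuous_map (prod_topology (prod_topology A B) C) A (\<lambda>p. fst (fst p))"
  using continuous_map_compose[OF continuous_map_fst continuous_map_fst] by (simp add: o_def)

lemma continuous_map_snd_fst: "continuous_map (prod_topology (prod_topology A B) C) B (\<lambda>p. snd (fst p))"
  using continuous_map_compose[OF continuous_map_fst continuous_map_snd] by (simp add: o_def)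

lemma continuous_map_I01_mult:
  assumes "continuous_map T I01 f" "continuous_map T I01 g"
  shows "continuous_map T I01 (\<lambda>x. f x * g x)"
proof (rule continuous_map_into_I01)
  show "continuous_map T euclideanreal (\<lambda>x. f x * g x)"
    using assms by (intro continuous_map_real_mult continuous_map_from_I01)
  show "0 \<le> f x * g x \<and> f x * g x \<le> 1" if "x \<in> topspace T" for x
    using assms that by (auto simp: continuous_map_in_subtopology Pi_iff mult_le_one)
qed

lemma continuous_map_I01_compl:
  assumes "continuous_map T I01 f"
  shows "continuous_map T I01 (\<lambda>x. 1 - f x)"
proof (rule continuous_map_into_I01)
  show "continuous_map T euclideanreal (\<lambda>x. 1 - f x)"
    using assms by (intro continuous_map_diff continuous_map_from_I01) auto
  show "0 \<le> 1 - f x \<and> 1 - f x \<le> 1" if "x \<in> topspace T" for x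
    using assms that by (auto simp: continuous_map_in_subtopology Pi_iff)
qed

lemma instant_homotopy_mem_iff:
  assumes "instant_homotopy Y A h" "y \<in> topspace Y" "0 \<le> t" "t \<le> 1"
  shows "h (y, t) \<in> A \<longleftrightarrow> y \<in> A \<and> t = 0"
proof (cases "t = 0")
  case True
  then show ?thesis using assms by (simp add: instant_homotopy_def)
next
  case False
  then have "h (y, t) \<in> h ` (topspace Y \<times> {0<..1})" using assms by (intro imageI) auto
  then have "h (y, t) \<notin> A" using assms(1) unfolding instant_homotopy_def by blast
  then show ?thesis using False by simp
qed

lemma instant_homotopy_approaching:
  assumes Y: "metrizable_space Y" and h: "instant_homotopy Y A h"
  shows "approaching (prod_topology Y I01) (A \<times> {0}) Y A h"
proof (rule approaching_continuous[OF metrizable_prod_I01[OF Y]])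
  show "continuous_map (prod_topology Y I01) Y h" using h by (simp add: instant_homotopy_def)
  show "h p \<in> A \<longleftrightarrow> p \<in> A \<times> {0}" if "p \<in> topspace (prod_topology Y I01)" for p
    using that instant_homotopy_mem_iff[OF h, of "fst p" "snd p"] by (auto simp: mem_Times_iff)
qed

section \<open>Between telescopes over the negligible set and maps off it\<close>

text \<open>Off \<open>A\<close> an extended telescope is defined down to height 0. Its bottom slice
  is how a map on \<open>Y - A\<close> is obtained from it.\<close>

lemma approaching_slice:
  assumes Y: "metrizable_space Y" and G: "approaching (prod_topology Y I01) (A \<times> {0}) M X G"
  shows "approaching Y A M X (\<lambda>y. G (y, 0))"
proof -
  have "approaching Y A (prod_topology Y I01) (A \<times> {0}) (\<lambda>y. (y, 0))"
    by (rule approaching_continuous[OF Y]) (auto simp: continuous_map_paired)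
  from approaching_compose[OF Y this G] show ?thesis by (simp add: o_def)
qed

text \<open>Extend \<open>g\<close> to \<open>G\<close> over \<open>Y \<times> [0,1]\<close> and
  take the bottom slice as \<open>\<phi>\<close>. The path
  \<open>(h (a, \<theta> * t), (1 - \<theta>) * t)\<close> leads from \<open>(a, t)\<close>, where
  \<open>G\<close> is \<open>g\<close>, to \<open>(h (a, t), 0)\<close>, where \<open>G\<close> is
  \<open>\<phi> \<circ> h\<close>. It meets \<open>A \<times> {0}\<close> only for
  \<open>t = 0\<close>, so composing with \<open>G\<close> gives the homotopy.\<close>

lemma extend_telescope:
  assumes adm: "admissible_data M X u H d" and Y: "metrizable_space Y" and A: "closedin Y A"
    and h: "instant_homotopy Y A h" and g: "telescope (subtopology Y A) M X g"
  obtains \<phi> where "approaching Y A M X \<phi>" "telescope_homotopic (subtopology Y A) M X (\<phi> \<circ> h) g"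
proof -
  let ?A = "subtopology Y A"
  have sub: "topspace Y \<inter> A = A" using closedin_subset[OF A] by auto
  have "telescope ?A M X g = approaching (subtopology (prod_topology Y I01) ((A \<union> {}) \<times> {0..1})) (A \<times> {0}) M X g"
    by (simp add: sub prod_topology_subtopology(1))
  with g obtain G where G: "approaching (prod_topology Y I01) (A \<times> {0}) M X G"
    and Gg: "\<And>p. \<lbrakk>p \<in> (A \<union> {}) \<times> {0..1}; p \<notin> A \<times> {0}\<rbrakk> \<Longrightarrow> G p = g p"
    using approaching_extension[OF adm Y A closedin_empty, of g] by metis
  let ?P = "prod_topology (prod_topology ?A I01) I01"
  define J where "J = (\<lambda>p. (h (fst (fst p), snd p * snd (fst p)), (1 - snd p) * snd (fst p)))"
  have mA: "metrizable_space (prod_topology ?A I01)"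
    by (intro metrizable_prod_I01 metrizable_space_subtopology Y)
  have mP: "metrizable_space ?P" by (rule metrizable_prod_I01[OF mA])
  have "continuous_map ?P (prod_topology Y I01) (\<lambda>p. (fst (fst p), snd p * snd (fst p)))"
    unfolding continuous_map_paired
    using continuous_map_fst_fst[of ?A I01 I01]
    by (intro conjI continuous_map_I01_mult continuous_map_snd continuous_map_snd_fst)
      (simp add: continuous_map_in_subtopology)
  from continuous_map_compose[OF this, of Y h]
  have "continuous_map ?P Y (\<lambda>p. h (fst (fst p), snd p * snd (fst p)))"
    using h by (simp add: o_def instant_homotopy_def)
  then have J: "continuous_map ?P (prod_topology Y I01) J"
    unfolding J_def continuous_map_paired
    by (intro conjI continuous_map_I01_mult continuous_map_I01_compl continuous_map_snd continuous_map_snd_fst)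
  have "approaching ?P ((A \<times> {0}) \<times> {0..1}) (prod_topology Y I01) (A \<times> {0}) J"
  proof (rule approaching_continuous[OF mP J])
    fix p assume p: "p \<in> topspace ?P"
    obtain a t \<theta> where [simp]: "p = ((a, t), \<theta>)" by (metis surj_pair)
    have *: "a \<in> A" "a \<in> topspace Y" "0 \<le> t" "t \<le> 1" "0 \<le> \<theta>" "\<theta> \<le> 1" using p sub by auto
    show "J p \<in> A \<times> {0} \<longleftrightarrow> p \<in> (A \<times> {0}) \<times> {0..1}"
      using * instant_homotopy_mem_iff[OF h, of a "\<theta> * t"] by (auto simp: J_def mult_le_one)
  qed
  from approaching_compose[OF mP this G]
  have "approaching ?P ((A \<times> {0}) \<times> {0..1}) M X (G \<circ> J)" .
  moreover have "(G \<circ> J) (m, 0) = g m \<and> (G \<circ> J) (m, 1) = ((\<lambda>y. G (y, 0)) \<circ> h) m"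
    if "m \<in> topspace (prod_topology ?A I01) - A \<times> {0}" for m
  proof -
    have "h (fst m, 0) = fst m" using that h by (auto simp: instant_homotopy_def)
    then show ?thesis using that Gg[of m] by (auto simp: J_def)
  qed
  ultimately have "telescope_homotopic ?A M X g ((\<lambda>y. G (y, 0)) \<circ> h)"
    unfolding approaching_homotopic_def by (intro exI[of _ "G \<circ> J"]) (simp add: sub)
  then have "telescope_homotopic ?A M X ((\<lambda>y. G (y, 0)) \<circ> h) g"
    by (rule approaching_homotopic_sym[OF mA])
  then show ?thesis using that approaching_slice[OF Y G] by blast
qed

lemma approaching_closed_Un3:
  assumes T: "metrizable_space T"
    and C: "closedin T C1" "closedin T C2" "closedin T C3" "topspace T \<subseteq> C1 \<union> C2 \<union> C3"
    and F: "approaching (subtopology T C1) (B \<inter> C1) N Y F"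
      "approaching (subtopology T C2) (B \<inter> C2) N Y F"
      "approaching (subtopology T C3) (B \<inter> C3) N Y F"
  shows "approaching T B N Y F"
proof (rule approaching_closed_Un[OF T C(1) closedin_Un[OF C(2,3)] _ F(1)])
  show "topspace T \<subseteq> C1 \<union> (C2 \<union> C3)" using C(4) by auto
  show "approaching (subtopology T (C2 \<union> C3)) (B \<inter> (C2 \<union> C3)) N Y F"
  proof (rule approaching_closed_Un)
    show "closedin (subtopology T (C2 \<union> C3)) C2" "closedin (subtopology T (C2 \<union> C3)) C3"
      using C by (auto intro: closedin_subset_topspace)
    have "(C2 \<union> C3) \<inter> C2 = C2" "(C2 \<union> C3) \<inter> C3 = C3" by auto
    then show "approaching (subtopology (subtopology T (C2 \<union> C3)) C2) (B \<inter> (C2 \<union> C3) \<inter> C2) N Y F"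
      "approaching (subtopology (subtopology T (C2 \<union> C3)) C3) (B \<inter> (C2 \<union> C3) \<inter> C3) N Y F"
      using F(2,3) by (simp_all add: subtopology_subtopology Int_assoc)
  qed (auto simp: T metrizable_space_subtopology)
qed

text \<open>Again \<open>approaching_extension\<close>, now with base
  \<open>Y \<times> [0,1]\<close>, whose second factor is the homotopy parameter. The given homotopy
  \<open>K\<close> is prescribed over \<open>A\<close>, and \<open>\<phi> \<circ> h\<close>,
  \<open>\<psi> \<circ> h\<close> over the ends 0 and 1. The bottom slice of the extension joins
  \<open>\<phi>\<close> to \<open>\<psi>\<close>, because \<open>h\<close> is the identity at time
  0.\<close>

lemma approaching_homotopic_if_telescope_homotopic:
  fixes Y :: "'y topology"
  assumes adm: "admissible_data M X u H d" and Y: "metrizable_space Y" and A: "closedin Y A"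
    and h: "instant_homotopy Y A h"
    and \<phi>: "approaching Y A M X \<phi>" and \<psi>: "approaching Y A M X \<psi>"
    and hom: "telescope_homotopic (subtopology Y A) M X (\<phi> \<circ> h) (\<psi> \<circ> h)"
  shows "approaching_homotopic Y A M X \<phi> \<psi>"
proof -
  let ?A = "subtopology Y A"
  have sub: "topspace Y \<inter> A = A" using closedin_subset[OF A] by auto
  obtain K where K: "approaching (prod_topology (prod_topology ?A I01) I01) ((A \<times> {0}) \<times> {0..1}) M X K"
    "\<And>m. m \<in> A \<times> {0..1} - A \<times> {0} \<Longrightarrow> K (m, 0) = (\<phi> \<circ> h) m \<and> K (m, 1) = (\<psi> \<circ> h) m"
    using hom unfolding approaching_homotopic_def by (auto simp: sub)
  let ?B = "A \<times> {0..1::real}" and ?C = "topspace Y \<times> {0, 1::real}"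
  let ?T = "prod_topology (prod_topology Y I01) I01"
  define T where "T = subtopology ?T ((?B \<union> ?C) \<times> {0..1})"
  note mY = metrizable_prod_I01[OF Y]
  have mT: "metrizable_space T" unfolding T_def
    by (intro metrizable_space_subtopology metrizable_prod_I01 Y)
  have B: "closedin (prod_topology Y I01) ?B"
    unfolding closedin_prod_Times_iff using A by auto
  have C: "closedin (prod_topology Y I01) ?C"
    unfolding closedin_prod_Times_iff by (auto intro!: closedin_subset_topspace)
  have topT: "topspace T = (?B \<union> ?C) \<times> {0..1}"
    using closedin_subset[OF B] closedin_subset[OF C] by (auto simp: T_def)
  have c1: "continuous_map T Y (\<lambda>p. fst (fst p))" and c2: "continuous_map T I01 (\<lambda>p. snd (fst p))"
    and c3: "continuous_map T I01 snd"
    unfolding T_def by (intro continuous_map_from_subtopology continuous_map_fst_fst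
        continuous_map_snd_fst continuous_map_snd)+
  define F where "F = (\<lambda>p :: ('y \<times> real) \<times> real. h (fst (fst p), snd p))"
  have F: "approaching T (?B \<times> {0}) Y A F"
  proof (rule approaching_continuous[OF mT])
    have "continuous_map T (prod_topology Y I01) (\<lambda>p. (fst (fst p), snd p))"
      unfolding continuous_map_paired using c1 c3 by blast
    from continuous_map_compose[OF this, of Y h] show "continuous_map T Y F"
      using h by (simp add: F_def o_def instant_homotopy_def)
    fix p assume p: "p \<in> topspace T"
    obtain y \<theta> t where [simp]: "p = ((y, \<theta>), t)" by (metis surj_pair)
    have "y \<in> topspace Y" "0 \<le> t" "t \<le> 1" "0 \<le> \<theta>" "\<theta> \<le> 1"
      using p topT sub by auto
    then show "F p \<in> A \<longleftrightarrow> p \<in> ?B \<times> {0}"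
      using instant_homotopy_mem_iff[OF h, of y t] by (auto simp: F_def)
  qed
  \<comment> \<open>\<open>K\<close> expects the telescope parameter before the homotopy parameter;
    points of \<open>T\<close> carry them in the other order.\<close>
  define F3 where "F3 = (\<lambda>p :: ('y \<times> real) \<times> real. ((fst (fst p), snd p), snd (fst p)))"
  define g where "g = (\<lambda>p. if snd (fst p) = 0 then \<phi> (F p) else if snd (fst p) = 1 then \<psi> (F p) else K (F3 p))"
  define C1 where "C1 = {p \<in> topspace T. snd (fst p) \<in> {0}}"
  define C2 where "C2 = {p \<in> topspace T. snd (fst p) \<in> {1}}"
  define C3 where "C3 = {p \<in> topspace T. fst (fst p) \<in> A}"
  have "approaching T (?B \<times> {0}) M X g"
  proof (rule approaching_closed_Un3[OF mT])
    show "closedin T C1" "closedin T C2"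
      unfolding C1_def C2_def
      by (rule closedin_continuous_map_preimage[OF continuous_map_from_I01[OF c2]]; simp)+
    show "closedin T C3"
      unfolding C3_def by (rule closedin_continuous_map_preimage[OF c1 A])
    show "topspace T \<subseteq> C1 \<union> C2 \<union> C3" by (auto simp: C1_def C2_def C3_def topT)
    show "approaching (subtopology T C1) (?B \<times> {0} \<inter> C1) M X g"
      by (rule approaching_cong[OF approaching_subtopology[OF mT approaching_compose[OF mT F \<phi>]]])
        (auto simp: mT metrizable_space_subtopology g_def C1_def)
    show "approaching (subtopology T C2) (?B \<times> {0} \<inter> C2) M X g"
      by (rule approaching_cong[OF approaching_subtopology[OF mT approaching_compose[OF mT F \<psi>]]])
        (auto simp: mT metrizable_space_subtopology g_def C2_def)
    have m3: "metrizable_space (subtopology T C3)" by (rule metrizable_space_subtopology[OF mT])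
    have "approaching (subtopology T C3) (?B \<times> {0} \<inter> C3)
        (prod_topology (prod_topology ?A I01) I01) ((A \<times> {0}) \<times> {0..1}) F3"
    proof (rule approaching_continuous[OF m3])
      have "continuous_map (subtopology T C3) ?A (\<lambda>p. fst (fst p))"
        by (rule continuous_map_into_subtopology[OF continuous_map_from_subtopology[OF c1]])
          (auto simp: C3_def)
      then show "continuous_map (subtopology T C3) (prod_topology (prod_topology ?A I01) I01) F3"
        unfolding F3_def continuous_map_paired
        using continuous_map_from_subtopology[OF c2] continuous_map_from_subtopology[OF c3] by blast
      show "F3 p \<in> (A \<times> {0}) \<times> {0..1} \<longleftrightarrow> p \<in> ?B \<times> {0} \<inter> C3" if "p \<in> topspace (subtopology T C3)" for p
        using that by (auto simp: F3_def C3_def mem_Times_iff)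
    qed
    from approaching_compose[OF m3 this K(1)]
    show "approaching (subtopology T C3) (?B \<times> {0} \<inter> C3) M X g"
    proof (rule approaching_cong[OF _ m3])
      fix p assume p: "p \<in> topspace (subtopology T C3) - ?B \<times> {0} \<inter> C3"
      obtain y \<theta> t where [simp]: "p = ((y, \<theta>), t)" by (metis surj_pair)
      have "(y, t) \<in> A \<times> {0..1} - A \<times> {0}" using p topT by (auto simp: C3_def)
      from K(2)[OF this] show "(K \<circ> F3) p = g p" by (auto simp: F3_def g_def F_def)
    qed
  qed
  then obtain G where G: "approaching ?T (?B \<times> {0}) M X G"
    and Gg: "\<And>p. \<lbrakk>p \<in> (?B \<union> ?C) \<times> {0..1}; p \<notin> ?B \<times> {0}\<rbrakk> \<Longrightarrow> G p = g p"
    unfolding T_def using approaching_extension[OF adm mY B C, of g] by metis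
  have "G ((y, 0), 0) = \<phi> y \<and> G ((y, 1), 0) = \<psi> y" if "y \<in> topspace Y - A" for y
  proof -
    have "h (y, 0) = y" using that h by (auto simp: instant_homotopy_def)
    then show ?thesis using that Gg[of "((y, 0), 0)"] Gg[of "((y, 1), 0)"] by (simp add: g_def F_def)
  qed
  then show ?thesis
    unfolding approaching_homotopic_def using approaching_slice[OF mY G]
    by (intro exI[of _ "\<lambda>y. G (y, 0)"]) simp
qed

section \<open>Maps into the space of paths\<close>

lemma bar_X_memD:
  assumes "(\<epsilon>, \<gamma>) \<in> bar_X d X u"
  shows "0 < \<epsilon>" "\<epsilon> \<le> 1" "\<gamma> \<in> mspace (path_metric d X)" "\<gamma> 0 = None"
    "\<forall>t. 0 < t \<and> t \<le> 1 \<longrightarrow> (\<exists>m\<in>mspace d - X. \<gamma> t = Some m \<and> \<epsilon> \<le> u m)"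
    "\<exists>m\<in>X. m \<in> mspace d \<and> \<epsilon> \<le> u m"
proof -
  show "0 < \<epsilon>" "\<epsilon> \<le> 1" "\<gamma> \<in> mspace (path_metric d X)" "\<gamma> 0 = None"
    using assms unfolding bar_X_def X_eps_paths_def M_eps_paths_def by (simp_all del: mspace_cfunspace)
  have "\<gamma> ` {0<..1} \<subseteq> Some ` (level d u \<epsilon> - X)"
    using assms unfolding bar_X_def X_eps_paths_def M_eps_paths_def by (simp del: mspace_cfunspace)
  then show "\<forall>t. 0 < t \<and> t \<le> 1 \<longrightarrow> (\<exists>m\<in>mspace d - X. \<gamma> t = Some m \<and> \<epsilon> \<le> u m)"
    by (force simp: level_def image_subset_iff)
  have "\<gamma> ` {0..1} \<subseteq> collapse X ` level d u \<epsilon>"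
    using assms unfolding bar_X_def X_eps_paths_def M_eps_paths_def by (simp del: mspace_cfunspace)
  \<comment> \<open>The collapsed point belongs to the quotient of a level set only if that level
    set meets \<open>X\<close>.\<close>
  then have "\<gamma> 0 \<in> collapse X ` level d u \<epsilon>" by (rule subsetD) simp
  then show "\<exists>m\<in>X. m \<in> mspace d \<and> \<epsilon> \<le> u m"
    using \<open>\<gamma> 0 = None\<close> by (auto simp: level_def collapse_def split: if_splits)
qed

lemma bar_X_memI:
  assumes "0 < \<epsilon>" "\<epsilon> \<le> 1" "\<gamma> \<in> mspace (path_metric d X)" "\<gamma> 0 = None"
    and "\<And>t. \<lbrakk>0 < t; t \<le> 1\<rbrakk> \<Longrightarrow> \<exists>m\<in>mspace d - X. \<gamma> t = Some m \<and> \<epsilon> \<le> u m \<and> u m \<le> 1"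
    and "\<exists>m\<in>X. m \<in> mspace d \<and> \<epsilon> \<le> u m \<and> u m \<le> 1"
  shows "(\<epsilon>, \<gamma>) \<in> bar_X d X u"
proof -
  have "\<gamma> t \<in> Some ` (level d u \<epsilon> - X)" if "0 < t" "t \<le> 1" for t
    using assms(5)[OF that] by (auto simp: level_def)
  moreover have "None \<in> collapse X ` level d u \<epsilon>"
    using assms(6) by (force simp: level_def collapse_def)
  moreover have "Some ` (level d u \<epsilon> - X) \<subseteq> collapse X ` level d u \<epsilon>"
    by (force simp: collapse_def)
  ultimately have "\<gamma> t \<in> collapse X ` level d u \<epsilon>" if "0 \<le> t" "t \<le> 1" for t
    using that assms(4) by (cases "t = 0") auto
  then show ?thesis
    using assms(1-4) \<open>\<And>t. \<lbrakk>0 < t; t \<le> 1\<rbrakk> \<Longrightarrow> \<gamma> t \<in> Some ` (level d u \<epsilon> - X)\<close>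
    unfolding bar_X_def X_eps_paths_def M_eps_paths_def
    by (auto simp del: mspace_cfunspace)
qed

lemma metrizable_space_bar_X: "metrizable_space (bar_X_topology d X u)"
  unfolding bar_X_topology_def
  by (intro metrizable_space_subtopology metrizable_space_mtopology_of)

lemma mdist_bar_M_metric':
  "mdist (bar_M_metric d X u) p q = \<bar>fst p - fst q\<bar> + mdist (path_metric d X) (snd p) (snd q)"
  by (metis mdist_bar_M_metric prod.collapse)

lemma limitin_bar_X:
  assumes "limitin (bar_X_topology d X u) \<sigma> l F"
  shows "((\<lambda>n. fst (\<sigma> n)) \<longlongrightarrow> fst l) F"
    "((\<lambda>n. mdist (path_metric d X) (snd (\<sigma> n)) (snd l)) \<longlongrightarrow> 0) F"
proof -
  have lim: "((\<lambda>n. \<bar>fst (\<sigma> n) - fst l\<bar> + mdist (path_metric d X) (snd (\<sigma> n)) (snd l)) \<longlongrightarrow> 0) F"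
    using assms
    unfolding bar_X_topology_def limitin_subtopology limitin_mtopology_of mdist_bar_M_metric' by simp
  have "((\<lambda>n. \<bar>fst (\<sigma> n) - fst l\<bar>) \<longlongrightarrow> 0) F"
    by (rule tendsto_sandwich[OF _ _ tendsto_const lim]) (auto intro: always_eventually)
  then show "((\<lambda>n. fst (\<sigma> n)) \<longlongrightarrow> fst l) F"
    by (simp add: tendsto_rabs_zero_iff LIM_zero_cancel)
  show "((\<lambda>n. mdist (path_metric d X) (snd (\<sigma> n)) (snd l)) \<longlongrightarrow> 0) F"
    by (rule tendsto_sandwich[OF _ _ tendsto_const lim]) (auto intro: always_eventually)
qed

lemma continuous_map_into_mspace:
  "\<lbrakk>continuous_map T (mtopology_of m) f; x \<in> topspace T\<rbrakk> \<Longrightarrow> f x \<in> mspace m"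
  by (auto simp: continuous_map_def)

lemma continuous_map_into_mtopology_of:
  assumes "\<And>x. x \<in> topspace T \<Longrightarrow> f x \<in> mspace m"
    and "\<And>x r. \<lbrakk>x \<in> topspace T; 0 < r\<rbrakk> \<Longrightarrow>
        \<exists>U. openin T U \<and> x \<in> U \<and> (\<forall>y\<in>U. mdist m (f x) (f y) < r)"
  shows "continuous_map T (mtopology_of m) f"
  unfolding mtopology_of_def Metric_space.continuous_map_to_metric[OF Metric_space_mspace_mdist]
proof (intro ballI allI impI)
  fix x and r :: real assume x: "x \<in> topspace T" and "0 < r"
  then obtain U where U: "openin T U" "x \<in> U" "\<And>y. y \<in> U \<Longrightarrow> mdist m (f x) (f y) < r"
    using assms(2) by metis
  have "f y \<in> Metric_space.mball (mspace m) (mdist m) (f x) r" if "y \<in> U" for y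
    using U(3)[OF that] assms(1)[OF x] assms(1)[of y] openin_subset[OF U(1)] that
    by (auto simp: Metric_space.in_mball)
  then show "\<exists>U. openin T U \<and> x \<in> U \<and> (\<forall>y\<in>U. f y \<in> Metric_space.mball (mspace m) (mdist m) (f x) r)"
    using U by blast
qed

lemma continuous_map_into_bar_X:
  assumes e: "continuous_map T euclideanreal e"
    and c: "continuous_map T (mtopology_of (path_metric d X)) c"
    and mem: "\<And>x. x \<in> topspace T \<Longrightarrow> (e x, c x) \<in> bar_X d X u"
  shows "continuous_map T (bar_X_topology d X u) (\<lambda>x. (e x, c x))"
proof -
  let ?B = "bar_M_metric d X u" and ?p = "path_metric d X"
  have bar_M: "(e x, c x) \<in> mspace ?B" if "x \<in> topspace T" for x
    using mem[OF that] by (auto simp: mspace_bar_M_metric bar_X_def bar_M_def X_eps_paths_def)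
  have "continuous_map T (mtopology_of ?B) (\<lambda>x. (e x, c x))"
  proof (rule continuous_map_into_mtopology_of[OF bar_M])
    fix x and r :: real assume x: "x \<in> topspace T" and r: "r > 0"
    have cx: "c x \<in> mspace ?p"
      by (rule continuous_map_into_mspace[OF c x])
    define U where "U = {y \<in> topspace T. \<bar>e y - e x\<bar> + mdist ?p (c y) (c x) \<in> {..<r}}"
    have "continuous_map T euclideanreal (\<lambda>y. mdist ?p (c y) (c x))"
      using continuous_map_compose[OF c continuous_map_mdist_left[OF cx]] by (simp add: o_def)
    then have "continuous_map T euclideanreal (\<lambda>y. \<bar>e y - e x\<bar> + mdist ?p (c y) (c x))"
      by (intro continuous_map_add continuous_map_real_abs continuous_map_diff e) auto
    then have "openin T U"
      unfolding U_def by (rule openin_continuous_map_preimage) auto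
    moreover have "x \<in> U" using x r mdist_zero[OF cx cx] by (simp add: U_def)
    moreover have "mdist ?B (e x, c x) (e y, c y) < r" if "y \<in> U" for y
      using that unfolding U_def
      by (simp add: mdist_bar_M_metric abs_minus_commute mdist_commute[of ?p "c x"])
    ultimately show "\<exists>U. openin T U \<and> x \<in> U \<and> (\<forall>y\<in>U. mdist ?B (e x, c x) (e y, c y) < r)"
      by blast
  qed
  then show ?thesis
    unfolding bar_X_topology_def by (rule continuous_map_into_subtopology) (use mem in auto)
qed

text \<open>A tube argument: the points whose value is at least \<open>r/2\<close> away from the
  value over \<open>w\<close> form a closed set, and its projection along the compact
  \<open>K\<close> is closed and misses \<open>w\<close>. Half the radius is used because a supremum
  of distances below \<open>r/2\<close> may equal \<open>r/2\<close>.\<close>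

lemma continuous_map_cfunspace:
  assumes K: "compact_space K" and G: "continuous_map (prod_topology W K) (mtopology_of m) G"
  shows "continuous_map W (mtopology_of (cfunspace K m)) (\<lambda>w. restrict (\<lambda>t. G (w, t)) (topspace K))"
proof -
  let ?c = "\<lambda>w. restrict (\<lambda>t. G (w, t)) (topspace K)"
  have slice: "continuous_map K (mtopology_of m) (\<lambda>t. G (w, t))" if "w \<in> topspace W" for w
  proof -
    have "continuous_map K (prod_topology W K) (\<lambda>t. (w, t))"
      using that by (simp add: continuous_map_paired)
    from continuous_map_compose[OF this G] show ?thesis by (simp add: o_def)
  qed
  have Gm: "G (w, t) \<in> mspace m" if "w \<in> topspace W" "t \<in> topspace K" for w t
    using continuous_map_into_mspace[OF G] that by simp
  have mem: "?c w \<in> mspace (cfunspace K m)" if "w \<in> topspace W" for w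
    using K Gm[OF that] continuous_map_eq[OF slice[OF that], where g="?c w"]
    by (simp add: compact_space_def compactin_mspace_cfunspace del: mspace_cfunspace)
  show ?thesis
  proof (rule continuous_map_into_mtopology_of[OF mem])
    fix w and r :: real assume w: "w \<in> topspace W" and r: "r > 0"
    define C where "C = {p \<in> topspace (prod_topology W K). mdist m (G p) (G (w, snd p)) \<in> {r/2..}}"
    have "continuous_map (prod_topology W K) (mtopology_of m) (\<lambda>p. G (w, snd p))"
      using continuous_map_compose[OF continuous_map_snd slice[OF w]] by (simp add: o_def)
    then have "continuous_map (prod_topology W K) euclideanreal (\<lambda>p. mdist m (G p) (G (w, snd p)))"
      using G by (intro continuous_map_mdist)
    then have "closedin (prod_topology W K) C"
      unfolding C_def by (rule closedin_continuous_map_preimage) auto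
    then have C: "closedin W (fst ` C)"
      using closed_map_fst[OF K] unfolding closed_map_def by blast
    define U where "U = topspace W - fst ` C"
    have "openin W U" using C by (simp add: U_def openin_diff)
    moreover have "w \<in> U"
    proof -
      have "mdist m (G (w, t)) (G (w, t)) = 0" if "t \<in> topspace K" for t
        using Gm[OF w that] by simp
      then show ?thesis using w r by (auto simp: U_def C_def)
    qed
    moreover have "mdist (cfunspace K m) (?c w) (?c y) < r"
      if y: "y \<in> U" for y
    proof -
      have yW: "y \<in> topspace W" using y by (simp add: U_def)
      have lt: "mdist m (G (y, t)) (G (w, t)) < r/2" if "t \<in> topspace K" for t
      proof (rule ccontr)
        assume "\<not> mdist m (G (y, t)) (G (w, t)) < r/2"
        then have "(y, t) \<in> C" using yW that by (simp add: C_def)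
        then show False using y by (force simp: U_def)
      qed
      have "mdist (cfunspace K m) (?c w) (?c y) \<le> r/2"
        using r lt by (intro mdist_cfunspace_le) (auto simp: mdist_commute less_imp_le)
      then show ?thesis using r by simp
    qed
    ultimately show "\<exists>U. openin W U \<and> w \<in> U \<and> (\<forall>y\<in>U. mdist (cfunspace K m) (?c w) (?c y) < r)"
      by blast
  qed
qed

section \<open>From maps to telescopes\<close>

text \<open>For a point of \<open>|X|\<close> the value at parameter 0 is the unspecified
  \<open>the None\<close>; telescopes are compared off parameter 0. The level is forgotten.\<close>

definition telescope_of :: "('w \<Rightarrow> real \<times> (real \<Rightarrow> 'm option)) \<Rightarrow> 'w \<times> real \<Rightarrow> 'm" where
  "telescope_of f p = the (snd (f (fst p)) (snd p))"

lemma exhaustionD: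
  assumes "exhaustion (mtopology_of d) u"
  shows "continuous_map (mtopology_of d) euclideanreal u" "\<forall>m\<in>mspace d. 0 < u m \<and> u m \<le> 1"
  using assms by (auto simp: exhaustion_def continuous_map_in_subtopology Pi_iff)

lemma quot_dist_collapse_le:
  assumes "m \<in> mspace d" "m' \<in> mspace d"
  shows "quot_dist d X (collapse X m) (collapse X m') \<le> mdist d m m'"
proof -
  have "dist_to d X a \<le> mdist d a b" if "b \<in> X" for a b
    using that cINF_lower[OF dist_to_bdd[of d a X] that] by (auto simp: dist_to_def)
  from this[of m' m] this[of m m'] show ?thesis
    by (auto simp: collapse_def mdist_commute)
qed

lemma continuous_map_collapse:
  assumes X: "closedin (mtopology_of d) X"
  shows "continuous_map (mtopology_of d) (mtopology_of (quot_metric d X)) (collapse X)"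
proof (rule continuous_map_into_mtopology_of)
  fix m and r :: real assume m: "m \<in> topspace (mtopology_of d)" and r: "0 < r"
  have "openin (mtopology_of d) {m' \<in> topspace (mtopology_of d). mdist d m' m \<in> {..<r}}"
    by (rule openin_continuous_map_preimage[OF continuous_map_mdist_left]) (use m in auto)
  moreover have "mdist (quot_metric d X) (collapse X m) (collapse X m') < r"
    if "m' \<in> {m' \<in> topspace (mtopology_of d). mdist d m' m \<in> {..<r}}" for m'
    using quot_dist_collapse_le[of m d m' X] m that
    by (simp add: mdist_quot_metric[OF X] mdist_commute[of d m])
  moreover have "mdist d m m < r"
  proof -
    have "mdist d m m = 0" using m by simp
    then show ?thesis by (simp only: r)
  qed
  ultimately show "\<exists>U. openin (mtopology_of d) U \<and> m \<in> U \<and>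
      (\<forall>m'\<in>U. mdist (quot_metric d X) (collapse X m) (collapse X m') < r)"
    using m r by (intro exI[of _ "{m' \<in> topspace (mtopology_of d). mdist d m' m \<in> {..<r}}"]) auto
qed (simp add: mspace_quot_metric[OF X])

text \<open>At distance less than \<open>dist_to d X l\<close> from \<open>l\<close> the route
  through the collapsed point is too long, so the minimum in the quotient metric is
  \<open>mdist d\<close>.\<close>

lemma quot_metric_limit_Some:
  assumes X: "closedin (mtopology_of d) X" and m: "\<And>n. m n \<in> mspace d" "l \<in> mspace d - X"
    and lim: "((\<lambda>n. quot_dist d X (Some (m n)) (Some l)) \<longlongrightarrow> 0) F"
  shows "limitin (mtopology_of d) m l F"
proof -
  have "((\<lambda>n. mdist d (m n) l) \<longlongrightarrow> 0) F"
  proof (cases "X = {}")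
    case True
    then show ?thesis using lim by simp
  next
    case False
    have "0 < dist_to d X l" using dist_to_pos[OF X False] m(2) by blast
    then have "\<forall>\<^sub>F n in F. quot_dist d X (Some (m n)) (Some l) < dist_to d X l"
      using order_tendstoD(2)[OF lim] by simp
    then have "\<forall>\<^sub>F n in F. quot_dist d X (Some (m n)) (Some l) = mdist d (m n) l"
    proof eventually_elim
      case (elim n)
      then show ?case using False dist_to_nonneg[of d X "m n"] by (auto simp: min_def split: if_splits)
    qed
    then show ?thesis using lim by (rule Lim_transform_eventually[rotated])
  qed
  then show ?thesis using m by (simp add: limitin_mtopology_of)
qed

text \<open>Uniform closeness of the paths and continuity of the limit path give convergence in
  \<open>M/X\<close>. At a positive parameter this is convergence in \<open>M\<close>. At parameter
  0 it says that \<open>dist_to d X\<close> tends to 0; the levels, which converge to a positive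
  level, keep \<open>u\<close> from tending to 0, so a subsequence converges in \<open>M\<close>,
  and its limit is at distance 0 from the closed set \<open>X\<close>.\<close>

lemma telescope_telescope_of:
  assumes adm: "admissible_data M X u H d" and W: "metrizable_space W"
    and f: "continuous_map W (bar_X_topology d X u) f"
  shows "telescope W M X (telescope_of f)"
proof (rule approachingI[OF metrizable_prod_I01[OF W]])
  note M = admissible_dataD[OF adm] and u = exhaustionD[OF admissible_dataD(4)[OF adm]]
  have f_mem: "(fst (f w), snd (f w)) \<in> bar_X d X u" if "w \<in> topspace W" for w
    using continuous_map_image_subset_topspace[OF f] that by (auto simp: topspace_bar_X_topology)
  have f_pos: "\<exists>m\<in>mspace d - X. snd (f w) t = Some m \<and> telescope_of f (w, t) = m \<and> fst (f w) \<le> u m"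
    if "w \<in> topspace W" "0 < t" "t \<le> 1" for w t
    using bar_X_memD(5)[OF f_mem[OF that(1)]] that(2,3) by (auto simp: telescope_of_def)
  show "telescope_of f p \<in> topspace M - X"
    if "p \<in> topspace (prod_topology W I01) - topspace W \<times> {0}" for p
  proof -
    have "fst p \<in> topspace W" "0 < snd p" "snd p \<le> 1"
      using that by (auto simp: mem_Times_iff)
    from f_pos[OF this] show ?thesis using M(1) by auto
  qed
  fix \<sigma> x assume \<sigma>: "range \<sigma> \<subseteq> topspace (prod_topology W I01) - topspace W \<times> {0}"
    and l: "limitin (prod_topology W I01) \<sigma> x sequentially"
  have \<sigma>': "fst (\<sigma> n) \<in> topspace W" "0 < snd (\<sigma> n)" "snd (\<sigma> n) \<le> 1" for n
    using subsetD[OF \<sigma> rangeI, of n] by (auto simp: mem_Times_iff)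
  have x: "fst x \<in> topspace W" "0 \<le> snd x" "snd x \<le> 1"
    using limitin_topspace[OF l] by (auto simp: mem_Times_iff)
  define m where "m = telescope_of f \<circ> \<sigma>"
  have m: "m n \<in> mspace d - X" "snd (f (fst (\<sigma> n))) (snd (\<sigma> n)) = Some (m n)"
      "fst (f (fst (\<sigma> n))) \<le> u (m n)" for n
    using f_pos[OF \<sigma>'(1,2,3)[of n]] by (auto simp: m_def)
  define \<gamma> where "\<gamma> = snd (f (fst x))"
  note \<gamma> = bar_X_memD[OF f_mem[OF x(1)], folded \<gamma>_def]
  have "limitin (bar_X_topology d X u) (f \<circ> (fst \<circ> \<sigma>)) (f (fst x)) sequentially"
    by (rule continuous_map_limit[OF f]) (use l in \<open>simp add: limitin_pairwise\<close>)
  note lf = limitin_bar_X[OF this]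
  let ?Q = "quot_metric d X"
  have \<gamma>_cont: "continuous_map I01 (mtopology_of ?Q) \<gamma>" using \<gamma>(3) by simp
  have "limitin I01 (snd \<circ> \<sigma>) (snd x) sequentially" using l by (simp only: limitin_pairwise)
  from continuous_map_limit[OF \<gamma>_cont this]
  have l\<gamma>: "(\<lambda>n. mdist ?Q (\<gamma> (snd (\<sigma> n))) (\<gamma> (snd x))) \<longlonglongrightarrow> 0"
    by (simp add: limitin_mtopology_of o_def)
  have "(\<lambda>n. quot_dist d X (Some (m n)) (\<gamma> (snd x))) \<longlonglongrightarrow> 0"
  proof (rule tendsto_sandwich[OF _ _ tendsto_const])
    show "(\<lambda>n. mdist (path_metric d X) (snd (f (fst (\<sigma> n)))) \<gamma> +
        mdist ?Q (\<gamma> (snd (\<sigma> n))) (\<gamma> (snd x))) \<longlonglongrightarrow> 0"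
      using tendsto_add[OF lf(2) l\<gamma>] by (simp add: \<gamma>_def o_def)
    have "quot_dist d X (Some (m n)) (\<gamma> (snd x)) \<le> mdist (path_metric d X) (snd (f (fst (\<sigma> n)))) \<gamma> +
        mdist ?Q (\<gamma> (snd (\<sigma> n))) (\<gamma> (snd x))" for n
    proof -
      have mem: "snd (f (fst (\<sigma> n))) \<in> mspace (path_metric d X)"
        by (rule bar_X_memD(3)[OF f_mem[OF \<sigma>'(1)]])
      have "mdist ?Q (snd (f (fst (\<sigma> n))) (snd (\<sigma> n))) (\<gamma> (snd (\<sigma> n)))
          \<le> mdist (path_metric d X) (snd (f (fst (\<sigma> n)))) \<gamma>"
        by (rule mdist_cfunspace_imp_mdist_le[OF mem \<gamma>(3) order_refl])
          (use \<sigma>'(2,3)[of n] in auto)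
      moreover have "mdist ?Q (Some (m n)) (\<gamma> (snd x))
          \<le> mdist ?Q (Some (m n)) (\<gamma> (snd (\<sigma> n))) + mdist ?Q (\<gamma> (snd (\<sigma> n))) (\<gamma> (snd x))"
      proof (rule mdist_triangle)
        show "Some (m n) \<in> mspace ?Q"
          using m(1)[of n] by (auto simp: mspace_quot_metric[OF M(5)] collapse_def)
        show "\<gamma> (snd (\<sigma> n)) \<in> mspace ?Q" "\<gamma> (snd x) \<in> mspace ?Q"
          using \<sigma>'(2,3)[of n] x by (auto intro!: continuous_map_into_mspace[OF \<gamma>_cont])
      qed
      ultimately show ?thesis by (simp add: m(2) mdist_quot_metric[OF M(5)])
    qed
    then show "\<forall>\<^sub>F n in sequentially. quot_dist d X (Some (m n)) (\<gamma> (snd x)) \<le>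
        mdist (path_metric d X) (snd (f (fst (\<sigma> n)))) \<gamma> +
        mdist ?Q (\<gamma> (snd (\<sigma> n))) (\<gamma> (snd x))"
      by (intro always_eventually) blast
    have "0 \<le> quot_dist d X (Some (m n)) (\<gamma> (snd x))" for n
      by (metis mdist_nonneg mdist_quot_metric[OF M(5)])
    then show "\<forall>\<^sub>F n in sequentially. 0 \<le> quot_dist d X (Some (m n)) (\<gamma> (snd x))"
      by (intro always_eventually) blast
  qed
  note lq = this
  show "\<exists>r y. strict_mono (r :: nat \<Rightarrow> nat) \<and> limitin M (telescope_of f \<circ> \<sigma> \<circ> r) y sequentially \<and>
      (x \<in> topspace W \<times> {0} \<longrightarrow> y \<in> X) \<and> (x \<notin> topspace W \<times> {0} \<longrightarrow> y = telescope_of f x)"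
  proof (cases "snd x = 0")
    case False
    then obtain l where l: "l \<in> mspace d - X" "\<gamma> (snd x) = Some l" "telescope_of f x = l"
      using f_pos[of "fst x" "snd x"] x by (auto simp: \<gamma>_def)
    have "limitin (mtopology_of d) m l sequentially"
      by (rule quot_metric_limit_Some[OF M(5) _ l(1)]) (use m lq l in auto)
    then show ?thesis
      using False l M(1) by (intro exI[of _ id] exI[of _ l]) (auto simp: m_def strict_mono_id)
  next
    case True
    have "(\<lambda>n. dist_to d X (m n)) \<longlonglongrightarrow> 0" using lq \<gamma>(4) True by simp
    have "\<not> (\<lambda>n. u (m n)) \<longlonglongrightarrow> 0"
    proof
      assume u0: "(\<lambda>n. u (m n)) \<longlonglongrightarrow> 0"
      have "fst (f (fst x)) \<le> 0"
        by (rule LIMSEQ_le[OF lf(1) u0]) (use m(3) in auto)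
      then show False using \<gamma>(1) by simp
    qed
    moreover have "range m \<subseteq> mspace d" using m(1) by auto
    ultimately obtain r p where r: "strict_mono (r :: nat \<Rightarrow> nat)"
      "limitin (mtopology_of d) (m \<circ> r) p sequentially"
      using exhaustion_convergent_subsequence[OF M(4)] by metis
    have "limitin euclideanreal (dist_to d X \<circ> (m \<circ> r)) (dist_to d X p) sequentially"
      by (rule continuous_map_limit[OF continuous_map_dist_to[OF M(6)] r(2)])
    moreover have "(dist_to d X \<circ> (m \<circ> r)) \<longlonglongrightarrow> 0"
      using LIMSEQ_subseq_LIMSEQ[OF \<open>(\<lambda>n. dist_to d X (m n)) \<longlonglongrightarrow> 0\<close> r(1)] by (simp add: o_def)
    ultimately have "dist_to d X p = 0"
      using LIMSEQ_unique by fastforce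
    moreover have "p \<in> mspace d" using limitin_topspace[OF r(2)] by simp
    moreover have "X \<noteq> {}" using \<gamma>(6) by blast
    ultimately have "p \<in> X" using dist_to_pos[OF M(5)] by force
    then show ?thesis
      using r True x(1) M(1) by (intro exI[of _ r] exI[of _ p]) (auto simp: m_def mem_Times_iff)
  qed
qed

section \<open>From telescopes back to maps\<close>

text \<open>A path of level \<open>e\<close> starts at the collapsed point of its own level set, so
  that set has to meet \<open>X\<close>. The point of \<open>X\<close> is a subsequential limit of
  the values of \<open>g\<close> at the parameters \<open>1/(n+1)\<close>, and continuity of
  \<open>u\<close> passes the bound on to it.\<close>

lemma telescope_level_limit:
  assumes adm: "admissible_data M X u H d" and g: "telescope W M X g" and w: "w \<in> topspace W"
    and W: "metrizable_space W" and e: "\<And>t. \<lbrakk>0 < t; t \<le> 1\<rbrakk> \<Longrightarrow> e \<le> u (g (w, t))"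
  shows "\<exists>m\<in>X. m \<in> mspace d \<and> e \<le> u m"
proof -
  note M = admissible_dataD[OF adm] and u = exhaustionD[OF admissible_dataD(4)[OF adm]]
  define \<sigma> where "\<sigma> = (\<lambda>n. (w, inverse (real (Suc n))))"
  have "inverse (real (Suc n)) \<le> 1" for n by (simp add: inverse_le_1_iff)
  then have \<sigma>: "range \<sigma> \<subseteq> topspace (prod_topology W I01) - topspace W \<times> {0}"
    using w by (auto simp: \<sigma>_def)
  have "limitin I01 (snd \<circ> \<sigma>) 0 sequentially"
    using LIMSEQ_inverse_real_of_nat \<open>\<And>n. inverse (real (Suc n)) \<le> 1\<close>
    by (auto simp: limitin_subtopology \<sigma>_def o_def intro!: always_eventually)
  moreover have "limitin W (fst \<circ> \<sigma>) w sequentially"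
    using w by (simp add: \<sigma>_def o_def)
  ultimately have "limitin (prod_topology W I01) \<sigma> (w, 0) sequentially"
    by (simp add: limitin_pairwise)
  then obtain r y where r: "limitin M (g \<circ> \<sigma> \<circ> r) y sequentially" "(w, 0) \<in> topspace W \<times> {0::real} \<longrightarrow> y \<in> X"
    by (rule approachingD[OF g \<sigma>])
  have "limitin euclideanreal (u \<circ> (g \<circ> \<sigma> \<circ> r)) (u y) sequentially"
    by (rule continuous_map_limit[of "mtopology_of d"]) (use u r M(1) in auto)
  then have "(u \<circ> (g \<circ> \<sigma> \<circ> r)) \<longlonglongrightarrow> u y" by simp
  then have "e \<le> u y"
    using e \<open>\<And>n. inverse (real (Suc n)) \<le> 1\<close> by (intro LIMSEQ_le_const) (auto simp: \<sigma>_def)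
  then show ?thesis using r(2) w M(6) by auto
qed

text \<open>
  The level \<open>e w\<close> of the point over \<open>w\<close> is the largest \<open>1\<close>-Lipschitz minorant of
  \<open>w \<mapsto> inf\<^sub>t u (g (w, t))\<close>; it is positive because \<open>g\<close> is approaching.
\<close>

lemma telescope_level_function:
  assumes adm: "admissible_data M X u H d" and W: "metrizable_space W" and g: "telescope W M X g"
  obtains e where "continuous_map W euclideanreal e" "\<forall>w\<in>topspace W. 0 < e w"
    "\<forall>w\<in>topspace W. \<forall>t. 0 < t \<and> t \<le> 1 \<longrightarrow> e w \<le> u (g (w, t))"
proof -
  note M = admissible_dataD[OF adm] and u = exhaustionD[OF admissible_dataD(4)[OF adm]]
  obtain dW where dW: "mtopology_of dW = W" using metrizable_space_metric[OF W] .
  have mW: "mspace dW = topspace W" using dW by auto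
  have g_maps: "g (w, t) \<in> mspace d" if "w \<in> topspace W" "0 < t" "t \<le> 1" for w t
    using approaching_maps[OF g, of "(w, t)"] that M(1) by auto
  define S where "S = topspace W \<times> {0<..1::real}"
  define e where "e = (\<lambda>w. INF p\<in>S. u (g p) + mdist dW w (fst p))"
  have nonneg: "0 \<le> u (g p) + mdist dW w (fst p)" if "p \<in> S" for p w
  proof -
    have "g p \<in> mspace d" using g_maps[of "fst p" "snd p"] that by (auto simp: S_def)
    then have "0 < u (g p)" using u(2) by blast
    then show ?thesis using mdist_nonneg[of dW w "fst p"] by linarith
  qed
  have bdd: "bdd_below ((\<lambda>p. u (g p) + mdist dW w (fst p)) ` S)" for w
    using nonneg by (intro bdd_belowI2[of _ 0]) auto
  have le: "e w \<le> u (g p) + mdist dW w (fst p)" if "p \<in> S" for p w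
    unfolding e_def by (rule cINF_lower[OF bdd that])
  have "continuous_map (mtopology_of dW) euclideanreal e"
  proof (rule continuous_map_1_Lipschitz)
    fix x y assume xy: "x \<in> mspace dW" "y \<in> mspace dW"
    then have "S \<noteq> {}" using mW by (auto simp: S_def)
    have "e x - mdist dW x y \<le> u (g p) + mdist dW y (fst p)" if "p \<in> S" for p
    proof -
      have "mdist dW x (fst p) \<le> mdist dW x y + mdist dW y (fst p)"
        by (rule mdist_triangle) (use xy that in \<open>simp_all add: mW S_def mem_Times_iff\<close>)
      with le[OF that, of x] show ?thesis by simp
    qed
    then have "e x - mdist dW x y \<le> (INF p\<in>S. u (g p) + mdist dW y (fst p))"
      by (rule cINF_greatest[OF \<open>S \<noteq> {}\<close>])
    then have "e x - mdist dW x y \<le> e y" by (simp only: e_def)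
    then show "e x \<le> e y + mdist dW x y" by simp
  qed
  then have "continuous_map W euclideanreal e" by (simp only: dW)
  moreover have "e w \<le> u (g (w, t))" if "w \<in> topspace W" "0 < t" "t \<le> 1" for w t
  proof -
    have "mdist dW w w = 0" using that mW by simp
    then show ?thesis using le[of "(w, t)" w] that by (simp add: S_def)
  qed
  moreover have "0 < e w" if w: "w \<in> topspace W" for w
  proof (rule ccontr)
    assume "\<not> 0 < e w"
    have "S \<noteq> {}" using w by (auto simp: S_def)
    \<comment> \<open>If the infimum at \<open>w\<close> is not positive, there are points of
      \<open>S\<close> whose base points tend to \<open>w\<close> and along which
      \<open>u \<circ> g\<close> tends to 0. Compactness of \<open>[0,1]\<close> makes their
      parameters converge along a subsequence; then values of \<open>g\<close> subconverge to a
      point of \<open>M\<close> where \<open>u\<close> would vanish.\<close>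
    have "\<exists>p\<in>S. u (g p) + mdist dW w (fst p) < inverse (real (Suc n))" for n
    proof -
      have "e w < inverse (real (Suc n))" 
        by (rule le_less_trans[of _ 0]) (use \<open>\<not> 0 < e w\<close> in auto)
      then show ?thesis
        unfolding e_def using cInf_lessD[of "(\<lambda>p. u (g p) + mdist dW w (fst p)) ` S"] \<open>S \<noteq> {}\<close> by auto
    qed
    then obtain p where p: "\<And>n. p n \<in> S" "\<And>n. u (g (p n)) + mdist dW w (fst (p n)) < inverse (real (Suc n))"
      by metis
    have p': "fst (p n) \<in> topspace W" "0 < snd (p n)" "snd (p n) \<le> 1" for n
      using p(1)[of n] by (auto simp: S_def)
    have u_pos: "0 < u (g (p n))" for n
      using u(2) g_maps[OF p'(1,2,3)[of n]] by simp
    have u0: "(\<lambda>n. u (g (p n))) \<longlonglongrightarrow> 0"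
    proof (rule tendsto_sandwich[OF _ _ tendsto_const LIMSEQ_inverse_real_of_nat])
      have "u (g (p n)) \<le> inverse (real (Suc n))" for n
        using p(2)[of n] mdist_nonneg[of dW w "fst (p n)"] by linarith
      then show "\<forall>\<^sub>F n in sequentially. u (g (p n)) \<le> inverse (real (Suc n))"
        by (intro always_eventually) blast
    qed (use u_pos in \<open>auto intro!: always_eventually less_imp_le\<close>)
    have "(\<lambda>n. mdist dW (fst (p n)) w) \<longlonglongrightarrow> 0"
    proof (rule tendsto_sandwich[OF _ _ tendsto_const LIMSEQ_inverse_real_of_nat])
      have "mdist dW (fst (p n)) w \<le> inverse (real (Suc n))" for n
        using p(2)[of n] u_pos[of n] by (simp add: mdist_commute[of dW w])
      then show "\<forall>\<^sub>F n in sequentially. mdist dW (fst (p n)) w \<le> inverse (real (Suc n))"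
        by (intro always_eventually) blast
    qed simp
    then have lw: "limitin W (fst \<circ> p) w sequentially"
      using w p' mW by (simp add: dW[symmetric] limitin_mtopology_of o_def del: topspace_mtopology_of)
    have "\<forall>n. (snd \<circ> p) n \<in> {0..1}" using p'(2,3) by (auto intro: less_imp_le)
    then obtain r t where r: "strict_mono (r :: nat \<Rightarrow> nat)" "t \<in> {0..1}" "((snd \<circ> p) \<circ> r) \<longlonglongrightarrow> t"
      using seq_compactE[OF compact_imp_seq_compact[OF compact_Icc[of "0::real" 1]]] by blast
    have "limitin I01 (snd \<circ> (p \<circ> r)) t sequentially"
      using r(2,3) p'(2,3) by (auto simp: limitin_subtopology o_assoc intro!: always_eventually less_imp_le)
    moreover have "limitin W (fst \<circ> (p \<circ> r)) w sequentially"
      using limitin_subsequence[OF r(1) lw] by (simp add: o_assoc)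
    ultimately have lim: "limitin (prod_topology W I01) (p \<circ> r) (w, t) sequentially"
      by (simp add: limitin_pairwise)
    have rg: "range (p \<circ> r) \<subseteq> topspace (prod_topology W I01) - topspace W \<times> {0}"
    proof (rule image_subsetI)
      fix n show "(p \<circ> r) n \<in> topspace (prod_topology W I01) - topspace W \<times> {0}"
        using p'[of "r n"] by (auto simp: mem_Times_iff)
    qed
    obtain r' y where r': "strict_mono (r' :: nat \<Rightarrow> nat)"
      "limitin M (g \<circ> (p \<circ> r) \<circ> r') y sequentially"
      using approachingD[OF g rg lim] by metis
    have "limitin euclideanreal (u \<circ> (g \<circ> (p \<circ> r) \<circ> r')) (u y) sequentially"
      by (rule continuous_map_limit[of "mtopology_of d"]) (use u r' M(1) in auto)
    then have "(\<lambda>n. u (g (p (r (r' n))))) \<longlonglongrightarrow> u y" by (simp add: o_def)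
    moreover have "(\<lambda>n. u (g (p (r (r' n))))) \<longlonglongrightarrow> 0"
      using LIMSEQ_subseq_LIMSEQ[OF u0 strict_mono_o[OF r(1) r'(1)]] by (simp add: o_def)
    ultimately have "u y = 0" by (rule LIMSEQ_unique)
    moreover have "y \<in> mspace d" using limitin_topspace[OF r'(2)] M(1) by simp
    ultimately show False using u(2) by force
  qed
  ultimately show ?thesis using that by blast
qed

text \<open>With the collapsed point put in at parameter 0, \<open>g\<close> becomes continuous into
  \<open>M/X\<close>: the different points of \<open>X\<close> to which its subsequences converge
  are identified there. Currying gives the paths, and \<open>telescope_level_function\<close> their
  levels.\<close>

lemma telescope_realization:
  assumes adm: "admissible_data M X u H d" and W: "metrizable_space W" and g: "telescope W M X g"
  obtains f where "continuous_map W (bar_X_topology d X u) f"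
    "\<forall>p \<in> topspace W \<times> {0<..1}. telescope_of f p = g p"
proof -
  note M = admissible_dataD[OF adm] and u = exhaustionD[OF admissible_dataD(4)[OF adm]]
  obtain e where e: "continuous_map W euclideanreal e" "\<forall>w\<in>topspace W. 0 < e w"
    "\<forall>w\<in>topspace W. \<forall>t. 0 < t \<and> t \<le> 1 \<longrightarrow> e w \<le> u (g (w, t))"
    by (rule telescope_level_function[OF adm W g])
  have g_maps: "g (w, t) \<in> mspace d - X" if "w \<in> topspace W" "0 < t" "t \<le> 1" for w t
    using approaching_maps[OF g, of "(w, t)"] that M(1) by auto
  have level_X: "\<exists>m\<in>X. m \<in> mspace d \<and> e w \<le> u m" if "w \<in> topspace W" for w
    by (rule telescope_level_limit[OF adm g that W]) (use e(3) that in blast)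
  let ?Q = "quot_metric d X"
  define \<Gamma> where "\<Gamma> = (\<lambda>p. if snd p = 0 then None else Some (g p))"
  have \<Gamma>_pos: "\<Gamma> (w, t) = collapse X (g (w, t))" if "w \<in> topspace W" "0 < t" "t \<le> 1" for w t
    using g_maps[OF that] that by (simp add: \<Gamma>_def collapse_def)
  have \<Gamma>_0: "\<Gamma> (w, 0) = None" for w by (simp add: \<Gamma>_def)
  have \<Gamma>_mem: "\<Gamma> (w, t) \<in> mspace ?Q" if "w \<in> topspace W" "0 \<le> t" "t \<le> 1" for w t
  proof (cases "t = 0")
    case True
    then show ?thesis
      using level_X[OF that(1)] by (force simp: mspace_quot_metric[OF M(5)] \<Gamma>_def collapse_def)
  next
    case False
    then show ?thesis
      using \<Gamma>_pos[of w t] g_maps[of w t] that by (auto simp: mspace_quot_metric[OF M(5)])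
  qed
  have \<Gamma>_cont: "continuous_map (prod_topology W I01) (mtopology_of ?Q) \<Gamma>"
  proof (rule continuous_map_subsequenceI[OF metrizable_prod_I01[OF W]])
    show "\<Gamma> x \<in> topspace (mtopology_of ?Q)" if "x \<in> topspace (prod_topology W I01)" for x
      using that \<Gamma>_mem[of "fst x" "snd x"] by auto
    fix \<sigma> x assume \<sigma>: "range \<sigma> \<subseteq> topspace (prod_topology W I01)"
      and l: "limitin (prod_topology W I01) \<sigma> x sequentially"
    obtain w t where x: "x = (w, t)" "w \<in> topspace W" "0 \<le> t" "t \<le> 1"
      using limitin_topspace[OF l] by (cases x) auto
    have \<sigma>': "fst (\<sigma> n) \<in> topspace W" "0 \<le> snd (\<sigma> n)" "snd (\<sigma> n) \<le> 1" for n
      using subsetD[OF \<sigma> rangeI, of n] by (auto simp: mem_Times_iff)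
    show "\<exists>r. strict_mono (r :: nat \<Rightarrow> nat) \<and> limitin (mtopology_of ?Q) (\<Gamma> \<circ> \<sigma> \<circ> r) (\<Gamma> x) sequentially"
    \<comment> \<open>Infinitely many terms at parameter 0 give a subsequence constant at the
      collapsed point. Otherwise a subsequence avoids parameter 0, and the hypothesis on
      \<open>g\<close> applies to it.\<close>
    proof (cases "infinite {n. snd (\<sigma> n) = 0}")
      case True
      then obtain r where r: "strict_mono (r :: nat \<Rightarrow> nat)" "\<And>n. snd (\<sigma> (r n)) = 0"
        using infinite_enumerate[OF True] by auto
      have "limitin I01 (snd \<circ> \<sigma>) t sequentially" using l x(1) by (simp only: limitin_pairwise snd_conv)
      then have "(snd \<circ> \<sigma>) \<longlonglongrightarrow> t" by (simp add: limitin_subtopology)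
      then have "(\<lambda>n. snd (\<sigma> (r n))) \<longlonglongrightarrow> t"
        using LIMSEQ_subseq_LIMSEQ[OF _ r(1)] by (fastforce simp: o_def)
      then have "t = 0" using r(2) by (simp add: LIMSEQ_const_iff)
      moreover have "\<Gamma> \<circ> \<sigma> \<circ> r = (\<lambda>_. None)" using r(2) by (auto simp: \<Gamma>_def)
      moreover have "None \<in> mspace ?Q" using \<Gamma>_mem[of w 0] x(2) \<Gamma>_0 by simp
      ultimately have "limitin (mtopology_of ?Q) (\<Gamma> \<circ> \<sigma> \<circ> r) (\<Gamma> x) sequentially"
        using x \<Gamma>_0 by simp
      then show ?thesis using r(1) by blast
    next
      case False
      then have inf: "infinite (- {n. snd (\<sigma> n) = 0})" 
        using finite_compl[of "{n. snd (\<sigma> n) = 0}"] infinite_UNIV_nat by blast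
      obtain r where r: "strict_mono (r :: nat \<Rightarrow> nat)" "\<And>n. r n \<in> - {n. snd (\<sigma> n) = 0}"
        using infinite_enumerate[OF inf] by auto
      have rpos: "0 < snd (\<sigma> (r n))" for n using r(2)[of n] \<sigma>'(2)[of "r n"] by simp
      have "range (\<sigma> \<circ> r) \<subseteq> topspace (prod_topology W I01) - topspace W \<times> {0}"
      proof (rule image_subsetI)
        fix n show "(\<sigma> \<circ> r) n \<in> topspace (prod_topology W I01) - topspace W \<times> {0}"
          using \<sigma>'[of "r n"] rpos[of n] by (auto simp: mem_Times_iff)
      qed
      then obtain r' y where r': "strict_mono (r' :: nat \<Rightarrow> nat)"
        "limitin M (g \<circ> (\<sigma> \<circ> r) \<circ> r') y sequentially"
        "x \<in> topspace W \<times> {0} \<longrightarrow> y \<in> X" "x \<notin> topspace W \<times> {0} \<longrightarrow> y = g x"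
        by (rule approachingD[OF g _ limitin_subsequence[OF r(1) l]])
      have "limitin (mtopology_of ?Q) (collapse X \<circ> (g \<circ> (\<sigma> \<circ> r) \<circ> r')) (collapse X y) sequentially"
        by (rule continuous_map_limit[OF continuous_map_collapse[OF M(5)]]) (use r'(2) M(1) in simp)
      moreover have "collapse X \<circ> (g \<circ> (\<sigma> \<circ> r) \<circ> r') = \<Gamma> \<circ> \<sigma> \<circ> (r \<circ> r')"
      proof
        fix n
        show "(collapse X \<circ> (g \<circ> (\<sigma> \<circ> r) \<circ> r')) n = (\<Gamma> \<circ> \<sigma> \<circ> (r \<circ> r')) n"
          using \<Gamma>_pos[OF \<sigma>'(1)[of "r (r' n)"] rpos[of "r' n"] \<sigma>'(3)[of "r (r' n)"]] by simp
      qed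
      moreover have "collapse X y = \<Gamma> x"
        using r'(3,4) x \<Gamma>_0 \<Gamma>_pos[of w t] by (cases "t = 0") (auto simp: collapse_def)
      ultimately show ?thesis
        using strict_mono_o[OF r(1) r'(1)] by (intro exI[of _ "r \<circ> r'"]) simp
    qed
  qed
  define c where "c = (\<lambda>w. restrict (\<lambda>t. \<Gamma> (w, t)) {0..1})"
  have c_cont: "continuous_map W (mtopology_of (path_metric d X)) c"
    using continuous_map_cfunspace[OF _ \<Gamma>_cont] by (simp add: c_def compact_space_subtopology)
  have "continuous_map W (bar_X_topology d X u) (\<lambda>w. (e w, c w))"
  proof (rule continuous_map_into_bar_X[OF e(1) c_cont])
    fix w assume w: "w \<in> topspace W"
    show "(e w, c w) \<in> bar_X d X u"
    proof (rule bar_X_memI)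
      show "0 < e w" using e(2) w by blast
      show "e w \<le> 1"
        using e(3) w u(2) g_maps[of w 1] by (metis DiffD1 order_trans zero_less_one order_refl)
      show "c w \<in> mspace (path_metric d X)"
        by (rule continuous_map_into_mspace[OF c_cont w])
      show "c w 0 = None" by (simp add: c_def \<Gamma>_def)
      show "\<exists>m\<in>mspace d - X. c w t = Some m \<and> e w \<le> u m \<and> u m \<le> 1" if "0 < t" "t \<le> 1" for t
        using that g_maps[OF w that] e(3) w u(2) by (auto simp: c_def \<Gamma>_def)
      show "\<exists>m\<in>X. m \<in> mspace d \<and> e w \<le> u m \<and> u m \<le> 1"
        using level_X[OF w] u(2) by blast
    qed
  qed
  moreover have "telescope_of (\<lambda>w. (e w, c w)) p = g p" if "p \<in> topspace W \<times> {0<..1}" for p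
    using that by (auto simp: telescope_of_def c_def \<Gamma>_def)
  ultimately show ?thesis using that by blast
qed

section \<open>Homotopies of maps and homotopies of telescopes\<close>

text \<open>The paths coincide and only the levels differ, so these are joined linearly. An
  intermediate level is at most the larger of the two; that one bounds \<open>u\<close> from below
  along the common path and at some point of \<open>X\<close>.\<close>

lemma homotopic_if_same_telescope:
  assumes adm: "admissible_data M X u H d"
    and f0: "continuous_map W (bar_X_topology d X u) f0"
    and f1: "continuous_map W (bar_X_topology d X u) f1"
    and eq: "\<And>p. p \<in> topspace W \<times> {0<..1} \<Longrightarrow> telescope_of f0 p = telescope_of f1 p"
  shows "homotopic_with (\<lambda>_. True) W (bar_X_topology d X u) f0 f1"
proof -
  note M = admissible_dataD[OF adm] and u = exhaustionD[OF admissible_dataD(4)[OF adm]]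
  let ?B = "bar_X_topology d X u"
  have mem: "(fst (f0 w), snd (f0 w)) \<in> bar_X d X u" "(fst (f1 w), snd (f1 w)) \<in> bar_X d X u"
    if "w \<in> topspace W" for w
    using continuous_map_image_subset_topspace[OF f0] continuous_map_image_subset_topspace[OF f1] that
    by (auto simp: topspace_bar_X_topology)
  have snd_eq: "snd (f0 w) = snd (f1 w)" if w: "w \<in> topspace W" for w
  proof (rule extensionalityI[where A="{0..1}"])
    show "snd (f0 w) \<in> extensional {0..1}" "snd (f1 w) \<in> extensional {0..1}"
      using bar_X_memD(3)[OF mem(1)[OF w]] bar_X_memD(3)[OF mem(2)[OF w]] by simp_all
    fix t :: real assume t: "t \<in> {0..1}"
    show "snd (f0 w) t = snd (f1 w) t"
    proof (cases "t = 0")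
      case True
      then show ?thesis using bar_X_memD(4)[OF mem(1)[OF w]] bar_X_memD(4)[OF mem(2)[OF w]] by simp
    next
      case False
      then have t': "0 < t \<and> t \<le> 1" using t by auto
      obtain m m' where "snd (f0 w) t = Some m" "snd (f1 w) t = Some m'"
        using bar_X_memD(5)[OF mem(1)[OF w]] bar_X_memD(5)[OF mem(2)[OF w]] t' by metis
      then show ?thesis using eq[of "(w, t)"] w t' by (simp add: telescope_of_def)
    qed
  qed
  define e where "e = (\<lambda>p. (1 - fst p) * fst (f0 (snd p)) + fst p * fst (f1 (snd p)))"
  let ?P = "prod_topology I01 W"
  have fst_cont: "continuous_map ?B euclideanreal fst"
  proof (rule continuous_map_subsequenceI[OF metrizable_space_bar_X])
    fix \<sigma> x assume "limitin ?B \<sigma> x sequentially"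
    from limitin_bar_X(1)[OF this]
    show "\<exists>r. strict_mono (r :: nat \<Rightarrow> nat) \<and> limitin euclideanreal (fst \<circ> \<sigma> \<circ> r) (fst x) sequentially"
      by (intro exI[of _ id]) (simp add: o_def strict_mono_id)
  qed auto
  have snd_mem: "snd x \<in> mspace (path_metric d X)" if "x \<in> topspace ?B" for x
    using that bar_X_memD(3)[of "fst x" "snd x"] by (simp only: topspace_bar_X_topology prod.collapse)
  have snd_cont: "continuous_map ?B (mtopology_of (path_metric d X)) snd"
  proof (rule continuous_map_subsequenceI[OF metrizable_space_bar_X])
    fix \<sigma> x assume \<sigma>: "range \<sigma> \<subseteq> topspace ?B" and l: "limitin ?B \<sigma> x sequentially"
    have "limitin (mtopology_of (path_metric d X)) (snd \<circ> \<sigma> \<circ> id) (snd x) sequentially"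
      unfolding limitin_mtopology_of
      using limitin_bar_X(2)[OF l] snd_mem[OF limitin_topspace[OF l]] snd_mem[OF subsetD[OF \<sigma> rangeI]]
      by (simp add: o_def del: mspace_cfunspace)
    then show "\<exists>r. strict_mono (r :: nat \<Rightarrow> nat) \<and>
        limitin (mtopology_of (path_metric d X)) (snd \<circ> \<sigma> \<circ> r) (snd x) sequentially"
      using strict_mono_id by blast
  qed (use snd_mem in \<open>simp del: mspace_cfunspace\<close>)
  have "continuous_map ?P euclideanreal (\<lambda>p. fst (f0 (snd p)))"
      "continuous_map ?P euclideanreal (\<lambda>p. fst (f1 (snd p)))"
    using continuous_map_compose[OF continuous_map_compose[OF continuous_map_snd f0] fst_cont]
      continuous_map_compose[OF continuous_map_compose[OF continuous_map_snd f1] fst_cont]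
    by (simp_all add: o_def)
  then have e_cont: "continuous_map ?P euclideanreal e"
    unfolding e_def using continuous_map_from_I01[OF continuous_map_fst[of I01 W]]
    by (intro continuous_map_add continuous_map_real_mult continuous_map_diff) auto
  have "continuous_map ?P ?B (\<lambda>p. (e p, snd (f0 (snd p))))"
  proof (rule continuous_map_into_bar_X[OF e_cont])
    show "continuous_map ?P (mtopology_of (path_metric d X)) (\<lambda>p. snd (f0 (snd p)))"
      using continuous_map_compose[OF continuous_map_compose[OF continuous_map_snd f0] snd_cont]
      by (simp add: o_def)
    fix p assume p: "p \<in> topspace ?P"
    define \<theta> w where "\<theta> = fst p" and "w = snd p"
    have \<theta>: "0 \<le> \<theta>" "\<theta> \<le> 1" and w: "w \<in> topspace W" using p by (auto simp: \<theta>_def w_def)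
    note m0 = bar_X_memD[OF mem(1)[OF w]] and m1 = bar_X_memD[OF mem(2)[OF w], folded snd_eq[OF w]]
    have between: "min (fst (f0 w)) (fst (f1 w)) \<le> e p" "e p \<le> max (fst (f0 w)) (fst (f1 w))"
    proof -
      have "(1 - \<theta>) * min (fst (f0 w)) (fst (f1 w)) + \<theta> * min (fst (f0 w)) (fst (f1 w)) \<le> e p"
        unfolding e_def \<theta>_def[symmetric] w_def[symmetric]
        using \<theta> by (intro add_mono mult_left_mono) auto
      then show "min (fst (f0 w)) (fst (f1 w)) \<le> e p" by (simp add: algebra_simps)
      have "e p \<le> (1 - \<theta>) * max (fst (f0 w)) (fst (f1 w)) + \<theta> * max (fst (f0 w)) (fst (f1 w))"
        unfolding e_def \<theta>_def[symmetric] w_def[symmetric]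
        using \<theta> by (intro add_mono mult_left_mono) auto
      then show "e p \<le> max (fst (f0 w)) (fst (f1 w))" by (simp add: algebra_simps)
    qed
    show "(e p, snd (f0 (snd p))) \<in> bar_X d X u"
      unfolding w_def[symmetric]
    proof (rule bar_X_memI[OF _ _ m0(3,4)])
      show "0 < e p" using between(1) m0(1) m1(1) by (auto simp: min_def split: if_splits)
      show "e p \<le> 1" using between(2) m0(2) m1(2) by (auto simp: max_def split: if_splits)
      show "\<exists>m\<in>mspace d - X. snd (f0 w) t = Some m \<and> e p \<le> u m \<and> u m \<le> 1" if "0 < t" "t \<le> 1" for t
      proof -
        obtain m where "m \<in> mspace d - X" "snd (f0 w) t = Some m" "fst (f0 w) \<le> u m"
          using m0(5) \<open>0 < t\<close> \<open>t \<le> 1\<close> by blast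
        moreover obtain m' where "snd (f0 w) t = Some m'" "fst (f1 w) \<le> u m'"
          using m1(5) \<open>0 < t\<close> \<open>t \<le> 1\<close> by blast
        ultimately show ?thesis using u(2) between(2) by (intro bexI[of _ m]) auto
      qed
      show "\<exists>m\<in>X. m \<in> mspace d \<and> e p \<le> u m \<and> u m \<le> 1"
      proof -
        obtain m where m: "m \<in> X" "m \<in> mspace d" "max (fst (f0 w)) (fst (f1 w)) \<le> u m"
          using m0(6) m1(6) by (cases "fst (f0 w) \<le> fst (f1 w)") (auto simp: max_def)
        then show ?thesis using u(2) between(2) by (intro bexI[of _ m]) auto
      qed
    qed
  qed
  moreover have "(e (0, w), snd (f0 w)) = f0 w" "(e (1, w), snd (f0 w)) = f1 w" if "w \<in> topspace W" for w
    using snd_eq[OF that] by (simp_all add: e_def prod_eq_iff)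
  ultimately show ?thesis
    by (subst homotopic_with) (auto intro!: exI[of _ "\<lambda>p. (e p, snd (f0 (snd p)))"])
qed

text \<open>Exchanging the two parameters turns a homotopy of telescopes over \<open>W\<close> into
  a telescope over \<open>W \<times> [0,1]\<close>, so \<open>telescope_realization\<close> applies
  to homotopies as well. The next lemma goes back.\<close>

lemma approaching_swap_last:
  assumes W: "metrizable_space W" and g: "approaching (prod_topology (prod_topology W I01) I01) (B \<times> {0..1}) M X g"
    and B: "B = topspace W \<times> {0}"
  shows "telescope (prod_topology W I01) M X (\<lambda>p. g ((fst (fst p), snd p), snd (fst p)))"
proof -
  let ?P = "prod_topology (prod_topology W I01) I01"
  have m: "metrizable_space ?P" by (intro metrizable_prod_I01 W)
  have "approaching ?P (topspace (prod_topology W I01) \<times> {0}) ?P (B \<times> {0..1})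
      (\<lambda>p. ((fst (fst p), snd p), snd (fst p)))"
    by (rule approaching_continuous[OF m])
      (auto simp: continuous_map_paired continuous_map_fst_fst continuous_map_snd_fst continuous_map_snd B)
  from approaching_compose[OF m this g] show ?thesis by (simp add: o_def)
qed

lemma telescope_swap_last:
  assumes W: "metrizable_space W" and g: "telescope (prod_topology W I01) M X g"
  shows "approaching (prod_topology (prod_topology W I01) I01) ((topspace W \<times> {0}) \<times> {0..1}) M X
    (\<lambda>p. g ((fst (fst p), snd p), snd (fst p)))"
proof -
  let ?P = "prod_topology (prod_topology W I01) I01"
  have m: "metrizable_space ?P" by (intro metrizable_prod_I01 W)
  have "approaching ?P ((topspace W \<times> {0}) \<times> {0..1}) ?P (topspace (prod_topology W I01) \<times> {0})
      (\<lambda>p. ((fst (fst p), snd p), snd (fst p)))"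
    by (rule approaching_continuous[OF m])
      (auto simp: continuous_map_paired continuous_map_fst_fst continuous_map_snd_fst continuous_map_snd)
  from approaching_compose[OF m this g] show ?thesis by (simp add: o_def)
qed

lemma continuous_map_swap: "continuous_map (prod_topology A B) (prod_topology B A) (\<lambda>p. (snd p, fst p))"
  by (simp add: continuous_map_paired continuous_map_fst continuous_map_snd)

text \<open>The homotopy of telescopes is realized by one map \<open>F\<close> on
  \<open>W \<times> [0,1]\<close>. The ends of \<open>F\<close> have the telescopes of
  \<open>f0\<close> and \<open>f1\<close> but possibly other levels, which two further homotopies
  correct.\<close>

lemma homotopic_if_telescope_homotopic:
  assumes adm: "admissible_data M X u H d" and W: "metrizable_space W"
    and f0: "continuous_map W (bar_X_topology d X u) f0"
    and f1: "continuous_map W (bar_X_topology d X u) f1"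
    and hom: "telescope_homotopic W M X (telescope_of f0) (telescope_of f1)"
  shows "homotopic_with (\<lambda>_. True) W (bar_X_topology d X u) f0 f1"
proof -
  let ?B = "bar_X_topology d X u"
  obtain K where K: "approaching (prod_topology (prod_topology W I01) I01) ((topspace W \<times> {0}) \<times> {0..1}) M X K"
    "\<And>m. m \<in> topspace (prod_topology W I01) - topspace W \<times> {0} \<Longrightarrow>
      K (m, 0) = telescope_of f0 m \<and> K (m, 1) = telescope_of f1 m"
    using hom unfolding approaching_homotopic_def by blast
  obtain F where F: "continuous_map (prod_topology W I01) ?B F"
    "\<forall>p \<in> topspace (prod_topology W I01) \<times> {0<..1}. telescope_of F p = K ((fst (fst p), snd p), snd (fst p))"
    by (rule telescope_realization[OF adm metrizable_prod_I01[OF W] approaching_swap_last[OF W K(1) refl]])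
  have cont: "continuous_map W ?B (\<lambda>w. F (w, t))" if "0 \<le> t" "t \<le> 1" for t
  proof -
    have "continuous_map W (prod_topology W I01) (\<lambda>w. (w, t))"
      using that by (simp add: continuous_map_paired)
    from continuous_map_compose[OF this F(1)] show ?thesis by (simp add: o_def)
  qed
  have tel: "telescope_of (\<lambda>w. F (w, \<theta>)) (w, t) = K ((w, t), \<theta>)"
    if "w \<in> topspace W" "0 < t" "t \<le> 1" "0 \<le> \<theta>" "\<theta> \<le> 1" for w t \<theta>
    using F(2)[rule_format, of "((w, \<theta>), t)"] that by (simp add: telescope_of_def)
  have "homotopic_with (\<lambda>_. True) W ?B f0 (\<lambda>w. F (w, 0))"
    by (rule homotopic_if_same_telescope[OF adm f0 cont]) (use tel K(2) in auto)
  moreover have "homotopic_with (\<lambda>_. True) W ?B (\<lambda>w. F (w, 0)) (\<lambda>w. F (w, 1))"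
    using continuous_map_compose[OF continuous_map_swap F(1)]
    by (subst homotopic_with) (auto intro!: exI[of _ "\<lambda>p. F (snd p, fst p)"] simp: o_def)
  moreover have "homotopic_with (\<lambda>_. True) W ?B (\<lambda>w. F (w, 1)) f1"
    by (rule homotopic_if_same_telescope[OF adm cont f1]) (use tel K(2) in auto)
  ultimately show ?thesis using homotopic_with_trans by blast
qed

lemma telescope_homotopic_if_homotopic:
  assumes adm: "admissible_data M X u H d" and W: "metrizable_space W"
    and hom: "homotopic_with (\<lambda>_. True) W (bar_X_topology d X u) f0 f1"
  shows "telescope_homotopic W M X (telescope_of f0) (telescope_of f1)"
proof -
  let ?B = "bar_X_topology d X u"
  obtain k where k: "continuous_map (prod_topology I01 W) ?B k" "\<And>x. k (0, x) = f0 x" "\<And>x. k (1, x) = f1 x"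
    using hom unfolding homotopic_with_def by blast
  have "continuous_map (prod_topology W I01) ?B (\<lambda>p. k (snd p, fst p))"
    using continuous_map_compose[OF continuous_map_swap k(1)] by (simp add: o_def)
  from telescope_swap_last[OF W telescope_telescope_of[OF adm metrizable_prod_I01[OF W] this]]
  show ?thesis
    unfolding approaching_homotopic_def
    by (intro exI conjI) (assumption, simp add: telescope_of_def k)
qed

section \<open>Restriction along an FDR-embedding\<close>

text \<open>\<open>W\<close> and \<open>A\<close> stand here for the images of the given spaces in
  \<open>N\<close>, so that all restrictions are along subspace inclusions. The conditions on
  \<open>\<Phi>\<close> make its end at time 1 an approaching retraction onto \<open>L - A\<close>
  that is approaching homotopic to the identity.\<close>

locale fdr_pair =
  fixes N :: "'n topology" and W A L :: "'n set"
    and hN :: "'n \<times> real \<Rightarrow> 'n" and hL :: "'n \<times> real \<Rightarrow> 'n" and \<Phi> :: "'n \<times> real \<Rightarrow> 'n"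
    and M :: "'m topology" and X :: "'m set" and u :: "'m \<Rightarrow> real"
    and H :: "'m \<times> real \<Rightarrow> 'm" and d :: "'m metric"
  assumes adm: "admissible_data M X u H d"
    and N: "metrizable_space N" and W: "closedin N W" and L: "closedin N L" and LW: "L \<inter> W = A"
    and A: "closedin (subtopology N L) A"
    and hN: "instant_homotopy N W hN" and hL: "instant_homotopy (subtopology N L) A hL"
    and \<Phi>: "approaching (prod_topology N I01) (W \<times> {0..1}) N W \<Phi>"
    and \<Phi>_0: "\<And>x. x \<in> topspace N - W \<Longrightarrow> \<Phi> (x, 0) = x"
    and \<Phi>_1: "\<And>x. x \<in> topspace N - W \<Longrightarrow> \<Phi> (x, 1) \<in> L - A"
    and \<Phi>_L: "\<And>x. x \<in> L - A \<Longrightarrow> \<Phi> (x, 1) = x"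
begin

abbreviation "NL \<equiv> subtopology N L"
abbreviation "NW \<equiv> subtopology N W"
abbreviation "NA \<equiv> subtopology N A"

lemma metrizable_subspaces: "metrizable_space NL" "metrizable_space NW" "metrizable_space NA"
  by (simp_all add: N metrizable_space_subtopology)

lemma topspaces: "topspace NL = L" "topspace NW = W" "topspace NA = A" "A \<subseteq> W" "A \<subseteq> L" "L \<subseteq> topspace N" "W \<subseteq> topspace N"
  using closedin_subset[OF L] closedin_subset[OF W] LW by auto

lemma NA_eq: "subtopology NL A = NA" "subtopology NW A = NA"
  using topspaces(4,5) by (simp_all add: subtopology_subtopology Int_absorb1)

definition \<rho> :: "'n \<Rightarrow> 'n" where "\<rho> x = \<Phi> (x, 1)"

text \<open>Closedness of \<open>L\<close> keeps the subsequential limits in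
  \<open>L \<inter> W\<close>, which is \<open>A\<close>.\<close>

lemma \<rho>: "approaching N W NL A \<rho>"
proof -
  have "approaching N W (prod_topology N I01) (W \<times> {0..1}) (\<lambda>x. (x, 1))"
    by (rule approaching_continuous[OF N]) (auto simp: continuous_map_paired)
  from approaching_compose[OF N this \<Phi>] have "approaching N W N W \<rho>"
    by (simp add: o_def \<rho>_def[abs_def])
  from approaching_into_closed_subspace[OF this N L] show ?thesis
    using \<Phi>_1 by (simp add: LW \<rho>_def)
qed

lemma approaching_inclusion: "approaching NL A N W id"
  by (rule approaching_continuous[OF metrizable_subspaces(1)]) (use LW in auto)

lemma approaching_homotopic_\<rho>:
  assumes "approaching N W M X \<phi>"
  shows "approaching_homotopic N W M X \<phi> (\<phi> \<circ> \<rho>)"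
  unfolding approaching_homotopic_def
  using approaching_compose[OF metrizable_prod_I01[OF N] \<Phi> assms] \<Phi>_0
  by (intro exI[of _ "\<phi> \<circ> \<Phi>"]) (auto simp: \<rho>_def)

lemma approaching_times_inclusion:
  assumes "S \<subseteq> topspace T" "metrizable_space T"
  shows "approaching (prod_topology (subtopology T S) I01) (S \<times> {0}) (prod_topology T I01) (S \<times> {0}) id"
  by (rule approaching_continuous)
    (use assms in \<open>auto simp: metrizable_prod_I01 metrizable_space_subtopology prod_topology_subtopology(1)\<close>)

lemma telescope_hN: "approaching (prod_topology NW I01) (W \<times> {0}) N W hN"
  using approaching_compose[OF metrizable_prod_I01[OF metrizable_subspaces(2)]
      approaching_times_inclusion[OF topspaces(7) N] instant_homotopy_approaching[OF N hN]] by simp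

lemma telescope_hL: "approaching (prod_topology NA I01) (A \<times> {0}) NL A hL"
  using approaching_compose[OF metrizable_prod_I01[OF metrizable_space_subtopology[OF metrizable_subspaces(1)]]
      approaching_times_inclusion[OF closedin_subset[OF A] metrizable_subspaces(1)]
      instant_homotopy_approaching[OF metrizable_subspaces(1) hL]]
  by (simp add: NA_eq)

lemma inclusion_NA_NW: "approaching (prod_topology NA I01) (A \<times> {0}) (prod_topology NW I01) (W \<times> {0}) id"
proof (rule approaching_continuous[OF metrizable_prod_I01[OF metrizable_subspaces(3)]])
  have "continuous_map (prod_topology NA I01) NW fst"
    using continuous_map_fst[of NA I01] topspaces(4)
    by (auto simp: continuous_map_in_subtopology)
  then show "continuous_map (prod_topology NA I01) (prod_topology NW I01) id"
    using continuous_map_paired[of "prod_topology NA I01" NW I01 fst snd] continuous_map_snd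
    by (simp add: id_def)
qed (use topspaces in auto)

lemma telescope_restrict:
  assumes "telescope_homotopic NW M X g g'"
  shows "telescope_homotopic NA M X g g'"
  using approaching_homotopic_compose_right[OF metrizable_prod_I01[OF metrizable_subspaces(3)]
      inclusion_NA_NW, of M X g g'] assms
  by (simp only: topspaces comp_id)

text \<open>The two ways of pushing \<open>A\<close> off \<open>W\<close>, inside \<open>L\<close> and inside \<open>N\<close>, are homotopic through the
  maps \<open>(a, t) \<mapsto> hN (hL (a, (1 - \<theta>) t), \<theta> t)\<close>.\<close>

lemma telescope_homotopic_hL_hN:
  assumes \<phi>: "approaching N W M X \<phi>"
  shows "telescope_homotopic NA M X (\<phi> \<circ> hL) (\<phi> \<circ> hN)"
proof -
  let ?P = "prod_topology (prod_topology NA I01) I01"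
  define J where "J = (\<lambda>p. hN (hL (fst (fst p), (1 - snd p) * snd (fst p)), snd p * snd (fst p)))"
  have mP: "metrizable_space ?P" by (intro metrizable_prod_I01 metrizable_subspaces)
  have "continuous_map ?P NL (\<lambda>p. fst (fst p))"
    using continuous_map_fst_fst[of NA I01 I01] topspaces(5)
    by (auto simp: continuous_map_in_subtopology)
  then have "continuous_map ?P (prod_topology NL I01) (\<lambda>p. (fst (fst p), (1 - snd p) * snd (fst p)))"
    unfolding continuous_map_paired
    by (intro conjI continuous_map_I01_mult continuous_map_I01_compl continuous_map_snd continuous_map_snd_fst)
  from continuous_map_compose[OF this, of NL hL]
  have "continuous_map ?P N (\<lambda>p. hL (fst (fst p), (1 - snd p) * snd (fst p)))"
    using hL by (simp add: o_def instant_homotopy_def continuous_map_in_subtopology)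
  then have "continuous_map ?P (prod_topology N I01)
      (\<lambda>p. (hL (fst (fst p), (1 - snd p) * snd (fst p)), snd p * snd (fst p)))"
    unfolding continuous_map_paired
    by (intro conjI continuous_map_I01_mult continuous_map_snd continuous_map_snd_fst)
  from continuous_map_compose[OF this, of N hN] have J: "continuous_map ?P N J"
    using hN by (simp add: o_def instant_homotopy_def J_def)
  have hL_L: "hL (a, t) \<in> L" if "a \<in> L" "0 \<le> t" "t \<le> 1" for a t
  proof -
    have "hL ` topspace (prod_topology NL I01) \<subseteq> topspace NL"
      by (rule continuous_map_image_subset_topspace) (use hL in \<open>simp add: instant_homotopy_def\<close>)
    then show ?thesis using that topspaces by (auto simp: image_subset_iff)
  qed
  have "approaching ?P ((A \<times> {0}) \<times> {0..1}) N W J"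
  proof (rule approaching_continuous[OF mP J])
    fix p assume p: "p \<in> topspace ?P"
    obtain a t \<theta> where [simp]: "p = ((a, t), \<theta>)" by (metis surj_pair)
    have *: "a \<in> A" "0 \<le> t" "t \<le> 1" "0 \<le> \<theta>" "\<theta> \<le> 1" using p by auto
    have b: "0 \<le> \<theta> * t" "\<theta> * t \<le> 1" "0 \<le> (1 - \<theta>) * t" "(1 - \<theta>) * t \<le> 1"
      using * by (auto simp: mult_le_one)
    have "a \<in> L" using * topspaces by auto
    then have l: "hL (a, (1 - \<theta>) * t) \<in> L" using hL_L b by blast
    \<comment> \<open>A point of \<open>L\<close> lies in \<open>W\<close> exactly when it lies in
      \<open>A\<close>; this turns the condition from \<open>hN\<close> into one on
      \<open>hL\<close>, and both parameters have to vanish.\<close>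
    have "J p \<in> W \<longleftrightarrow> hL (a, (1 - \<theta>) * t) \<in> A \<and> \<theta> * t = 0"
      using instant_homotopy_mem_iff[OF hN, of "hL (a, (1 - \<theta>) * t)" "\<theta> * t"] l b LW topspaces
      by (auto simp: J_def)
    also have "\<dots> \<longleftrightarrow> (1 - \<theta>) * t = 0 \<and> \<theta> * t = 0"
      using instant_homotopy_mem_iff[OF hL, of a "(1 - \<theta>) * t"] b * \<open>a \<in> L\<close> topspaces by auto
    also have "\<dots> \<longleftrightarrow> p \<in> (A \<times> {0}) \<times> {0..1}"
      using * by auto
    finally show "J p \<in> W \<longleftrightarrow> p \<in> (A \<times> {0}) \<times> {0..1}" .
  qed
  from approaching_compose[OF mP this \<phi>]
  have "approaching ?P ((A \<times> {0}) \<times> {0..1}) M X (\<phi> \<circ> J)" .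
  moreover have "(\<phi> \<circ> J) (m, 0) = (\<phi> \<circ> hL) m \<and> (\<phi> \<circ> J) (m, 1) = (\<phi> \<circ> hN) m"
    if m: "m \<in> topspace (prod_topology NA I01) - A \<times> {0}" for m
  proof -
    obtain a t where [simp]: "m = (a, t)" by (metis surj_pair)
    have *: "a \<in> A" "0 \<le> t" "t \<le> 1" using m by auto
    then have "a \<in> L" "a \<in> topspace N" using topspaces by auto
    then have "hL (a, 0) = a" "hL (a, t) \<in> topspace N"
      using hL hL_L[of a t] * topspaces by (auto simp: instant_homotopy_def)
    then show ?thesis using hN by (simp add: J_def instant_homotopy_def)
  qed
  ultimately show ?thesis
    unfolding approaching_homotopic_def by (intro exI[of _ "\<phi> \<circ> J"]) (simp only: topspaces, blast)
qed

section \<open>Extension and uniqueness from \<open>A\<close> to \<open>W\<close>\<close>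

text \<open>Realize \<open>g\<close> up to homotopy by a map \<open>\<phi>\<close> on
  \<open>L - A\<close>, pull it back along \<open>\<rho>\<close> to \<open>N - W\<close>, and
  restrict by \<open>hN\<close>. Over \<open>A\<close>, \<open>hN\<close> may be exchanged for
  \<open>hL\<close>, whose values off parameter 0 lie in \<open>L - A\<close>, where
  \<open>\<rho>\<close> is the identity.\<close>

lemma telescope_extends:
  assumes g: "telescope NA M X g"
  obtains G where "telescope NW M X G" "telescope_homotopic NA M X G g"
proof -
  have mA: "metrizable_space (prod_topology NA I01)" and mW: "metrizable_space (prod_topology NW I01)"
    by (intro metrizable_prod_I01 metrizable_subspaces)+
  obtain \<phi> where \<phi>: "approaching NL A M X \<phi>" "telescope_homotopic NA M X (\<phi> \<circ> hL) g"
    using extend_telescope[OF adm metrizable_subspaces(1) A hL, unfolded NA_eq, OF g] by metis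
  have \<phi>\<rho>: "approaching N W M X (\<phi> \<circ> \<rho>)" by (rule approaching_compose[OF N \<rho> \<phi>(1)])
  have G: "telescope NW M X (\<phi> \<circ> \<rho> \<circ> hN)"
    using approaching_compose[OF mW telescope_hN \<phi>\<rho>] by (simp only: topspaces)
  have 1: "telescope_homotopic NA M X (\<phi> \<circ> \<rho> \<circ> hN) (\<phi> \<circ> \<rho> \<circ> hL)"
    by (rule approaching_homotopic_sym[OF mA telescope_homotopic_hL_hN[OF \<phi>\<rho>]])
  have 2: "telescope_homotopic NA M X (\<phi> \<circ> \<rho> \<circ> hL) (\<phi> \<circ> hL)"
    unfolding topspaces
  proof (rule approaching_homotopic_refl[OF mA])
    show "approaching (prod_topology NA I01) (A \<times> {0}) M X (\<phi> \<circ> \<rho> \<circ> hL)"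
      using approaching_compose[OF mA approaching_compose[OF mA telescope_hL approaching_inclusion] \<phi>\<rho>]
      by simp
    fix m assume "m \<in> topspace (prod_topology NA I01) - A \<times> {0}"
    then have "hL m \<in> L - A"
      using approaching_maps[OF telescope_hL, of m] by auto
    then show "(\<phi> \<circ> \<rho> \<circ> hL) m = (\<phi> \<circ> hL) m" using \<Phi>_L by (simp add: \<rho>_def)
  qed
  from approaching_homotopic_trans[OF mA approaching_homotopic_trans[OF mA 1 2] \<phi>(2)]
  show ?thesis using that G by blast
qed

text \<open>Both telescopes come from maps \<open>\<phi>1\<close>, \<open>\<phi>2\<close> on
  \<open>N - W\<close>. Over \<open>A\<close> the hypothesis makes these homotopic after composition
  with \<open>hL\<close>, hence homotopic on \<open>L - A\<close>. Precomposing with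
  \<open>\<rho>\<close> spreads that homotopy over \<open>N - W\<close>, and \<open>\<rho>\<close>
  can be removed because it is homotopic to the identity.\<close>

lemma telescope_homotopic_extends:
  assumes g1: "telescope NW M X g1" and g2: "telescope NW M X g2"
    and hom: "telescope_homotopic NA M X g1 g2"
  shows "telescope_homotopic NW M X g1 g2"
proof -
  have mA: "metrizable_space (prod_topology NA I01)" and mW: "metrizable_space (prod_topology NW I01)"
    by (intro metrizable_prod_I01 metrizable_subspaces)+
  obtain \<phi>1 where \<phi>1: "approaching N W M X \<phi>1" "telescope_homotopic NW M X (\<phi>1 \<circ> hN) g1"
    using extend_telescope[OF adm N W hN g1] by metis
  obtain \<phi>2 where \<phi>2: "approaching N W M X \<phi>2" "telescope_homotopic NW M X (\<phi>2 \<circ> hN) g2"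
    using extend_telescope[OF adm N W hN g2] by metis
  have on_A: "telescope_homotopic NA M X (\<phi> \<circ> hL) g"
    if "approaching N W M X \<phi>" "telescope_homotopic NW M X (\<phi> \<circ> hN) g" for \<phi> g
    by (rule approaching_homotopic_trans[OF mA telescope_homotopic_hL_hN[OF that(1)]
          telescope_restrict[OF that(2)]])
  have "telescope_homotopic NA M X (\<phi>1 \<circ> hL) (\<phi>2 \<circ> hL)"
    by (rule approaching_homotopic_trans[OF mA approaching_homotopic_trans[OF mA on_A[OF \<phi>1] hom]
          approaching_homotopic_sym[OF mA on_A[OF \<phi>2]]])
  moreover have "approaching NL A M X \<phi>1" "approaching NL A M X \<phi>2"
    using approaching_compose[OF metrizable_subspaces(1) approaching_inclusion] \<phi>1(1) \<phi>2(1)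
    by fastforce+
  ultimately have "approaching_homotopic NL A M X \<phi>1 \<phi>2"
    using approaching_homotopic_if_telescope_homotopic[OF adm metrizable_subspaces(1) A hL, unfolded NA_eq]
    by blast
  then have "approaching_homotopic N W M X (\<phi>1 \<circ> \<rho>) (\<phi>2 \<circ> \<rho>)"
    by (rule approaching_homotopic_compose_right[OF N \<rho>])
  then have "approaching_homotopic N W M X \<phi>1 \<phi>2"
    using approaching_homotopic_trans[OF N] approaching_homotopic_sym[OF N]
      approaching_homotopic_\<rho>[OF \<phi>1(1)] approaching_homotopic_\<rho>[OF \<phi>2(1)] by metis
  from approaching_homotopic_compose_right[OF mW telescope_hN this]
  have "telescope_homotopic NW M X (\<phi>1 \<circ> hN) (\<phi>2 \<circ> hN)" by (simp only: topspaces)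
  then show ?thesis
    using approaching_homotopic_trans[OF mW] approaching_homotopic_sym[OF mW] \<phi>1(2) \<phi>2(2) by metis
qed

lemma map_extends:
  assumes f: "continuous_map NA (bar_X_topology d X u) f"
  obtains F where "continuous_map NW (bar_X_topology d X u) F"
    "homotopic_with (\<lambda>_. True) NA (bar_X_topology d X u) F f"
proof -
  have mA: "metrizable_space (prod_topology NA I01)"
    by (intro metrizable_prod_I01 metrizable_subspaces)
  obtain G where G: "telescope NW M X G" "telescope_homotopic NA M X G (telescope_of f)"
    using telescope_extends[OF telescope_telescope_of[OF adm metrizable_subspaces(3) f]] by metis
  obtain F where F: "continuous_map NW (bar_X_topology d X u) F"
    "\<forall>p \<in> topspace NW \<times> {0<..1}. telescope_of F p = G p"
    by (rule telescope_realization[OF adm metrizable_subspaces(2) G(1)])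
  have FA: "continuous_map NA (bar_X_topology d X u) F"
    using continuous_map_from_subtopology[OF F(1), of A] by (simp add: NA_eq)
  have "telescope_homotopic NA M X (telescope_of F) G"
  proof (rule approaching_homotopic_refl[OF mA telescope_telescope_of[OF adm metrizable_subspaces(3) FA]])
    fix p assume p: "p \<in> topspace (prod_topology NA I01) - topspace NA \<times> {0}"
    have "p \<in> topspace NW \<times> {0<..1}" using p topspaces by auto
    then show "telescope_of F p = G p" using F(2) by blast
  qed
  from homotopic_if_telescope_homotopic[OF adm metrizable_subspaces(3) FA f
      approaching_homotopic_trans[OF mA this G(2)]]
  show ?thesis using that F(1) by blast
qed

lemma map_extension_unique:
  assumes F: "continuous_map NW (bar_X_topology d X u) F" "continuous_map NW (bar_X_topology d X u) F'"
    and hom: "homotopic_with (\<lambda>_. True) NA (bar_X_topology d X u) F F'"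
  shows "homotopic_with (\<lambda>_. True) NW (bar_X_topology d X u) F F'"
  by (intro homotopic_if_telescope_homotopic[OF adm metrizable_subspaces(2) F]
      telescope_homotopic_extends telescope_telescope_of[OF adm metrizable_subspaces(2)] F
      telescope_homotopic_if_homotopic[OF adm metrizable_subspaces(3) hom])

end

section \<open>Transfer from the images in \<open>N\<close> to the given spaces\<close>

lemma embedding_map_inverse:
  assumes "embedding_map A N j"
  obtains k where "continuous_map A (subtopology N (j ` topspace A)) j"
    "continuous_map (subtopology N (j ` topspace A)) A k" "\<forall>a\<in>topspace A. k (j a) = a"
proof -
  obtain k where "homeomorphic_maps A (subtopology N (j ` topspace A)) j k"
    using assms by (auto simp: embedding_map_def homeomorphic_map_maps)
  then show ?thesis using that by (auto simp: homeomorphic_maps_def)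
qed

theorem theorem5p8:
  fixes M :: "'m topology" and X :: "'m set" and u :: "'m \<Rightarrow> real"
    and H :: "'m \<times> real \<Rightarrow> 'm" and d :: "'m metric"
    and A :: "'a topology" and W :: "'w topology"
    and f :: "'a \<Rightarrow> real \<times> (real \<Rightarrow> 'm option)" and i :: "'a \<Rightarrow> 'w"
  assumes "local_compactum (subtopology M X)"
    and "admissible_data M X u H d"
    and "metrizable_space W" and "locally_compact_space W"
    and "fdr_embedding TYPE('n) A W i"
    and "continuous_map A (bar_X_topology d X u) f"
  shows "(\<exists>f'. continuous_map W (bar_X_topology d X u) f' \<and>
            homotopic_with (\<lambda>_. True) A (bar_X_topology d X u) (f' \<circ> i) f) \<and>
         (\<forall>f' f''.
            continuous_map W (bar_X_topology d X u) f' \<and>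
            homotopic_with (\<lambda>_. True) A (bar_X_topology d X u) (f' \<circ> i) f \<and>
            continuous_map W (bar_X_topology d X u) f'' \<and>
            homotopic_with (\<lambda>_. True) A (bar_X_topology d X u) (f'' \<circ> i) f \<longrightarrow>
            homotopic_with (\<lambda>_. True) W (bar_X_topology d X u) f' f'')"
proof -
  let ?B = "bar_X_topology d X u"
  have i: "embedding_map A W i" and incl: "fdr_inclusion TYPE('n) W (i ` topspace A)"
    using assms(5) by (auto simp: fdr_embedding_def)
  obtain N :: "'n topology" and j W' A' L \<Phi> where *: "embedding_map W N j"
    "W' = j ` topspace W" "A' = j ` i ` topspace A"
    "absolute_retract N" "homotopy_negligible N W'" "closedin N L" "L \<inter> W' = A'"
    "homotopy_negligible (subtopology N L) A'"
    "approaching (prod_topology N I01) (W' \<times> {0..1}) N W' \<Phi>"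
    "\<forall>x\<in>topspace N - W'. \<Phi> (x, 0) = x"
    "(\<lambda>x. \<Phi> (x, 1)) ` (topspace N - W') = L - A'"
    "\<forall>t\<in>{0..1}. \<forall>x\<in>L - A'. \<Phi> (x, t) = x"
    using incl[unfolded fdr_inclusion_def] by (elim conjE exE) (rule that; assumption)
  note j = *(1) and N = *(4) and neg = *(5,8)[unfolded homotopy_negligible_def *(2,3)]
    and L = *(6,7)[unfolded *(2,3)] and \<Phi> = *(9-12)[unfolded *(2,3)]
  obtain hN hL where h: "instant_homotopy N (j ` topspace W) hN"
    "instant_homotopy (subtopology N L) (j ` i ` topspace A) hL"
    using neg by blast
  interpret fdr_pair N "j ` topspace W" "j ` i ` topspace A" L hN hL \<Phi> M X u H d
  proof
    show "metrizable_space N" using N by (simp add: absolute_retract_def)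
    show "\<Phi> (x, 1) \<in> L - j ` i ` topspace A" if "x \<in> topspace N - j ` topspace W" for x
      using \<Phi>(3) that by blast
    show "\<Phi> (x, 1) = x" if "x \<in> L - j ` i ` topspace A" for x
      using \<Phi>(4) that by simp
    show "\<Phi> (x, 0) = x" if "x \<in> topspace N - j ` topspace W" for x
      using \<Phi>(2) that by blast
  qed (use assms(2) L neg h \<Phi>(1) in simp_all)
  obtain k where k: "continuous_map W NW j" "continuous_map NW W k" "\<forall>w\<in>topspace W. k (j w) = w"
    by (rule embedding_map_inverse[OF j])
  have "embedding_map A N (j \<circ> i)" by (rule embedding_map_compose[OF i j])
  then obtain l where l: "continuous_map A NA (j \<circ> i)" "continuous_map NA A l"
    "\<forall>a\<in>topspace A. l ((j \<circ> i) a) = a"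
    using embedding_map_inverse[of A N "j \<circ> i"] unfolding image_comp by metis
  have i_W: "i a \<in> topspace W" if "a \<in> topspace A" for a
    using assms(5) that closedin_subset unfolding fdr_embedding_def by blast
  show ?thesis
  proof (intro conjI allI impI)
    \<comment> \<open>The inverse \<open>l\<close> moves \<open>f\<close> to the image of
      \<open>A\<close> in \<open>N\<close>; the extension found there is pulled back along
      \<open>j\<close>.\<close>
    obtain F where F: "continuous_map NW ?B F" "homotopic_with (\<lambda>_. True) NA ?B F (f \<circ> l)"
      using map_extends[OF continuous_map_compose[OF l(2) assms(6)]] by metis
    have "homotopic_with (\<lambda>_. True) A ?B (F \<circ> (j \<circ> i)) (f \<circ> l \<circ> (j \<circ> i))"
      by (rule homotopic_with_compose_continuous_map_right[OF F(2) l(1)]) simp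
    then have "homotopic_with (\<lambda>_. True) A ?B (F \<circ> j \<circ> i) f"
      by (rule homotopic_with_eq) (use l(3) in auto)
    moreover have "continuous_map W ?B (F \<circ> j)"
      by (rule continuous_map_compose[OF k(1) F(1)])
    ultimately show "\<exists>f'. continuous_map W ?B f' \<and> homotopic_with (\<lambda>_. True) A ?B (f' \<circ> i) f"
      by blast
  next
    fix f' f''
    assume *: "continuous_map W ?B f' \<and> homotopic_with (\<lambda>_. True) A ?B (f' \<circ> i) f \<and>
      continuous_map W ?B f'' \<and> homotopic_with (\<lambda>_. True) A ?B (f'' \<circ> i) f"
    then have "homotopic_with (\<lambda>_. True) A ?B (f' \<circ> i) (f'' \<circ> i)"
      using homotopic_with_trans homotopic_with_symD by metis
    from homotopic_with_compose_continuous_map_right[OF this l(2)]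
    have "homotopic_with (\<lambda>_. True) NA ?B (f' \<circ> i \<circ> l) (f'' \<circ> i \<circ> l)" by simp
    \<comment> \<open>Points of \<open>NA\<close> have the form \<open>j (i a)\<close>, and both
      \<open>i \<circ> l\<close> and \<open>k\<close> send such a point to
      \<open>i a\<close>.\<close>
    then have "homotopic_with (\<lambda>_. True) NA ?B (f' \<circ> k) (f'' \<circ> k)"
      by (rule homotopic_with_eq) (use l(3) k(3) i_W in auto)
    then have "homotopic_with (\<lambda>_. True) NW ?B (f' \<circ> k) (f'' \<circ> k)"
      using * k(2) by (intro map_extension_unique) (auto intro: continuous_map_compose)
    from homotopic_with_compose_continuous_map_right[OF this k(1)]
    have "homotopic_with (\<lambda>_. True) W ?B (f' \<circ> k \<circ> j) (f'' \<circ> k \<circ> j)" by simp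
    then show "homotopic_with (\<lambda>_. True) W ?B f' f''"
      by (rule homotopic_with_eq) (use k(3) in auto)
  qed
qed

end
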